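(* Let $d\ge2$ be an integer. Then there is a constant $C(d)$ depending only on $d$ such that, whenever $n\in\mathbb{N}$, $\mu$ is a log-concave probability measure on $\mathbb{R}^n$ and $f$ is a polynomial of degree $d$ on $\mathbb{R}^n$, for every function $\varphi\in C_b^\infty(\mathbb{R})$ with $\|\varphi\|_\infty\le1$ one has $$\sigma_f^{1/d}\int\varphi'(f)\,d\mu\le C(d)\,\|\varphi'\|_\infty^{1-1/d}.$$
   Context: A Borel probability measure on $\mathbb{R}^n$ is log-concave if it has a density $e^{-V}$ with respect to Lebesgue measure on some affine subspace $L$, where $V\colon L\to(-\infty,+\infty]$ is convex. $\sigma_f^2=\int(f-\int f\,d\mu)^2d\mu$ is the variance of $f$. $C_b^\infty(\mathbb{R})$ is the space of bounded smooth functions with bounded derivatives of all orders; $\|\varphi\|_\infty=\sup_t|\varphi(t)|$. *)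

theory Defs
  imports "HOL-Analysis.Analysis" "HOL-Probability.Probability"
begin

definition Rn :: "nat \<Rightarrow> (nat \<Rightarrow> real) set" where
  "Rn n = PiE {..<n} (\<lambda>_. UNIV)"

definition lebRn :: "nat \<Rightarrow> (nat \<Rightarrow> real) measure" where
  "lebRn n = PiM {..<n} (\<lambda>_. lborel)"

definition comb :: "nat \<Rightarrow> real \<Rightarrow> (nat \<Rightarrow> real) \<Rightarrow> (nat \<Rightarrow> real) \<Rightarrow> (nat \<Rightarrow> real)" where
  "comb n t x y = restrict (\<lambda>j. t * x j + (1 - t) * y j) {..<n}"

definition affmap :: "nat \<Rightarrow> nat \<Rightarrow> (nat \<Rightarrow> real) \<Rightarrow> (nat \<Rightarrow> nat \<Rightarrow> real) \<Rightarrow> (nat \<Rightarrow> real) \<Rightarrow> (nat \<Rightarrow> real)" where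
  "affmap n k a b y = restrict (\<lambda>j. a j + (\<Sum>i<k. y i * b i j)) {..<n}"

text \<open>A Borel probability measure on R^n is log-concave if it has a density exp(-V) with respect
  to Lebesgue measure on some affine subspace L (parametrised injectively by an affine map from R^k),
  where V : L -> (-infinity, +infinity] is convex.\<close>
definition log_concave :: "nat \<Rightarrow> (nat \<Rightarrow> real) measure \<Rightarrow> bool" where
  "log_concave n \<mu> \<longleftrightarrow> prob_space \<mu> \<and>
     (\<exists>k a b V.
        a \<in> Rn n \<and> (\<forall>i<k. b i \<in> Rn n) \<and>
        inj_on (affmap n k a b) (Rn k) \<and>
        (let L = affmap n k a b ` Rn k in
          (\<forall>x\<in>L. V x \<noteq> (-\<infinity> :: ereal)) \<and>
          (\<forall>x\<in>L. \<forall>y\<in>L. \<forall>t\<in>{0..1}.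
              V (comb n t x y) \<le> ereal t * V x + ereal (1 - t) * V y)) \<and>
        \<mu> = distr (density (lebRn k)
                 (\<lambda>y. if V (affmap n k a b y) = \<infinity> then 0
                      else ennreal (exp (- real_of_ereal (V (affmap n k a b y))))))
               (lebRn n) (affmap n k a b))"

definition poly_deg_le :: "nat \<Rightarrow> nat \<Rightarrow> ((nat \<Rightarrow> real) \<Rightarrow> real) \<Rightarrow> bool" where
  "poly_deg_le n d f \<longleftrightarrow>
     (\<exists>A c. finite A \<and> (\<forall>\<alpha>\<in>A. (\<Sum>i<n. \<alpha> i) \<le> d) \<and>
        (\<forall>x. f x = (\<Sum>\<alpha>\<in>A. c \<alpha> * (\<Prod>i<n. x i ^ \<alpha> i))))"

definition var :: "'a measure \<Rightarrow> ('a \<Rightarrow> real) \<Rightarrow> real" where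
  "var \<mu> f = (\<integral>x. (f x - (\<integral>y. f y \<partial>\<mu>))\<^sup>2 \<partial>\<mu>)"

definition Cb_inf :: "(real \<Rightarrow> real) \<Rightarrow> bool" where
  "Cb_inf \<phi> \<longleftrightarrow> (\<exists>D :: nat \<Rightarrow> real \<Rightarrow> real. D 0 = \<phi> \<and>
      (\<forall>k x. (D k has_real_derivative D (Suc k) x) (at x)) \<and>
      (\<forall>k. bounded (range (D k))))"

definition sup_norm :: "(real \<Rightarrow> real) \<Rightarrow> real" where
  "sup_norm g = (SUP t. \<bar>g t\<bar>)"

end

(*
A log-concave measure is cut by hyperplanes into thin convex cells on which a given quantile of f
is the same as for the whole measure (needle decomposition in the sense of Lovasz-Simonovits).
On a thin cell f is almost a polynomial of one coordinate, whose law is log-concave by the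
Prekopa-Leindler inequality, so only one-dimensional estimates are needed.  In dimension one, an
interval on which a polynomial g oscillates by omega carries a derivative of order k <= d that is
uniformly large, and van der Corput's argument bounds the integral of phi'(g); summation over the
level sets of the density gives M^(1-1/d) omega^(-1/d) on a needle, where M bounds phi'.

Fixing P(f <= m) on the needles makes omega comparable to |f - m|, so averaging over needles costs
the integral of |f - m|^(-1/d).  For a badly chosen m this can be infinite, but 1/d < 1, so the average over m
between the quartiles of f is finite and some level m is good.  The distance of the quartiles
dominates the standard deviation, again by needle decomposition.
*)

theory Submission
  imports Defs "HOL-Computational_Algebra.Polynomial"
begin

section \<open>Oscillatory integrals of polynomials\<close>

text \<open>The potential is merely convex, so it may jump upwards arbitrarily at the boundary of
  its domain, and the given density need not be Borel measurable; a log-concave Borel version with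
  the same law has to be built before anything can be cut or integrated. Cutting in turn needs
  bounded densities on a box. These are obtained by truncation, so every estimate must be uniform in
  the size of the box and in the bound of the density. Needles are never limits of cells. Finitely
  many bisections through grid points already force each cell to be close to a segment, and the
  error \<eta> made by replacing f by a polynomial of one coordinate enters additively, multiplied
  by a Lipschitz constant of phi'. It disappears when \<eta> tends to 0 after summation over the
  cells, so the size of phi'' leaves no trace in the constant. The weight |f - m|^(-1/d) is
  unbounded, whereas bisection handles functions that are bounded on a box. It is therefore cut off
  at the scale 1/M: where |f - m| is smaller, the trivial bound M for phi' is no worse than
  M^(1-1/d) times the capped weight.\<close>

abbreviation pd :: "nat \<Rightarrow> real poly \<Rightarrow> real poly" where
  "pd k P \<equiv> (pderiv ^^ k) P"

section \<open>Taylor expansion and a derivative of uniform size\<close>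

lemma pd_add: "pd i (pd j P) = pd (i + j) P"
  by (simp add: funpow_add)

lemma poly_taylor:
  fixes P :: "real poly"
  assumes "degree P \<le> d"
  shows "poly P y = (\<Sum>m\<le>d. poly (pd m P) x / fact m * (y - x) ^ m)"
proof -
  have D: "\<forall>m t. ((\<lambda>t. poly (pd m P) (x + t)) has_real_derivative poly (pd (Suc m) P) (x + t)) (at t)"
    by (auto intro!: derivative_eq_intros)
  have "\<exists>t. \<bar>t\<bar> \<le> \<bar>y - x\<bar> \<and> poly P (x + (y - x)) =
      (\<Sum>m<Suc d. poly (pd m P) (x + 0) / fact m * (y - x) ^ m)
      + poly (pd (Suc d) P) (x + t) / fact (Suc d) * (y - x) ^ Suc d"
    by (rule Maclaurin_all_le[OF _ D]) auto
  \<comment> \<open>The Lagrange remainder carries a derivative of order d + 1, so the expansion is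
    exact.\<close>
  moreover have "pd (Suc d) P = 0"
  proof -
    have "degree (pd d P) = 0" using assms by (simp add: degree_higher_pderiv)
    then show ?thesis by (simp add: pderiv_eq_0_iff)
  qed
  ultimately show ?thesis by (simp add: lessThan_Suc_atMost)
qed

text \<open>The ratio 1/8 is fixed for the whole section. Its geometric sum 1/7 is small enough that
  two deviations from the value at the left endpoint stay below a full oscillation, and that one
  deviation leaves more than half of a value.\<close>

lemma sum_eighth: "(\<Sum>m=1..d. (1/8::real) ^ m) \<le> 1/7"
proof -
  have "(\<Sum>m=1..d. (1/8::real) ^ m) = 1/7 - (1/7) * (1/8) ^ d"
  proof (induction d)
    case (Suc d)
    define a :: real where "a = (1/8) ^ d"
    have "(\<Sum>m=1..Suc d. (1/8::real) ^ m) = (\<Sum>m=1..d. (1/8) ^ m) + 1/8 * a" by (simp add: a_def)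
    also have "\<dots> = 1/7 - (1/7) * (1/8 * a)" unfolding Suc.IH by (simp flip: a_def)
    finally show ?case by (simp add: a_def)
  qed simp
  then show ?thesis by simp
qed

text \<open>Taylor expansion at the left endpoint: the scaled derivatives are dominated by a
  geometric sequence. Scaling by powers of v - u makes the condition invariant under affine changes
  of the variable.\<close>

lemma poly_variation_bound:
  fixes P :: "real poly"
  assumes dg: "degree P \<le> d" and "u < v" "z \<in> {u..v}"
    and b: "\<And>m. m \<ge> 1 \<Longrightarrow> \<bar>poly (pd m P) u\<bar> * (v - u) ^ m \<le> B * (1/8) ^ m" and "0 \<le> B"
  shows "\<bar>poly P z - poly P u\<bar> \<le> B / 7"
proof -
  have "poly P z - poly P u = (\<Sum>m=1..d. poly (pd m P) u / fact m * (z - u) ^ m)"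
    unfolding poly_taylor[OF dg, of z u]
    by (simp add: sum.atMost_shift sum.atLeast1_atMost_eq)
  also have "\<bar>\<dots>\<bar> \<le> (\<Sum>m=1..d. B * (1/8) ^ m)"
  proof (rule order.trans[OF sum_abs sum_mono])
    fix m assume m: "m \<in> {1..d}"
    have "\<bar>poly (pd m P) u / fact m * (z - u) ^ m\<bar> = \<bar>poly (pd m P) u\<bar> * ((z - u) ^ m / fact m)"
      using assms by (simp add: abs_mult power_abs)
    also have "\<dots> \<le> \<bar>poly (pd m P) u\<bar> * (v - u) ^ m"
    proof (rule mult_left_mono)
      have "(z - u) ^ m / fact m \<le> (z - u) ^ m / 1"
        using assms by (intro divide_left_mono) auto
      also have "\<dots> \<le> (v - u) ^ m" using assms by (auto intro!: power_mono)
      finally show "(z - u) ^ m / fact m \<le> (v - u) ^ m" .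
    qed auto
    also have "\<dots> \<le> B * (1/8) ^ m" using b m by auto
    finally show "\<bar>poly (pd m P) u / fact m * (z - u) ^ m\<bar> \<le> B * (1/8) ^ m" .
  qed
  also have "\<dots> = B * (\<Sum>m=1..d. (1/8) ^ m)" by (simp add: sum_distrib_left)
  also have "\<dots> \<le> B * (1/7)" by (intro mult_left_mono sum_eighth) fact
  finally show ?thesis by simp
qed

text \<open>If every scaled derivative at u were below its threshold \<omega> / 8^j, then P would
  vary by at most 2/7 of \<omega>, too little. For the largest order k at which the threshold is
  reached, all higher derivatives are small, so the k-th one keeps half of its size on the entire
  interval. The bound on the next order serves the case k = 1, where a lower bound on P' alone does
  not control the integral.\<close>

lemma large_derivative:
  fixes P :: "real poly"
  assumes dg: "degree P \<le> d" and uv: "u < v" and xy: "x \<in> {u..v}" "y \<in> {u..v}"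
    and om: "0 < \<omega>" "\<omega> \<le> poly P y - poly P x"
  obtains k where "1 \<le> k" "k \<le> d"
    "\<And>z. z \<in> {u..v} \<Longrightarrow> (1/8) ^ k / 2 * \<omega> / (v - u) ^ k \<le> \<bar>poly (pd k P) z\<bar>"
    "\<And>z. z \<in> {u..v} \<Longrightarrow> \<bar>poly (pd (Suc k) P) z\<bar> \<le> (1/8) ^ k * \<omega> / (v - u) ^ Suc k"
proof -
  define b where "b = (\<lambda>j. \<bar>poly (pd j P) u\<bar> * (v - u) ^ j)"
  define S where "S = {k. 1 \<le> k \<and> k \<le> d \<and> b k \<ge> (1/8) ^ k * \<omega>}"
  have fin: "finite S" unfolding S_def by auto
  have zero: "pd j P = 0" if "j > d" for j
  proof -
    define i where "i = j - 1"
    have i: "j = Suc i" "i \<ge> d" using that by (auto simp: i_def)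
    have "degree (pd i P) = 0" using dg i by (simp add: degree_higher_pderiv)
    then show ?thesis using i by (simp add: pderiv_eq_0_iff)
  qed
  have small: "b j \<le> \<omega> * (1/8) ^ j" if "j \<notin> S" "1 \<le> j" for j
  proof (cases "j \<le> d")
    case True then show ?thesis using that unfolding S_def by (auto simp: mult.commute)
  next
    case False then show ?thesis using zero[of j] om by (simp add: b_def)
  qed
  have "S \<noteq> {}"
  proof
    assume e: "S = {}"
    have "\<bar>poly P z - poly P u\<bar> \<le> \<omega> / 7" if "z \<in> {u..v}" for z
      using dg uv that by (rule poly_variation_bound) (use small om e in \<open>auto simp: b_def\<close>)
    from this[OF xy(1)] this[OF xy(2)] show False using om by auto
  qed
  \<comment> \<open>The largest element, so that every higher order falls below its
    threshold.\<close>
  define k where "k = Max S"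
  have kS: "k \<in> S" using Max_in[OF fin \<open>S \<noteq> {}\<close>] by (simp add: k_def)
  have big: "b j \<le> \<omega> * (1/8) ^ j" if "j > k" for j
    using small[of j] that Max_ge[OF fin, of j] by (force simp: k_def)
  have l: "v - u > 0" using uv by simp
  define B where "B = (1/8) ^ k * \<omega> / (v - u) ^ k"
  have B: "0 \<le> B" using l om by (simp add: B_def)
  have v1: "\<bar>poly (pd k P) z - poly (pd k P) u\<bar> \<le> B / 7" if "z \<in> {u..v}" for z
  proof (rule poly_variation_bound[OF _ uv that _ B])
    show "degree (pd k P) \<le> d" using dg by (simp add: degree_higher_pderiv)
    fix m :: nat assume "1 \<le> m"
    then have "b (m + k) \<le> \<omega> * (1/8) ^ (m + k)" by (intro big) auto
    then have "\<bar>poly (pd (m+k) P) u\<bar> * (v - u) ^ m * (v - u) ^ k \<le> \<omega> * (1/8) ^ m * (1/8) ^ k"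
      by (simp add: b_def power_add algebra_simps)
    then show "\<bar>poly (pd m (pd k P)) u\<bar> * (v - u) ^ m \<le> B * (1/8) ^ m"
      unfolding pd_add B_def using l by (simp add: field_simps)
  qed
  define B2 where "B2 = (1/8) ^ Suc k * \<omega> / (v - u) ^ Suc k"
  have B2: "0 \<le> B2" using l om by (simp add: B2_def)
  have v2: "\<bar>poly (pd (Suc k) P) z - poly (pd (Suc k) P) u\<bar> \<le> B2 / 7" if "z \<in> {u..v}" for z
  proof (rule poly_variation_bound[OF _ uv that _ B2])
    show "degree (pd (Suc k) P) \<le> d"
      using dg degree_higher_pderiv[of "Suc k" P] by simp
    fix m :: nat assume "1 \<le> m"
    then have "b (m + Suc k) \<le> \<omega> * (1/8) ^ (m + Suc k)" by (intro big) auto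
    then have "\<bar>poly (pd (m+Suc k) P) u\<bar> * (v - u) ^ m * (v - u) ^ Suc k \<le> \<omega> * (1/8) ^ m * (1/8) ^ Suc k"
      by (simp only: b_def power_add ac_simps)
    then show "\<bar>poly (pd m (pd (Suc k) P)) u\<bar> * (v - u) ^ m \<le> B2 * (1/8) ^ m"
      unfolding pd_add B2_def using l by (simp add: field_simps)
  qed
  have u1: "\<bar>poly (pd k P) u\<bar> \<ge> B"
    using kS l unfolding S_def b_def B_def by (simp add: field_simps)
  have "b (Suc k) \<le> \<omega> * (1/8) ^ Suc k" by (rule big) simp
  then have u2: "\<bar>poly (pd (Suc k) P) u\<bar> \<le> B2"
    using l unfolding b_def B2_def by (simp add: pos_le_divide_eq mult.commute)
  show ?thesis
  proof (rule that[of k])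
    show "1 \<le> k" "k \<le> d" using kS by (auto simp: S_def)
    fix z assume z: "z \<in> {u..v}"
    have "B / 2 \<le> \<bar>poly (pd k P) z\<bar>" using v1[OF z] u1 B by linarith
    then show "(1/8) ^ k / 2 * \<omega> / (v - u) ^ k \<le> \<bar>poly (pd k P) z\<bar>" by (simp add: B_def)
    \<comment> \<open>One factor 8 converts the threshold of order k + 1 into the power of 1/8 that
      belongs to order k.\<close>
    have "\<bar>poly (pd (Suc k) P) z\<bar> \<le> 8 * B2" using v2[OF z] u2 B2 by linarith
    then show "\<bar>poly (pd (Suc k) P) z\<bar> \<le> (1/8) ^ k * \<omega> / (v - u) ^ Suc k" by (simp add: B2_def)
  qed
qed

section \<open>Test functions and van der Corput's estimate\<close>

text \<open>D is a separate argument because the estimates are applied to several families: the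
  given function, its reflections, and arctangents. M is any bound of D, not necessarily the least
  one.\<close>

definition test_fun :: "(real \<Rightarrow> real) \<Rightarrow> (real \<Rightarrow> real) \<Rightarrow> real \<Rightarrow> bool" where
  "test_fun \<phi> D M \<longleftrightarrow> (\<forall>x. (\<phi> has_real_derivative D x) (at x)) \<and> continuous_on UNIV D
     \<and> (\<forall>x. \<bar>\<phi> x\<bar> \<le> 1) \<and> (\<forall>x. \<bar>D x\<bar> \<le> M)"

text \<open>Replacing P by -P and \<phi> by its reflection leaves the integrand D(P) unchanged. A
  negative derivative of order k is thereby reduced to a positive one.\<close>

lemma test_fun_reflect:
  assumes "test_fun \<phi> D M"
  shows "test_fun (\<lambda>t. - \<phi> (- t)) (\<lambda>t. D (- t)) M"
proof -
  have d: "(\<phi> has_real_derivative D x) (at x)" and c: "continuous_on UNIV D"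
    and b: "\<bar>\<phi> x\<bar> \<le> 1" "\<bar>D x\<bar> \<le> M" for x
    using assms by (auto simp: test_fun_def)
  have "((\<lambda>t. - \<phi> (- t)) has_real_derivative D (- x)) (at x)" for x
    using DERIV_minus[OF DERIV_chain2[OF d DERIV_minus[OF DERIV_ident]], of x] by simp
  moreover have "continuous_on UNIV (\<lambda>t. D (- t))"
    by (rule continuous_on_compose2[OF c]) (auto intro!: continuous_intros)
  ultimately show ?thesis using b by (simp add: test_fun_def)
qed

lemma test_fun_cont:
  assumes "test_fun \<phi> D M"
  shows "continuous_on A (\<lambda>x. D (poly P x))"
proof -
  have "continuous_on UNIV D" using assms by (simp add: test_fun_def)
  then show ?thesis by (rule continuous_on_compose2) (auto intro!: continuous_intros)
qed

lemma test_fun_bound: "test_fun \<phi> D M \<Longrightarrow> D x \<le> M"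
  using abs_le_D1 unfolding test_fun_def by blast

lemma test_fun_integrable: "test_fun \<phi> D M \<Longrightarrow> (\<lambda>x. D (poly P x)) integrable_on {u..v}"
  by (intro integrable_continuous_interval test_fun_cont)

text \<open>Stands in for integration by parts: F is the boundary term, and the leftover integrand
  is absorbed in the inequality between h and the derivative of F.\<close>

lemma integral_le_increment:
  fixes h F :: "real \<Rightarrow> real"
  assumes "u \<le> v" "h integrable_on {u..v}"
    "\<And>x. x \<in> {u..v} \<Longrightarrow> (F has_real_derivative F' x) (at x)"
    "\<And>x. x \<in> {u..v} \<Longrightarrow> h x \<le> F' x"
  shows "integral {u..v} h \<le> F v - F u"
proof -
  have "(F' has_integral (F v - F u)) {u..v}"
    using assms by (intro fundamental_theorem_of_calculus)
      (auto simp: has_real_derivative_iff_has_vector_derivative[symmetric] intro: DERIV_subset)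
  with assms show ?thesis by (metis has_integral_le integrable_integral)
qed

text \<open>Integration by parts against 1 / P'. The shift by 1 makes the numerator of
  \<open>F\<close> nonpositive; for convex P the leftover term then has a favourable sign, which
  takes the place of a bound on P''.\<close>

lemma integral_monotone_phase:
  assumes t: "test_fun \<phi> D M" and uv: "u \<le> v" and e: "0 < \<epsilon>"
    and a: "\<And>x. x \<in> {u..v} \<Longrightarrow> \<epsilon> \<le> \<bar>poly (pd 1 P) x\<bar>"
    and c: "\<And>x. x \<in> {u..v} \<Longrightarrow> 0 \<le> poly (pd 2 P) x"
  shows "integral {u..v} (\<lambda>x. D (poly P x)) \<le> 4 / \<epsilon>"
proof -
  define F where "F = (\<lambda>x. (\<phi> (poly P x) - 1) / poly (pd 1 P) x)"
  define F' where "F' = (\<lambda>x. D (poly P x) - (\<phi> (poly P x) - 1) * poly (pd 2 P) x / (poly (pd 1 P) x)^2)"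
  have nz: "poly (pd 1 P) x \<noteq> 0" if "x \<in> {u..v}" for x using a[OF that] e by auto
  have d: "\<And>y. (\<phi> has_real_derivative D y) (at y)" and bd: "\<And>y. \<bar>\<phi> y\<bar> \<le> 1"
    using t unfolding test_fun_def by blast+
  have Fb: "\<bar>F x\<bar> \<le> 2 / \<epsilon>" if "x \<in> {u..v}" for x
  proof -
    have "\<bar>F x\<bar> = \<bar>\<phi> (poly P x) - 1\<bar> / \<bar>poly (pd 1 P) x\<bar>" by (simp add: F_def)
    also have "\<dots> \<le> 2 / \<epsilon>" using bd[of "poly P x"] by (intro frac_le e a that) auto
    finally show ?thesis .
  qed
  have "integral {u..v} (\<lambda>x. D (poly P x)) \<le> F v - F u"
  proof (rule integral_le_increment[OF uv test_fun_integrable[OF t]])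
    fix x assume x: "x \<in> {u..v}"
    have "((\<lambda>x. \<phi> (poly P x)) has_real_derivative D (poly P x) * poly (pderiv P) x) (at x)"
      by (rule DERIV_chain2[OF d poly_DERIV])
    then show "(F has_real_derivative F' x) (at x)"
      unfolding F_def F'_def using nz[OF x]
      by (auto intro!: derivative_eq_intros simp: field_simps power2_eq_square numeral_2_eq_2)
    have "(\<phi> (poly P x) - 1) * poly (pd 2 P) x / (poly (pd 1 P) x)^2 \<le> 0"
      using bd[of "poly P x"] c[OF x] by (intro divide_nonpos_nonneg mult_nonpos_nonneg) auto
    then show "D (poly P x) \<le> F' x" by (simp add: F'_def)
  qed
  also have "\<dots> \<le> 4 / \<epsilon>" using Fb[of u] Fb[of v] uv by auto
  finally show ?thesis .
qed

text \<open>With slope at least \<kappa>, q is within \<epsilon> of zero only at distance at most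
  \<epsilon> / \<kappa> from its zero. The disjunctions cover the cases where the zero is near or
  beyond an endpoint and a side piece shrinks to a point.\<close>

lemma split_increasing:
  fixes q :: "real \<Rightarrow> real"
  assumes uv: "u \<le> v" and e: "0 < \<epsilon>" "0 < \<kappa>"
    and q: "\<And>x. (q has_real_derivative q' x) (at x)" and q': "\<And>x. x \<in> {u..v} \<Longrightarrow> \<kappa> \<le> q' x"
  obtains s t where "u \<le> s" "s \<le> t" "t \<le> v" "t - s \<le> 2 * \<epsilon> / \<kappa>"
    "s = u \<or> (\<forall>x\<in>{u..s}. q x \<le> - \<epsilon>)" "t = v \<or> (\<forall>x\<in>{t..v}. \<epsilon> \<le> q x)"
proof -
  have inc: "q y - q x \<ge> \<kappa> * (y - x)" if "u \<le> x" "x \<le> y" "y \<le> v" for x y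
  proof (cases "x = y")
    case False
    then have "x < y" using that by simp
    then obtain z where "z > x" "z < y" "q y - q x = (y - x) * q' z"
      using MVT2[of x y q q'] q by auto
    with q'[of z] that show ?thesis by (simp add: mult.commute mult_left_mono)
  qed simp
  \<comment> \<open>If q has no zero, z is the endpoint at which q is closest to zero.\<close>
  have "\<exists>z\<in>{u..v}. (z = u \<or> q z \<le> 0) \<and> (z = v \<or> 0 \<le> q z)"
  proof -
    consider "q u \<ge> 0" | "q v \<le> 0" | "q u \<le> 0" "0 \<le> q v" by linarith
    then show ?thesis
    proof cases
      case 3
      have "continuous_on {u..v} q" using q
        by (intro continuous_at_imp_continuous_on) (auto intro: DERIV_isCont)
      then obtain z where "u \<le> z" "z \<le> v" "q z = 0" using IVT'[of q u 0 v] 3 uv by auto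
      then show ?thesis by (intro bexI[of _ z]) auto
    qed (use uv in auto)
  qed
  then obtain z where z: "z \<in> {u..v}" "z = u \<or> q z \<le> 0" "z = v \<or> 0 \<le> q z" by blast
  define s t where "s = max u (z - \<epsilon> / \<kappa>)" and "t = min v (z + \<epsilon> / \<kappa>)"
  have p: "\<epsilon> / \<kappa> > 0" using e by simp
  show ?thesis
  proof (rule that[of s t])
    show "u \<le> s" "s \<le> t" "t \<le> v" using z p uv by (auto simp: s_def t_def)
    show "t - s \<le> 2 * \<epsilon> / \<kappa>" by (simp add: s_def t_def)
    show "s = u \<or> (\<forall>x\<in>{u..s}. q x \<le> - \<epsilon>)"
    proof (cases "s = u")
      case False
      then have s: "s = z - \<epsilon> / \<kappa>" "z \<noteq> u" using z p by (auto simp: s_def max_def split: if_splits)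
      have "q x \<le> - \<epsilon>" if "x \<in> {u..s}" for x
      proof -
        have "\<kappa> * (\<epsilon> / \<kappa>) \<le> \<kappa> * (z - x)" using that s e by (intro mult_left_mono) auto
        also have "\<dots> \<le> q z - q x" using that s z p by (intro inc) auto
        finally show ?thesis using z s e by auto
      qed
      then show ?thesis by blast
    qed auto
    show "t = v \<or> (\<forall>x\<in>{t..v}. \<epsilon> \<le> q x)"
    proof (cases "t = v")
      case False
      then have s: "t = z + \<epsilon> / \<kappa>" "z \<noteq> v" using z p by (auto simp: t_def min_def split: if_splits)
      have "q x \<ge> \<epsilon>" if "x \<in> {t..v}" for x
      proof -
        have "\<kappa> * (\<epsilon> / \<kappa>) \<le> \<kappa> * (x - z)" using that s e by (intro mult_left_mono) auto
        also have "\<dots> \<le> q x - q z" using that s z p by (intro inc) auto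
        finally show ?thesis using z s e by auto
      qed
      then show ?thesis by blast
    qed auto
  qed
qed

lemma integral_split3_le:
  fixes h :: "real \<Rightarrow> real"
  assumes "u \<le> s" "s \<le> t" "t \<le> v" and h: "continuous_on UNIV h"
    and "integral {u..s} h \<le> A" "integral {t..v} h \<le> A" and M: "\<And>x. h x \<le> M"
  shows "integral {u..v} h \<le> 2 * A + M * (t - s)"
proof -
  have i: "h integrable_on {a..b}" for a b using h
    by (intro integrable_continuous_interval continuous_on_subset[OF h]) auto
  have "integral {u..v} h = integral {u..s} h + integral {s..t} h + integral {t..v} h"
    using Henstock_Kurzweil_Integration.integral_combine[OF assms(1) _ i, of v]
      Henstock_Kurzweil_Integration.integral_combine[OF assms(2,3) i] assms by auto
  moreover have "integral {s..t} h \<le> integral {s..t} (\<lambda>_. M)"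
    by (intro integral_le i M) auto
  ultimately show ?thesis using assms by (simp add: mult.commute)
qed

text \<open>The exponents balance because \<open>\<epsilon>\<close> is chosen so that the two error terms coincide.\<close>

lemma van_der_corput:
  assumes "k \<ge> 2"
  shows "\<exists>C\<ge>0. \<forall>P \<phi> D M \<kappa> u v. test_fun \<phi> D M \<longrightarrow> 0 < M \<longrightarrow> 0 < \<kappa> \<longrightarrow> u \<le> v \<longrightarrow>
     (\<forall>x\<in>{u..v}. \<kappa> \<le> poly (pd k P) x) \<longrightarrow>
     integral {u..v} (\<lambda>x. D (poly P x)) \<le> C * M powr (1 - 1 / k) * \<kappa> powr (- 1 / k)"
  using assms
proof (induction k rule: dec_induct)
  case base
  show ?case
  proof (intro exI[of _ "10"] conjI allI impI)
    fix P \<phi> D and M \<kappa> u v :: real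
    assume t: "test_fun \<phi> D M" and M: "0 < M" and l: "0 < \<kappa>" and uv: "u \<le> v"
      and q: "\<forall>x\<in>{u..v}. \<kappa> \<le> poly (pd 2 P) x"
    define \<epsilon> where "\<epsilon> = sqrt (\<kappa> / M)"
    have e: "0 < \<epsilon>" using M l by (simp add: \<epsilon>_def)
    have D1: "(poly (pd 1 P) has_real_derivative poly (pd 2 P) x) (at x)" for x
      using poly_DERIV[of "pd 1 P" x] by (simp add: numeral_2_eq_2)
    obtain s r where st: "u \<le> s" "s \<le> r" "r \<le> v" "r - s \<le> 2 * \<epsilon> / \<kappa>"
      "s = u \<or> (\<forall>x\<in>{u..s}. poly (pd 1 P) x \<le> - \<epsilon>)" "r = v \<or> (\<forall>x\<in>{r..v}. \<epsilon> \<le> poly (pd 1 P) x)"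
      by (rule split_increasing[OF uv e l D1 bspec[OF q]])
    \<comment> \<open>The side pieces use the lower bound on P'' as convexity; its size enters
      through the length of the middle piece.\<close>
    have c: "0 \<le> poly (pd 2 P) x" if "x \<in> {u..v}" for x using bspec[OF q that] l by linarith
    have "integral {u..s} (\<lambda>x. D (poly P x)) \<le> 4 / \<epsilon>"
    proof (cases "s = u")
      case False
      then show ?thesis using st e by (intro integral_monotone_phase[OF t]) (force intro!: c)+
    qed (use e in auto)
    moreover have "integral {r..v} (\<lambda>x. D (poly P x)) \<le> 4 / \<epsilon>"
    proof (cases "r = v")
      case False
      then show ?thesis using st e by (intro integral_monotone_phase[OF t]) (force intro!: c)+
    qed (use e in auto)
    ultimately have "integral {u..v} (\<lambda>x. D (poly P x)) \<le> 2 * (4 / \<epsilon>) + M * (r - s)"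
      using st by (intro integral_split3_le test_fun_cont[OF t] test_fun_bound[OF t])
    also have "\<dots> \<le> 8 / \<epsilon> + M * (2 * \<epsilon> / \<kappa>)" using mult_left_mono[OF st(4), of M] M by simp
    also have "8 / \<epsilon> = 8 * (M powr (1/2) * \<kappa> powr (-1/2))"
      using M l by (simp add: \<epsilon>_def powr_half_sqrt real_sqrt_divide powr_minus_divide)
    also have "M * (2 * \<epsilon> / \<kappa>) = 2 * (M powr (1/2) * \<kappa> powr (-1/2))"
    proof -
      have "M = sqrt M * sqrt M" "\<kappa> = sqrt \<kappa> * sqrt \<kappa>" using M l by auto
      then have "M * (2 * \<epsilon> / \<kappa>) = 2 * (sqrt M * sqrt M * (sqrt \<kappa> / sqrt M) / (sqrt \<kappa> * sqrt \<kappa>))"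
        unfolding \<epsilon>_def real_sqrt_divide by simp
      also have "\<dots> = 2 * (sqrt M / sqrt \<kappa>)" using M l by (simp add: field_simps)
      finally show ?thesis using M l by (simp add: powr_half_sqrt powr_minus_divide)
    qed
    finally show "integral {u..v} (\<lambda>x. D (poly P x)) \<le> 10 * M powr (1 - 1 / real 2) * \<kappa> powr (- 1 / real 2)"
      by simp
  qed auto
next
  case (step k)
  then obtain C where C: "C \<ge> 0" and IH: "\<And>P \<phi> D M \<kappa> u v. test_fun \<phi> D M \<Longrightarrow> 0 < M \<Longrightarrow> 0 < \<kappa> \<Longrightarrow> u \<le> v \<Longrightarrow>
     (\<forall>x\<in>{u..v}. \<kappa> \<le> poly (pd k P) x) \<Longrightarrow>
     integral {u..v} (\<lambda>x. D (poly P x)) \<le> C * M powr (1 - 1 / k) * \<kappa> powr (- 1 / k)" by blast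
  have k: "real k > 0" using step by simp
  show ?case
  proof (intro exI[of _ "2 * C + 2"] conjI allI impI)
    fix P \<phi> D and M \<kappa> u v :: real
    assume t: "test_fun \<phi> D M" and M: "0 < M" and l: "0 < \<kappa>" and uv: "u \<le> v"
      and q: "\<forall>x\<in>{u..v}. \<kappa> \<le> poly (pd (Suc k) P) x"
    define \<epsilon> where "\<epsilon> = \<kappa> powr (k / (k + 1)) * M powr (- 1 / (k + 1))"
    have e: "0 < \<epsilon>" using M l by (simp add: \<epsilon>_def)
    have D1: "(poly (pd k P) has_real_derivative poly (pd (Suc k) P) x) (at x)" for x
      using poly_DERIV[of "pd k P" x] by simp
    obtain s r where st: "u \<le> s" "s \<le> r" "r \<le> v" "r - s \<le> 2 * \<epsilon> / \<kappa>"
      "s = u \<or> (\<forall>x\<in>{u..s}. poly (pd k P) x \<le> - \<epsilon>)" "r = v \<or> (\<forall>x\<in>{r..v}. \<epsilon> \<le> poly (pd k P) x)"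
      by (rule split_increasing[OF uv e l D1 bspec[OF q]])
    define A where "A = C * M powr (1 - 1 / k) * \<epsilon> powr (- 1 / k)"
    have A0: "0 \<le> A" using C by (simp add: A_def)
    have "integral {u..s} (\<lambda>x. D (poly P x)) \<le> A"
    proof (cases "s = u")
      case False
      \<comment> \<open>On the left piece the derivative of order k is at most -\<epsilon>, so the
        induction hypothesis is applied to -P and the reflected test function.\<close>
      have pm: "pd k (- P) = - pd k P"
        by (induction k) (auto simp: pderiv_minus)
      have "integral {u..s} (\<lambda>x. D (- poly (- P) x)) \<le> A" unfolding A_def
        using st False by (intro IH[OF test_fun_reflect[OF t] M e]) (auto simp: pm)
      then show ?thesis by simp
    qed (use A0 in auto)
    moreover have "integral {r..v} (\<lambda>x. D (poly P x)) \<le> A"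
    proof (cases "r = v")
      case False
      then show ?thesis unfolding A_def using st by (intro IH[OF t M e]) auto
    qed (use A0 in auto)
    ultimately have "integral {u..v} (\<lambda>x. D (poly P x)) \<le> 2 * A + M * (r - s)"
      using st by (intro integral_split3_le test_fun_cont[OF t] test_fun_bound[OF t])
    also have "\<dots> \<le> 2 * A + M * (2 * \<epsilon> / \<kappa>)" using mult_left_mono[OF st(4), of M] M by linarith
    also have "A = C * (M powr (1 - 1 / (k+1)) * \<kappa> powr (- 1 / (k+1)))"
    proof -
      have "M powr (1 - 1 / k) * \<epsilon> powr (- 1 / k) = M powr (1 - 1 / (k+1)) * \<kappa> powr (- 1 / (k+1))"
      proof -
        have "\<epsilon> powr (- 1 / k) = \<kappa> powr (k / (k + 1) * (- 1 / k)) * M powr (- 1 / (k + 1) * (- 1 / k))"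
          using M l by (simp add: \<epsilon>_def powr_mult powr_powr)
        also have "k / (k + 1) * (- 1 / k) = - 1 / (k + 1)" using k by (simp add: field_simps)
        finally have "M powr (1 - 1 / k) * \<epsilon> powr (- 1 / k)
           = M powr ((1 - 1 / k) + (- 1 / (k + 1) * (- 1 / k))) * \<kappa> powr (- 1 / (k + 1))"
          by (simp add: powr_add)
        also have "(1 - 1 / k) + (- 1 / (k + 1) * (- 1 / k)) = 1 - 1 / (k + 1)"
        proof -
          have "real k + real k * real k \<noteq> 0" using k by (metis add_pos_pos mult_pos_pos less_numeral_extra(3))
          then show ?thesis using k by (simp add: field_simps)
        qed
        finally show ?thesis .
      qed
      then show ?thesis by (simp add: A_def mult.assoc)
    qed
    also have "M * (2 * \<epsilon> / \<kappa>) = 2 * (M powr (1 - 1 / (k+1)) * \<kappa> powr (- 1 / (k+1)))"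
    proof -
      have "M powr (1 - 1 / (k+1)) = M powr 1 * M powr (- 1 / (k+1))"
        using powr_add[of M 1 "- 1 / (k+1)"] by simp
      moreover have "\<kappa> powr (- 1 / (k+1)) = \<kappa> powr (k / (k + 1)) * \<kappa> powr (- 1)"
        by (subst powr_add[symmetric]) (simp add: field_simps)
      moreover have "M powr 1 = M" "\<kappa> powr (- 1) = 1 / \<kappa>" using M l by (auto simp: powr_minus_divide)
      ultimately show ?thesis by (simp add: \<epsilon>_def field_simps)
    qed
    finally show "integral {u..v} (\<lambda>x. D (poly P x))
        \<le> (2 * C + 2) * M powr (1 - 1 / real (Suc k)) * \<kappa> powr (- 1 / real (Suc k))"
      by (simp add: algebra_simps)
  qed (use C in auto)
qed


section \<open>From the order of the derivative to the degree of the polynomial\<close>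

text \<open>Written as M (M \<omega>)^(-1/k), the rate increases with k as soon as M \<omega> \<ge>
  1. The order k supplied by the oscillation, over which there is no control, can thus be replaced
  by d.\<close>

lemma powr_rate_mono:
  assumes "1 \<le> M * \<omega>" "0 < M" "0 < \<omega>" "1 \<le> k" "k \<le> d"
  shows "M powr (1 - 1 / real k) * \<omega> powr (- 1 / real k) \<le> M powr (1 - 1 / real d) * \<omega> powr (- 1 / real d)"
proof -
  have e: "M powr (1 - 1 / real j) * \<omega> powr (- 1 / real j) = M * (M * \<omega>) powr (- 1 / real j)" for j :: nat
  proof -
    have "M powr (1 - 1 / real j) = M * M powr (- 1 / real j)"
      using assms powr_add[of M 1 "- 1 / real j"] by simp
    then show ?thesis using assms by (simp add: powr_mult)
  qed
  have "- 1 / real k \<le> - 1 / real d" using assms by (simp add: field_simps)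
  then have "(M * \<omega>) powr (- 1 / real k) \<le> (M * \<omega>) powr (- 1 / real d)"
    using assms by (intro powr_mono) auto
  then show ?thesis unfolding e using assms by simp
qed

text \<open>The case k = 1. P'' has no definite sign here, so the leftover term of the integration
  by parts is bounded by B = 32 / \<omega> and compensated by adding B x to the boundary term. The
  numbers 16 and 8 are those of \<open>large_derivative\<close> at k = 1.\<close>

lemma integral_nonstationary_phase:
  assumes t: "test_fun \<phi> D M" and uv: "u' \<le> v'" "v' - u' \<le> L" "0 < L" and om: "0 < \<omega>"
    and a: "\<And>x. x \<in> {u'..v'} \<Longrightarrow> \<omega> / (16 * L) \<le> \<bar>poly (pd 1 P) x\<bar>"
    and c: "\<And>x. x \<in> {u'..v'} \<Longrightarrow> \<bar>poly (pd 2 P) x\<bar> \<le> \<omega> / (8 * L^2)"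
  shows "integral {u'..v'} (\<lambda>x. D (poly P x)) \<le> 64 * L / \<omega>"
proof -
  define B where "B = 32 / \<omega>"
  define F where "F = (\<lambda>x. \<phi> (poly P x) / poly (pd 1 P) x + B * x)"
  define F' where "F' = (\<lambda>x. D (poly P x) - \<phi> (poly P x) * poly (pd 2 P) x / (poly (pd 1 P) x)^2 + B)"
  have p: "\<omega> / (16 * L) > 0" using om uv by simp
  have nz: "poly (pd 1 P) x \<noteq> 0" if "x \<in> {u'..v'}" for x using a[OF that] p by linarith
  have d: "\<And>y. (\<phi> has_real_derivative D y) (at y)" and bd: "\<And>y. \<bar>\<phi> y\<bar> \<le> 1"
    using t unfolding test_fun_def by blast+
  have Fb: "\<bar>\<phi> (poly P x) / poly (pd 1 P) x\<bar> \<le> 16 * L / \<omega>" if "x \<in> {u'..v'}" for x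
  proof -
    have "\<bar>\<phi> (poly P x) / poly (pd 1 P) x\<bar> = \<bar>\<phi> (poly P x)\<bar> / \<bar>poly (pd 1 P) x\<bar>" by simp
    also have "\<dots> \<le> 1 / (\<omega> / (16 * L))" by (intro frac_le a that bd p) auto
    finally show ?thesis by simp
  qed
  have "integral {u'..v'} (\<lambda>x. D (poly P x)) \<le> F v' - F u'"
  proof (rule integral_le_increment[OF uv(1) test_fun_integrable[OF t]])
    fix x assume x: "x \<in> {u'..v'}"
    have "((\<lambda>x. \<phi> (poly P x)) has_real_derivative D (poly P x) * poly (pderiv P) x) (at x)"
      by (rule DERIV_chain2[OF d poly_DERIV])
    then show "(F has_real_derivative F' x) (at x)"
      unfolding F_def F'_def using nz[OF x]
      by (auto intro!: derivative_eq_intros simp: field_simps power2_eq_square numeral_2_eq_2)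
    have "\<bar>\<phi> (poly P x) * poly (pd 2 P) x / (poly (pd 1 P) x)^2\<bar>
       = \<bar>\<phi> (poly P x)\<bar> * \<bar>poly (pd 2 P) x\<bar> / (poly (pd 1 P) x)^2" by (simp add: abs_mult)
    also have "\<dots> \<le> 1 * (\<omega> / (8 * L^2)) / (\<omega> / (16 * L))^2"
    proof (rule frac_le)
      show "(\<omega> / (16 * L))\<^sup>2 \<le> (poly (pd 1 P) x)\<^sup>2"
        using power_mono[OF a[OF x], of 2] p by simp
      show "\<bar>\<phi> (poly P x)\<bar> * \<bar>poly (pd 2 P) x\<bar> \<le> 1 * (\<omega> / (8 * L^2))"
        by (intro mult_mono bd c x) auto
    qed (use p om in auto)
    also have "\<dots> = B" using om uv by (simp add: B_def field_simps power2_eq_square)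
    finally show "D (poly P x) \<le> F' x" unfolding F'_def by linarith
  qed
  also have "\<dots> \<le> 32 * L / \<omega> + B * (v' - u')" 
  proof -
    have "\<bar>a\<bar> \<le> c \<Longrightarrow> \<bar>b\<bar> \<le> c \<Longrightarrow> (a + B * v') - (b + B * u') \<le> 2 * c + B * (v' - u')" for a b c
      by (simp add: algebra_simps abs_le_iff)
    from this[OF Fb[of v'] Fb[of u']] uv show ?thesis by (simp add: F_def)
  qed
  also have "B * (v' - u') \<le> B * L" using uv om by (intro mult_left_mono) (auto simp: B_def)
  finally show ?thesis by (simp add: B_def)
qed

text \<open>A predicate on the constant rather than a number, so that later bounds can be explicit
  in it. The integral runs over a subinterval of the one on which P oscillates; this freedom serves
  level sets that are too short to see the oscillation themselves.\<close>

definition oscillation_constant :: "nat \<Rightarrow> real \<Rightarrow> bool" where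
  "oscillation_constant d C \<longleftrightarrow> 0 < C \<and> (\<forall>P \<phi> D M \<omega> u v u' v' x y. degree P \<le> d \<longrightarrow> test_fun \<phi> D M \<longrightarrow> 0 < M \<longrightarrow> 0 < \<omega> \<longrightarrow>
     1 \<le> M * \<omega> \<longrightarrow> u < v \<longrightarrow> x \<in> {u..v} \<longrightarrow> y \<in> {u..v} \<longrightarrow> \<omega> \<le> poly P y - poly P x \<longrightarrow>
     u \<le> u' \<longrightarrow> u' \<le> v' \<longrightarrow> v' \<le> v \<longrightarrow>
     integral {u'..v'} (\<lambda>x. D (poly P x)) \<le> C * (v - u) * (M powr (1 - 1 / d) * \<omega> powr (- 1 / d)))"

lemma oscillation_constant_exists: "\<exists>C. oscillation_constant d C"
proof -
  have "\<forall>k. \<exists>C. k \<ge> 2 \<longrightarrow> C \<ge> 0 \<and> (\<forall>P \<phi> D M \<kappa> u v. test_fun \<phi> D M \<longrightarrow> 0 < M \<longrightarrow> 0 < \<kappa> \<longrightarrow> u \<le> v \<longrightarrow>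
     (\<forall>x\<in>{u..v}. \<kappa> \<le> poly (pd k P) x) \<longrightarrow>
     integral {u..v} (\<lambda>x. D (poly P x)) \<le> C * M powr (1 - 1 / k) * \<kappa> powr (- 1 / k))"
    using van_der_corput by auto
  then obtain c where c0: "\<And>k. k \<ge> 2 \<Longrightarrow> c k \<ge> 0" and
    c: "\<And>k P \<phi> D M \<kappa> u v. k \<ge> 2 \<Longrightarrow> test_fun \<phi> D M \<Longrightarrow> 0 < M \<Longrightarrow> 0 < \<kappa> \<Longrightarrow> u \<le> v \<Longrightarrow>
     (\<forall>x\<in>{u..v}. \<kappa> \<le> poly (pd k P) x) \<Longrightarrow>
     integral {u..v} (\<lambda>x. D (poly P x)) \<le> c k * M powr (1 - 1 / k) * \<kappa> powr (- 1 / k)"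
    by metis
  \<comment> \<open>The summand 64 pays for k = 1. The sum dominates each \<open>c k\<close>, and 16
    arises when the lower bound of the k-th derivative is raised to the power -1/k.\<close>
  define C where "C = 64 + 16 * (\<Sum>k=2..d. c k)"
  have C0: "C > 0" unfolding C_def using c0 by (intro add_pos_nonneg mult_nonneg_nonneg sum_nonneg) auto
  show ?thesis
    unfolding oscillation_constant_def
  proof (intro exI[of _ C] conjI allI impI C0)
    fix P \<phi> D and M \<omega> u v u' v' x y :: real
    assume dg: "degree P \<le> d" and t: "test_fun \<phi> D M" and M: "0 < M" and om: "0 < \<omega>" "1 \<le> M * \<omega>"
      and uv: "u < v" and xy: "x \<in> {u..v}" "y \<in> {u..v}" "\<omega> \<le> poly P y - poly P x"
      and uv': "u \<le> u'" "u' \<le> v'" "v' \<le> v"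
    obtain k where k: "1 \<le> k" "k \<le> d" and
      lo: "\<And>z. z \<in> {u..v} \<Longrightarrow> (1/8) ^ k / 2 * \<omega> / (v - u) ^ k \<le> \<bar>poly (pd k P) z\<bar>" and
      up: "\<And>z. z \<in> {u..v} \<Longrightarrow> \<bar>poly (pd (Suc k) P) z\<bar> \<le> (1/8) ^ k * \<omega> / (v - u) ^ Suc k"
      using large_derivative[OF dg uv xy(1,2) om(1) xy(3)] by blast
    have bound: "integral {u'..v'} (\<lambda>x. D (poly P x)) \<le> C * (v - u) * (M powr (1 - 1 / k) * \<omega> powr (- 1 / k))"
    proof (cases "k = 1")
      case True
      have "integral {u'..v'} (\<lambda>x. D (poly P x)) \<le> 64 * (v - u) / \<omega>"
      proof (rule integral_nonstationary_phase[OF t uv'(2) _ _ om(1)])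
        fix z assume "z \<in> {u'..v'}"
        then have z: "z \<in> {u..v}" using uv' by auto
        show "\<omega> / (16 * (v - u)) \<le> \<bar>poly (pd 1 P) z\<bar>" using lo[OF z] True by (simp add: field_simps)
        show "\<bar>poly (pd 2 P) z\<bar> \<le> \<omega> / (8 * (v - u)\<^sup>2)"
          using up[OF z] unfolding True by (simp add: numeral_2_eq_2)
      qed (use uv uv' in auto)
      also have "\<dots> \<le> C * (v - u) / \<omega>"
      proof -
        have "64 \<le> C" unfolding C_def using c0 sum_nonneg[of "{2..d}" c] by simp
        then show ?thesis using uv om by (intro divide_right_mono mult_right_mono) auto
      qed
      finally show ?thesis using True M om by (simp add: powr_minus_divide)
    next
      case False
      then have k2: "k \<ge> 2" using k by simp
      define \<kappa> where "\<kappa> = (1/8) ^ k / 2 * \<omega> / (v - u) ^ k"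
      have kp: "\<kappa> > 0" using om uv by (simp add: \<kappa>_def)
      have kp': "\<kappa> powr (- 1 / k) \<le> 16 * (v - u) * \<omega> powr (- 1 / k)"
      proof -
        \<comment> \<open>The factor 1/2 is absorbed by passing from 8^k to 16^k; the denominator is
          then a pure k-th power, of which the root is explicit.\<close>
        have "\<omega> / (16 * (v - u)) ^ k \<le> \<kappa>"
        proof -
          have "(1/16::real) ^ k \<le> (1/8) ^ k / 2"
          proof -
            have "(1/2::real) ^ k \<le> (1/2) ^ 1" by (rule power_decreasing) (use k in auto)
            moreover have "(1/16::real) ^ k = (1/8) ^ k * (1/2) ^ k" by (subst power_mult_distrib[symmetric]) simp
            ultimately show ?thesis by simp
          qed
          then have "(1/16) ^ k * (\<omega> / (v - u) ^ k) \<le> (1/8) ^ k / 2 * (\<omega> / (v - u) ^ k)"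
            using om uv by (intro mult_right_mono) auto
          then show ?thesis unfolding \<kappa>_def power_mult_distrib power_one_over
            by simp
        qed
        then have "\<kappa> powr (- 1 / k) \<le> (\<omega> / (16 * (v - u)) ^ k) powr (- 1 / k)"
          using om uv k by (intro powr_mono2') auto
        also have "\<dots> = \<omega> powr (- 1 / k) / ((16 * (v - u)) ^ k) powr (- 1 / k)"
          using om uv by (subst powr_divide) auto
        also have "((16 * (v - u)) ^ k) powr (- 1 / k) = 1 / (16 * (v - u))"
        proof -
          have "((16 * (v - u)) ^ k) powr (- 1 / k) = (16 * (v - u)) powr (k * (- 1 / k))"
            using uv by (simp add: powr_powr flip: powr_realpow)
          also have "real k * (- 1 / k) = -1" using k by simp
          finally show ?thesis using uv by (simp add: powr_minus_divide)
        qed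
        finally show ?thesis by (simp add: mult_ac)
      qed
      have cont: "continuous_on {u..v} (poly (pd k P))" by (intro continuous_intros)
      \<comment> \<open>The k-th derivative is bounded away from zero on an interval, hence has
        constant sign by the intermediate value property.\<close>
      have sign: "(\<forall>z\<in>{u..v}. \<kappa> \<le> poly (pd k P) z) \<or> (\<forall>z\<in>{u..v}. \<kappa> \<le> - poly (pd k P) z)"
      proof (rule ccontr)
        assume "\<not> ?thesis"
        then obtain a b where ab: "a \<in> {u..v}" "b \<in> {u..v}" "poly (pd k P) a < \<kappa>" "- poly (pd k P) b < \<kappa>"
          by (auto simp: not_le)
        have "poly (pd k P) a \<le> - \<kappa>" "\<kappa> \<le> poly (pd k P) b"
          using lo[OF ab(1)] lo[OF ab(2)] ab(3,4) unfolding \<kappa>_def[symmetric] by linarith+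
        then have "poly (pd k P) a \<le> 0" "0 \<le> poly (pd k P) b" using kp by linarith+
        moreover have "connected (poly (pd k P) ` {u..v})" by (intro connected_continuous_image cont) auto
        ultimately have "0 \<in> poly (pd k P) ` {u..v}"
          using ab unfolding connected_iff_interval by blast
        then obtain z where "z \<in> {u..v}" "poly (pd k P) z = 0" by auto
        with lo[of z] kp show False by (simp add: \<kappa>_def)
      qed
      have I: "integral {u'..v'} (\<lambda>x. D (poly P x)) \<le> c k * M powr (1 - 1 / k) * \<kappa> powr (- 1 / k)"
        using sign
      proof
        assume "\<forall>z\<in>{u..v}. \<kappa> \<le> poly (pd k P) z"
        then show ?thesis using uv' by (intro c[OF k2 t M kp]) auto
      next
        assume s: "\<forall>z\<in>{u..v}. \<kappa> \<le> - poly (pd k P) z"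
        have pm: "pd k (- P) = - pd k P" by (induction k) (auto simp: pderiv_minus)
        have "integral {u'..v'} (\<lambda>x. D (- poly (- P) x)) \<le> c k * M powr (1 - 1 / k) * \<kappa> powr (- 1 / k)"
          using uv' s by (intro c[OF k2 test_fun_reflect[OF t] M kp]) (auto simp: pm)
        then show ?thesis by simp
      qed
      also have "\<dots> \<le> c k * M powr (1 - 1 / k) * (16 * (v - u) * \<omega> powr (- 1 / k))"
        using c0[OF k2] by (intro mult_left_mono kp') auto
      also have "\<dots> = (16 * c k) * ((v - u) * (M powr (1 - 1 / k) * \<omega> powr (- 1 / k)))" by simp
      also have "\<dots> \<le> C * ((v - u) * (M powr (1 - 1 / k) * \<omega> powr (- 1 / k)))"
      proof (rule mult_right_mono)
        have "c k \<le> (\<Sum>k=2..d. c k)" using k k2 c0 by (intro member_le_sum) auto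
        then show "16 * c k \<le> C" by (simp add: C_def)
      qed (use uv in auto)
      finally show ?thesis by (simp add: mult_ac)
    qed
    also have "\<dots> \<le> C * (v - u) * (M powr (1 - 1 / d) * \<omega> powr (- 1 / d))"
      using C0 uv by (intro mult_left_mono powr_rate_mono om M k) auto
    finally show "integral {u'..v'} (\<lambda>x. D (poly P x)) \<le> C * (v - u) * (M powr (1 - 1 / d) * \<omega> powr (- 1 / d))" .
  qed
qed

section \<open>One-dimensional log-concave densities\<close>

lemma oscillatory_integralD:
  assumes "oscillation_constant d C" "degree P \<le> d" "test_fun \<phi> D M" "0 < M" "0 < \<omega>" "1 \<le> M * \<omega>"
    "u < v" "x \<in> {u..v}" "y \<in> {u..v}" "\<omega> \<le> poly P y - poly P x" "u \<le> u'" "u' \<le> v'" "v' \<le> v"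
  shows "integral {u'..v'} (\<lambda>x. D (poly P x)) \<le> C * (v - u) * (M powr (1 - 1 / d) * \<omega> powr (- 1 / d))"
  using assms unfolding oscillation_constant_def by blast

text \<open>Sublevel sets are controlled by testing the oscillatory estimate against an arctangent.\<close>

lemma arctan_test_fun:
  assumes "0 < c"
  shows "test_fun (\<lambda>t. 2 / pi * arctan (t / c)) (\<lambda>t. 2 / (pi * c * (1 + (t / c)\<^sup>2))) (1 / c)"
  unfolding test_fun_def
proof (intro conjI allI)
  fix x :: real
  have "1 + (x / c)\<^sup>2 \<ge> 1" by simp
  then have p: "1 + (x / c)\<^sup>2 > 0" by linarith
  show "((\<lambda>t. 2 / pi * arctan (t / c)) has_real_derivative 2 / (pi * c * (1 + (x / c)\<^sup>2))) (at x)"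
    using assms p by (auto intro!: derivative_eq_intros simp: inverse_eq_divide)
  have "\<bar>arctan (x / c)\<bar> \<le> pi / 2" using arctan_lbound[of "x/c"] arctan_ubound[of "x/c"] by simp
  then show "\<bar>2 / pi * arctan (x / c)\<bar> \<le> 1" by (simp add: abs_mult field_simps)
  have "pi * c * (1 + (x / c)\<^sup>2) \<ge> 2 * c * 1"
    using assms pi_ge_two by (intro mult_mono) auto
  then have "2 / (pi * c * (1 + (x / c)\<^sup>2)) \<le> 2 / (2 * c)"
    using assms by (intro divide_left_mono) (auto intro!: mult_pos_pos p)
  moreover have "0 \<le> 2 / (pi * c * (1 + (x / c)\<^sup>2))" using assms p by (intro divide_nonneg_nonneg mult_nonneg_nonneg) auto
  ultimately show "\<bar>2 / (pi * c * (1 + (x / c)\<^sup>2))\<bar> \<le> 1 / c" by simp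
next
  have "1 + (x / c)\<^sup>2 \<noteq> 0" for x by (metis add_pos_nonneg less_irrefl zero_le_power2 zero_less_one)
  then show "continuous_on UNIV (\<lambda>t. 2 / (pi * c * (1 + (t / c)\<^sup>2)))"
    using assms by (intro continuous_intros) auto
qed

text \<open>A Remez-type bound. The derivative of (2 / pi) arctan(t / D) is at least 1 / (pi D) for
  |t| \<le> D and is bounded by 1 / D. The oscillatory estimate with M = 1 / D, whose condition M
  \<omega> \<ge> 1 reads D \<le> \<omega>, therefore controls the measure of the sublevel
  set.\<close>

lemma poly_sublevel:
  assumes E: "oscillation_constant d E" and d: "1 \<le> d" "degree P \<le> d" and D: "0 < D" and uv: "u < v"
    and xy: "x \<in> {u..v}" "y \<in> {u..v}" and om: "\<omega> = poly P y - poly P x" "D \<le> \<omega>"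
  shows "measure lborel ({u..v} \<inter> {x. \<bar>poly P x\<bar> \<le> D}) \<le> pi * E * (v - u) * (D / \<omega>) powr (1 / d)"
proof -
  define A where "A = {u..v} \<inter> {x. \<bar>poly P x\<bar> \<le> D}"
  define \<psi> where "\<psi> = (\<lambda>t. 2 / (pi * D * (1 + (t / D)\<^sup>2)))"
  have cont: "continuous_on UNIV (\<lambda>x. \<bar>poly P x\<bar>)" by (intro continuous_intros)
  have "closed {x. \<bar>poly P x\<bar> \<le> D}" by (intro closed_Collect_le continuous_intros)
  then have comp: "compact A" unfolding A_def by (intro compact_Int_closed) auto
  then have Ab: "A \<in> sets borel" by (simp add: borel_compact)
  have Alm: "A \<in> lmeasurable" using comp by (rule lmeasurable_compact)
  note t = arctan_test_fun[OF D]
  have om0: "\<omega> > 0" using om D by linarith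
  have "integral {u..v} (\<lambda>x. \<psi> (poly P x)) \<le> E * (v - u) * ((1 / D) powr (1 - 1 / d) * \<omega> powr (- 1 / d))"
    unfolding \<psi>_def using D om om0
    by (intro oscillatory_integralD[OF E d(2) t _ om0 _ uv xy]) (use uv in \<open>auto simp: field_simps\<close>)
  also have "\<dots> = E * (v - u) * (1 / D * (D / \<omega>) powr (1 / d))"
    using D om0 powr_add[of "1/D" 1 "- 1 / real d"] by (simp add: powr_divide powr_minus_divide)
  finally have up: "integral {u..v} (\<lambda>x. \<psi> (poly P x)) \<le> E * (v - u) * (1 / D * (D / \<omega>) powr (1 / d))" .
  have "measure lborel A / (pi * D) = integral {u..v} (\<lambda>x. indicator A x *\<^sub>R (1 / (pi * D)))"
  proof -
    have "A \<inter> {u..v} = A" by (auto simp: A_def)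
    then have "integral {u..v} (indicat_real A) = measure lebesgue A"
      using Alm by (simp add: Equivalence_Lebesgue_Henstock_Integration.integral_indicator)
    then show ?thesis using Ab by simp
  qed
  also have "\<dots> \<le> integral {u..v} (\<lambda>x. \<psi> (poly P x))"
  proof (rule integral_le)
    show "(\<lambda>x. indicat_real A x *\<^sub>R (1 / (pi * D))) integrable_on {u..v}"
    proof -
      have "A \<inter> {u..v} = A" by (auto simp: A_def)
      then have "indicat_real A integrable_on {u..v}"
        using Alm by (simp add: integrable_on_indicator)
      then show ?thesis by (rule integrable_on_scaleR_left)
    qed
    show "(\<lambda>x. \<psi> (poly P x)) integrable_on {u..v}" unfolding \<psi>_def by (rule test_fun_integrable[OF t])
    fix x assume "x \<in> {u..v}"
    have pos: "1 + (poly P x / D)\<^sup>2 > 0" by (metis add_pos_nonneg zero_le_power2 zero_less_one)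
    show "indicat_real A x *\<^sub>R (1 / (pi * D)) \<le> \<psi> (poly P x)"
    proof (cases "x \<in> A")
      case True
      then have "\<bar>poly P x / D\<bar> \<le> 1" using D by (simp add: A_def)
      then have "(poly P x / D)\<^sup>2 \<le> 1" by (simp add: abs_square_le_1)
      then have "pi * D * (1 + (poly P x / D)\<^sup>2) \<le> pi * D * 2" using D by (intro mult_left_mono) auto
      then have "2 / (pi * D * 2) \<le> \<psi> (poly P x)" unfolding \<psi>_def
        using D pos by (intro divide_left_mono) auto
      then show ?thesis using True by simp
    next
      case False
      then show ?thesis using D pos by (simp add: \<psi>_def)
    qed
  qed
  finally have "measure lborel A / (pi * D) \<le> E * (v - u) * (1 / D * (D / \<omega>) powr (1 / d))" using up by linarith
  then have "measure lborel A \<le> E * (v - u) * (1 / D * (D / \<omega>) powr (1 / d)) * (pi * D)"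
    using D by (simp add: divide_le_eq)
  then show ?thesis using D unfolding A_def[symmetric] by (simp add: mult_ac)
qed

text \<open>Solves the inequality of \<open>poly_sublevel\<close> for \<omega>. The summand 1 covers
  oscillations below D, to which that inequality does not apply.\<close>

lemma poly_interval_bound:
  assumes E: "oscillation_constant d E" and d: "1 \<le> d" "degree P \<le> d" and D: "0 < D" and uv: "u < v"
    and xy: "x \<in> {u..v}" "y \<in> {u..v}" and m: "0 < m" "m \<le> measure lborel ({u..v} \<inter> {x. \<bar>poly P x\<bar> \<le> D})"
  shows "\<bar>poly P y - poly P x\<bar> \<le> D * (1 + (pi * E * (v - u) / m) ^ d)"
proof -
  have E0: "0 < E" using E by (simp add: oscillation_constant_def)
  have main: "poly P y - poly P x \<le> D * (1 + (pi * E * (v - u) / m) ^ d)" if xy: "x \<in> {u..v}" "y \<in> {u..v}" for x y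
  proof (cases "D \<le> poly P y - poly P x")
    case True
    define \<omega> where "\<omega> = poly P y - poly P x"
    have om: "0 < \<omega>" using True D by (simp add: \<omega>_def)
    have "m \<le> pi * E * (v - u) * (D / \<omega>) powr (1 / d)"
      using poly_sublevel[OF E d D uv xy \<omega>_def] True m by (simp add: \<omega>_def)
    then have "m ^ d \<le> (pi * E * (v - u) * (D / \<omega>) powr (1 / d)) ^ d"
      using m by (intro power_mono) auto
    also have "\<dots> = (pi * E * (v - u)) ^ d * (D / \<omega>)"
    proof -
      have "((D / \<omega>) powr (1 / d)) ^ d = (D / \<omega>) powr (1 / d * d)"
        using D om by (simp add: powr_powr flip: powr_realpow)
      then show ?thesis using d D om by (simp add: power_mult_distrib)
    qed
    finally have "\<omega> \<le> D * (pi * E * (v - u) / m) ^ d"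
      using m om by (simp add: power_divide field_simps)
    then show ?thesis using D by (simp add: \<omega>_def algebra_simps)
  next
    case False
    have "D * 1 \<le> D * (1 + (pi * E * (v - u) / m) ^ d)"
      using D E0 uv m by (intro mult_left_mono) auto
    with False show ?thesis by simp
  qed
  from main[OF xy] main[OF xy(2,1)] show ?thesis by (simp add: abs_le_iff)
qed

section \<open>Superlevel sets and the layer-cake formula\<close>

lemma integrable_bounded_support:
  fixes f :: "real \<Rightarrow> real"
  assumes "f \<in> borel_measurable borel" "\<And>x. \<bar>f x\<bar> \<le> B" "\<And>x. R < \<bar>x\<bar> \<Longrightarrow> f x = 0"
  shows "integrable lborel f"
proof (rule Bochner_Integration.integrable_bound)
  show "integrable lborel (\<lambda>x. B * indicator {-R..R} x)"
    by (intro integrable_mult_right integrable_real_indicator) (auto simp: emeasure_lborel_Icc_eq)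
  show "AE x in lborel. norm (f x) \<le> norm (B * indicator {-R..R} x)"
  proof (intro AE_I2)
    fix x
    show "norm (f x) \<le> norm (B * indicator {-R..R} x)"
      using assms(2)[of x] assms(3)[of x] by (cases "\<bar>x\<bar> \<le> R") (auto simp: indicator_def)
  qed
qed (use assms in simp)

lemma convex_bounded_real:
  fixes A :: "real set"
  assumes "\<And>x y z. x \<in> A \<Longrightarrow> y \<in> A \<Longrightarrow> x < z \<Longrightarrow> z < y \<Longrightarrow> z \<in> A" "A \<noteq> {}" "\<And>x. x \<in> A \<Longrightarrow> \<bar>x\<bar> \<le> R"
  shows "{Inf A<..<Sup A} \<subseteq> A" "A \<subseteq> {Inf A..Sup A}"
proof -
  have b: "bdd_above A" "bdd_below A" using assms(3) by (force intro!: bdd_aboveI[of _ R] bdd_belowI[of _ "-R"] simp: abs_le_iff)+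
  show "A \<subseteq> {Inf A..Sup A}" using b by (auto intro: cInf_lower cSup_upper)
  show "{Inf A<..<Sup A} \<subseteq> A"
  proof
    fix z assume "z \<in> {Inf A<..<Sup A}"
    then obtain x y where "x \<in> A" "x < z" "y \<in> A" "z < y"
      using cInf_less_iff[OF assms(2) b(2), of z] less_cSup_iff[OF assms(2) b(1), of z] by auto
    then show "z \<in> A" using assms(1) by blast
  qed
qed

text \<open>A superlevel set is an interval that may or may not contain its endpoints; being null,
  they do not affect the integral.\<close>

lemma interval_like_integral:
  fixes h :: "real \<Rightarrow> real"
  assumes A: "{l<..<r} \<subseteq> A" "A \<subseteq> {l..r}" "A \<in> sets borel" and h: "continuous_on UNIV h"
  shows "(\<integral>x. indicator A x * h x \<partial>lborel) = integral {l..r} h"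
proof -
  have hm[measurable]: "h \<in> borel_measurable borel" using h by (rule borel_measurable_continuous_onI)
  note A(3)[measurable]
  have "AE x in lborel. x \<noteq> l" "AE x in lborel. x \<noteq> r" by (rule AE_lborel_singleton)+
  then have "AE x in lborel. indicator A x * h x = indicator {l..r} x * h x"
  proof eventually_elim
    case (elim x)
    then have "x \<in> A \<longleftrightarrow> x \<in> {l..r}" using A by force
    then show ?case by (auto simp: indicator_def)
  qed
  then have "(\<integral>x. indicator A x * h x \<partial>lborel) = (\<integral>x. indicator {l..r} x * h x \<partial>lborel)"
    by (intro integral_cong_AE) auto
  also have "\<dots> = (LINT x:{l..r}|lborel. h x)" by (simp add: set_lebesgue_integral_def)
  also have "\<dots> = integral {l..r} h"
    by (rule set_borel_integral_eq_integral)
      (rule borel_integrable_compact[unfolded set_integrable_def[symmetric]], auto intro: continuous_on_subset[OF h])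
  finally show ?thesis .
qed


text \<open>Fubini on the region between 0 and the graph of W. The strict inequality in the
  superlevel sets comes from writing W(x) as the length of \<open>{0..<W x}\<close>.\<close>

lemma layer_cake_integral:
  fixes W u :: "real \<Rightarrow> real"
  assumes [measurable]: "W \<in> borel_measurable borel" and nonneg: "\<And>x. 0 \<le> W x" and bound: "\<And>x. W x \<le> B"
    and support: "\<And>x. R < \<bar>x\<bar> \<Longrightarrow> W x = 0"
    and [measurable]: "u \<in> borel_measurable borel" and u: "\<And>x. \<bar>x\<bar> \<le> R \<Longrightarrow> \<bar>u x\<bar> \<le> K"
  shows "(\<integral>x. u x * W x \<partial>lborel) = (\<integral>s. indicator {0..} s * (\<integral>x. indicator {x. s < W x} x * u x \<partial>lborel) \<partial>lborel)"
    and "integrable lborel (\<lambda>s. indicator {0..} s * (\<integral>x. indicator {x. s < W x} x * u x \<partial>lborel))"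
proof -
  define f where "f = (\<lambda>x s. if 0 \<le> s \<and> s < W x then u x else 0)"
  have int: "integrable (lborel \<Otimes>\<^sub>M lborel) (case_prod f)"
  proof (rule Bochner_Integration.integrable_bound)
    show "integrable (lborel \<Otimes>\<^sub>M lborel) (\<lambda>x. K * indicator ({-R..R} \<times> {0..B}) x :: real)"
      by (intro integrable_mult_right integrable_real_indicator)
        (auto simp: lborel.emeasure_pair_measure_Times emeasure_lborel_Icc_eq ennreal_mult_less_top)
    show "case_prod f \<in> borel_measurable (lborel \<Otimes>\<^sub>M lborel)" unfolding f_def by measurable
    show "AE x in lborel \<Otimes>\<^sub>M lborel. norm (case x of (x, xa) \<Rightarrow> f x xa) \<le> norm (K * indicat_real ({-R..R} \<times> {0..B}) x)"
    proof (intro AE_I2, clarify)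
      fix x s
      show "norm (f x s) \<le> norm (K * indicat_real ({-R..R} \<times> {0..B}) (x, s))"
      proof (cases "0 \<le> s \<and> s < W x")
        case True
        then have "\<bar>x\<bar> \<le> R" using support[of x] by force
        moreover have "s \<le> B" using True bound[of x] by linarith
        ultimately show ?thesis using True u[of x] by (auto simp: f_def abs_le_iff indicator_def)
      qed (auto simp: f_def)
    qed
  qed
  have 1: "(\<integral>s. f x s \<partial>lborel) = u x * W x" for x
  proof -
    have "(\<integral>s. f x s \<partial>lborel) = (\<integral>s. u x * indicator {0..<W x} s \<partial>lborel)"
      by (intro Bochner_Integration.integral_cong) (auto simp: f_def indicator_def)
    then show ?thesis using nonneg[of x] by simp
  qed
  have 2: "(\<integral>x. f x s \<partial>lborel) = indicator {0..} s * (\<integral>x. indicator {x. s < W x} x * u x \<partial>lborel)" for s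
  proof -
    have "(\<integral>x. f x s \<partial>lborel) = (\<integral>x. indicator {0..} s * (indicator {x. s < W x} x * u x) \<partial>lborel)"
      by (intro Bochner_Integration.integral_cong) (auto simp: f_def indicator_def)
    then show ?thesis by simp
  qed
  have "(\<integral>s. (\<integral>x. f x s \<partial>lborel) \<partial>lborel) = (\<integral>x. (\<integral>s. f x s \<partial>lborel) \<partial>lborel)"
    by (rule lborel_pair.Fubini_integral[OF int])
  then show "(\<integral>x. u x * W x \<partial>lborel) = (\<integral>s. indicator {0..} s * (\<integral>x. indicator {x. s < W x} x * u x \<partial>lborel) \<partial>lborel)"
    unfolding 1 2 by simp
  show "integrable lborel (\<lambda>s. indicator {0..} s * (\<integral>x. indicator {x. s < W x} x * u x \<partial>lborel))"
    using lborel_pair.integrable_snd[OF int] unfolding 2 .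
qed

text \<open>R and B make all integrals finite; the estimates below are uniform in both, which is
  what permits the truncation to be removed later. The multiplicative form of log-concavity allows W
  to vanish.\<close>

locale log_concave_density =
  fixes W :: "real \<Rightarrow> real" and R B :: real
  assumes nonneg: "0 \<le> W x"
    and log_concave: "0 < t \<Longrightarrow> t < 1 \<Longrightarrow> W x powr t * W y powr (1 - t) \<le> W (t * x + (1 - t) * y)"
    and meas[measurable]: "W \<in> borel_measurable borel"
    and support: "R < \<bar>x\<bar> \<Longrightarrow> W x = 0"
    and bound: "W x \<le> B"
    and mass: "(\<integral>x. W x \<partial>lborel) = 1"
begin

lemma integrable_mult:
  assumes [measurable]: "u \<in> borel_measurable borel" and "\<And>x. \<bar>x\<bar> \<le> R \<Longrightarrow> \<bar>u x\<bar> \<le> K"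
  shows "integrable lborel (\<lambda>x. u x * W x)"
proof (rule integrable_bounded_support[where R = R and B = "K * B"])
  fix x
  show "\<bar>u x * W x\<bar> \<le> K * B"
  proof (cases "\<bar>x\<bar> \<le> R")
    case True
    have "\<bar>u x\<bar> * \<bar>W x\<bar> \<le> K * B"
      using assms(2)[OF True] nonneg[of x] bound[of x] by (intro mult_mono) auto
    then show ?thesis by (simp add: abs_mult)
  next
    case False
    have "0 \<le> K * B \<or> R < 0"
    proof (cases "R < 0")
      case f: False
      have "0 \<le> K" using assms(2)[of 0] f by force
      moreover have "0 \<le> B" using nonneg[of 0] bound[of 0] by linarith
      ultimately show ?thesis by simp
    qed simp
    moreover have "\<not> R < 0"
    proof
      assume "R < 0"
      then have "W = (\<lambda>x. 0)" by (intro ext support) (use abs_ge_zero in \<open>metis less_le_trans\<close>)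
      then show False using mass by simp
    qed
    ultimately show ?thesis using support[of x] False by simp
  qed
qed (use support in auto)

lemma integrable_W: "integrable lborel W"
  using integrable_mult[of "\<lambda>_. 1" 1] by simp

lemma exists_pos: "\<exists>x. 0 < W x"
proof (rule ccontr)
  assume "\<not> ?thesis"
  then have "W = (\<lambda>x. 0)" using nonneg by (intro ext) (meson antisym not_less)
  then show False using mass by simp
qed

lemma powr_integrable: "0 < r \<Longrightarrow> integrable lborel (\<lambda>x. W x powr r)"
  by (rule integrable_bounded_support[where R = R and B = "B powr r"])
    (auto simp: support nonneg intro!: powr_mono2 bound)

text \<open>Log-concavity turns the contraction towards \<open>x0\<close> by the factor \<open>1/n\<close> into a moment bound for \<open>W\<close>.\<close>

lemma powr_integral_le:
  assumes x0: "0 < W x0" and n: "2 \<le> (n::nat)"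
  shows "(\<integral>x. W x powr (1 / n) \<partial>lborel) \<le> n * W x0 powr (1 / n - 1)"
proof -
  define t where "t = 1 / real n"
  have t: "0 < t" "t < 1" using n by (auto simp: t_def)
  have aff: "(\<integral>x. W x \<partial>lborel) = \<bar>t\<bar> *\<^sub>R (\<integral>x. W ((1 - t) * x0 + t * x) \<partial>lborel)"
    by (rule lborel_integral_real_affine) (use t in auto)
  have int: "integrable lborel (\<lambda>x. W ((1 - t) * x0 + t * x))"
    using t integrable_W by (intro lborel_integrable_real_affine) auto
  have "W x0 powr (1 - t) * (\<integral>x. W x powr t \<partial>lborel) = (\<integral>x. W x0 powr (1 - t) * W x powr t \<partial>lborel)" by simp
  also have "\<dots> \<le> (\<integral>x. W ((1 - t) * x0 + t * x) \<partial>lborel)"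
    using log_concave[OF t, of _ x0] by (intro integral_mono integrable_mult_right powr_integrable t int) (simp add: mult.commute add.commute)
  also have "\<dots> = 1 / t" using aff mass t by (simp add: field_simps)
  finally have "(\<integral>x. W x powr t \<partial>lborel) \<le> (1 / t) / W x0 powr (1 - t)"
    using x0 by (subst pos_le_divide_eq) (auto simp: mult.commute)
  also have "\<dots> = n * W x0 powr (t - 1)" using powr_minus_divide[of "W x0" "1 - t"] by (simp add: t_def)
  finally show ?thesis by (simp add: t_def)
qed

text \<open>Where W \<le> \<kappa> W(x0), W is at most sqrt(\<kappa> W(x0)) sqrt(W), and the
  integral of sqrt(W) is at most 2 / sqrt(W(x0)). Points of low density thus carry little mass
  although they may fill a long interval.\<close>

lemma low_density_mass:
  assumes x0: "0 < W x0" and k: "0 < \<kappa>"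
  shows "(\<integral>x. indicator {x. W x \<le> \<kappa> * W x0} x * W x \<partial>lborel) \<le> 2 * sqrt \<kappa>"
proof -
  have "(\<integral>x. indicator {x. W x \<le> \<kappa> * W x0} x * W x \<partial>lborel) \<le> (\<integral>x. sqrt (\<kappa> * W x0) * W x powr (1/2) \<partial>lborel)"
  proof (rule integral_mono)
    show "integrable lborel (\<lambda>x. indicat_real {x. W x \<le> \<kappa> * W x0} x * W x)"
      by (rule integrable_mult[where K = 1]) auto
    show "integrable lborel (\<lambda>x. sqrt (\<kappa> * W x0) * W x powr (1 / 2))"
      by (intro integrable_mult_right powr_integrable) simp
    fix x
    have "W x = sqrt (W x) * sqrt (W x)" using nonneg[of x] by simp
    also have "\<dots> \<le> sqrt (\<kappa> * W x0) * sqrt (W x)" if "W x \<le> \<kappa> * W x0" using that nonneg[of x] by (intro mult_right_mono) auto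
    finally show "indicat_real {x. W x \<le> \<kappa> * W x0} x * W x \<le> sqrt (\<kappa> * W x0) * W x powr (1 / 2)"
      using nonneg[of x] x0 k by (auto simp: indicator_def powr_half_sqrt)
  qed
  also have "\<dots> \<le> sqrt (\<kappa> * W x0) * (2 * W x0 powr (1 / 2 - 1))"
    using powr_integral_le[OF x0, of 2] x0 k by (simp add: mult_left_mono)
  also have "W x0 powr (1 / 2 - 1) = 1 / sqrt (W x0)"
    using x0 powr_minus_divide[of "W x0" "1/2"] by (simp add: powr_half_sqrt)
  finally show ?thesis using x0 by (simp add: real_sqrt_mult)
qed

definition level :: "real \<Rightarrow> real set" where "level s = {x. s < W x}"

lemma level_measurable[measurable]: "level s \<in> sets borel"
  unfolding level_def by measurable

text \<open>Log-concavity implies quasi-concavity: at an intermediate point W is at least the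
  smaller of the two given values.\<close>

lemma level_convex:
  assumes s: "0 \<le> s" and "x \<in> level s" "y \<in> level s" "x < z" "z < y"
  shows "z \<in> level s"
proof -
  define t where "t = (y - z) / (y - x)"
  have t: "0 < t" "t < 1" using assms by (auto simp: t_def)
  have "t * (y - x) = y - z" using assms by (simp add: t_def)
  then have z: "t * x + (1 - t) * y = z" by (simp add: algebra_simps)
  define m where "m = min (W x) (W y)"
  have m: "s < m" using assms by (auto simp: m_def level_def)
  have "m = m powr t * m powr (1 - t)" using m s by (simp flip: powr_add)
  also have "\<dots> \<le> W x powr t * W y powr (1 - t)"
    using m s t by (intro mult_mono powr_mono2) (auto simp: m_def)
  also have "\<dots> \<le> W z" using log_concave[OF t, of x y] by (simp add: z)
  finally show ?thesis using m by (simp add: level_def)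
qed

lemma level_bounded: "0 \<le> s \<Longrightarrow> x \<in> level s \<Longrightarrow> \<bar>x\<bar> \<le> R"
  using support[of x] by (force simp: level_def)

lemma level_antimono: "s \<le> s' \<Longrightarrow> level s' \<subseteq> level s"
  by (auto simp: level_def)

lemma level_interval:
  assumes "0 \<le> s" "level s \<noteq> {}"
  shows "{Inf (level s)<..<Sup (level s)} \<subseteq> level s" "level s \<subseteq> {Inf (level s)..Sup (level s)}"
  using convex_bounded_real[of "level s" R] level_convex[OF assms(1)] level_bounded[OF assms(1)] assms(2) by blast+

lemma level_integral:
  fixes h :: "real \<Rightarrow> real"
  assumes "0 \<le> s" "level s \<noteq> {}" "continuous_on UNIV h"
  shows "(\<integral>x. indicator (level s) x * h x \<partial>lborel) = integral {Inf (level s)..Sup (level s)} h"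
  by (rule interval_like_integral[OF level_interval[OF assms(1,2)] level_measurable assms(3)])

lemma level_measure:
  assumes "0 \<le> s" "level s \<noteq> {}"
  shows "measure lborel (level s) = Sup (level s) - Inf (level s)" "Inf (level s) \<le> Sup (level s)"
proof -
  show le: "Inf (level s) \<le> Sup (level s)" using level_interval(2)[OF assms] assms(2) by force
  show "measure lborel (level s) = Sup (level s) - Inf (level s)"
    using level_integral[OF assms, of "\<lambda>_. 1"] le by simp
qed

lemma level_finite: assumes "0 \<le> s" shows "emeasure lborel (level s) < \<infinity>"
proof -
  have "emeasure lborel (level s) \<le> emeasure lborel {-R..R}"
    using level_bounded[OF assms] by (intro emeasure_mono) (auto simp: abs_le_iff minus_le_iff)
  also have "\<dots> < \<infinity>" by (simp add: emeasure_lborel_Icc_eq)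
  finally show ?thesis .
qed

text \<open>Markov's inequality for W^(1/n). The free exponent has two uses: n = 1 bounds the length
  of the core level, and a large n shows that level sets grow more slowly than any fixed negative
  power of s as s decreases.\<close>

lemma powr_level_measure:
  assumes x0: "0 < W x0" and n: "1 \<le> (n::nat)" and s: "0 < s"
  shows "measure lborel (level s) * W x0 \<le> n * (W x0 / s) powr (1 / n)"
proof -
  have fin: "emeasure lborel (level s) < \<infinity>" using s by (intro level_finite) auto
  have "s powr (1 / n) * measure lborel (level s) = (\<integral>x. s powr (1 / n) * indicator (level s) x \<partial>lborel)"
    by simp
  also have "\<dots> \<le> (\<integral>x. W x powr (1 / n) \<partial>lborel)"
  proof (rule integral_mono)
    show "integrable lborel (\<lambda>x. s powr (1 / n) * indicat_real (level s) x)"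
      using fin by (intro integrable_mult_right integrable_real_indicator) auto
    show "integrable lborel (\<lambda>x. W x powr (1 / n))" using n by (intro powr_integrable) auto
    show "s powr (1 / n) * indicat_real (level s) x \<le> W x powr (1 / n)" for x
      using s by (auto simp: indicator_def level_def intro!: powr_mono2)
  qed
  also have "\<dots> \<le> n * W x0 powr (1 / n - 1)"
  proof (cases "n = 1")
    case True then show ?thesis using mass nonneg x0 by simp
  next
    case False then show ?thesis using powr_integral_le[OF x0, of n] n by simp
  qed
  finally have "measure lborel (level s) \<le> n * W x0 powr (1 / n - 1) / s powr (1 / n)"
    using s by (simp add: field_simps)
  then have "measure lborel (level s) * W x0 \<le> n * W x0 powr (1 / n - 1) / s powr (1 / n) * W x0"
    using x0 by (intro mult_right_mono) auto
  also have "\<dots> = n * (W x0 powr (1 / n - 1) * W x0 powr 1) / s powr (1 / n)" using x0 by simp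
  also have "W x0 powr (1 / n - 1) * W x0 powr 1 = W x0 powr (1 / n)"
    using powr_add[of "W x0" "1 / n - 1" 1] by simp
  finally show ?thesis using x0 s by (simp add: powr_divide)
qed

lemma layer_cake:
  assumes "u \<in> borel_measurable borel" "\<And>x. \<bar>x\<bar> \<le> R \<Longrightarrow> \<bar>u x\<bar> \<le> K"
  shows "(\<integral>x. u x * W x \<partial>lborel) = (\<integral>s. indicator {0..} s * (\<integral>x. indicator (level s) x * u x \<partial>lborel) \<partial>lborel)"
    and "integrable lborel (\<lambda>s. indicator {0..} s * (\<integral>x. indicator (level s) x * u x \<partial>lborel))"
  using layer_cake_integral[OF meas nonneg bound support assms] by (simp_all add: level_def)

text \<open>The supremum of W need not be attained, and a point within a factor 2 of it is
  enough.\<close>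

lemma near_max: obtains x0 where "0 < W x0" "\<And>x. W x \<le> 2 * W x0"
proof -
  obtain z where z: "0 < W z" using exists_pos by blast
  have bdd: "bdd_above (range W)" using bound by (auto intro!: bdd_aboveI[of _ B])
  define S where "S = Sup (range W)"
  have S: "W x \<le> S" for x unfolding S_def using bdd by (auto intro: cSup_upper)
  have "S / 2 < S" using S[of z] z by simp
  then obtain x0 where "S / 2 < W x0" using less_cSup_iff[OF _ bdd, of "S/2"] S_def by auto
  moreover from this have "0 < W x0" using S[of z] z by linarith
  ultimately show ?thesis by (intro that[of x0]) (auto intro: order_trans[OF S])
qed


text \<open>For \<kappa> = c^2 / 16 the mass lost outside the core level is at most 2 sqrt(\<kappa>)
  = c / 2. One level serves all sets of mass c simultaneously.\<close>

lemma core_level: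
  assumes x0: "0 < W x0" and c: "0 < c" and k: "\<kappa> = c\<^sup>2 / 16"
    and [measurable]: "A \<in> sets borel" and A: "c \<le> (\<integral>x. indicator A x * W x \<partial>lborel)"
  shows "c / 2 \<le> (\<integral>x. indicator (A \<inter> level (\<kappa> * W x0)) x * W x \<partial>lborel)"
proof -
  have kp: "0 < \<kappa>" unfolding k using c by simp
  have int: "integrable lborel (\<lambda>x. indicat_real Z x * W x)" if [measurable]: "Z \<in> sets borel" for Z
    by (rule integrable_mult[where K = 1]) (auto simp: indicator_def)
  have "c \<le> (\<integral>x. indicator A x * W x \<partial>lborel)" by (rule A)
  also have "\<dots> \<le> (\<integral>x. indicator (A \<inter> level (\<kappa> * W x0)) x * W x + indicator {x. W x \<le> \<kappa> * W x0} x * W x \<partial>lborel)"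
    by (intro integral_mono Bochner_Integration.integrable_add int)
      (auto simp: indicator_def level_def nonneg)
  also have "\<dots> = (\<integral>x. indicator (A \<inter> level (\<kappa> * W x0)) x * W x \<partial>lborel)
     + (\<integral>x. indicator {x. W x \<le> \<kappa> * W x0} x * W x \<partial>lborel)"
    by (intro Bochner_Integration.integral_add int) auto
  also have "\<dots> \<le> (\<integral>x. indicator (A \<inter> level (\<kappa> * W x0)) x * W x \<partial>lborel) + 2 * sqrt \<kappa>"
    using low_density_mass[OF x0 kp] by simp
  also have "2 * sqrt \<kappa> = c / 2" using c by (simp add: k real_sqrt_divide)
  finally show ?thesis by simp
qed

lemma core_level_nonempty:
  assumes "0 < W x0" "0 < c" "\<kappa> = c\<^sup>2 / 16" "A \<in> sets borel" "c \<le> (\<integral>x. indicator A x * W x \<partial>lborel)"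
  shows "A \<inter> level (\<kappa> * W x0) \<noteq> {}"
  using core_level[OF assms] assms(2) by auto

section \<open>Oscillatory integrals and second moments against a log-concave density\<close>

text \<open>The integral is a superposition of oscillatory integrals over level sets. Both events
  have mass c and therefore meet the core level J, so P oscillates by b - a on J. A level set
  containing J pays with its own length, one contained in J with the length of J. The first
  contribution sums to the total mass 1, the second to at most 2 W(x0) |J| \<le> 32 / c^2.\<close>

theorem needle_oscillation:
  assumes E: "oscillation_constant d E" and d: "1 \<le> d" "degree P \<le> d" and t: "test_fun \<phi> D M" and M: "0 < M"
    and c: "0 < c" "c \<le> 1" and ab: "a < b"
    and Na: "c \<le> (\<integral>x. indicator {x. poly P x \<le> a} x * W x \<partial>lborel)"
    and Nb: "c \<le> (\<integral>x. indicator {x. b \<le> poly P x} x * W x \<partial>lborel)"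
  shows "(\<integral>x. D (poly P x) * W x \<partial>lborel)
    \<le> (1 + E * (1 + 32 / c\<^sup>2)) * (M powr (1 - 1 / d) * (b - a) powr (- 1 / d))"
proof -
  define \<omega> where "\<omega> = b - a"
  define Q where "Q = M powr (1 - 1 / d) * \<omega> powr (- 1 / d)"
  have om: "0 < \<omega>" using ab by (simp add: \<omega>_def)
  have Q: "0 < Q" using M om by (simp add: Q_def)
  have E0: "0 < E" using E by (simp add: oscillation_constant_def)
  have DM: "\<bar>D x\<bar> \<le> M" for x using t unfolding test_fun_def by blast
  have Dc: "continuous_on UNIV (\<lambda>x. D (poly P x))" by (rule test_fun_cont[OF t])
  have Dm[measurable]: "(\<lambda>x. D (poly P x)) \<in> borel_measurable borel"
    using Dc by (rule borel_measurable_continuous_onI)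
  have Pm[measurable]: "poly P \<in> borel_measurable borel"
    by (intro borel_measurable_continuous_onI continuous_intros)
  have Dint: "integrable lborel (\<lambda>x. D (poly P x) * W x)" by (rule integrable_mult[OF Dm DM])
  have "(\<integral>x. D (poly P x) * W x \<partial>lborel) \<le> (1 + E * (1 + 32 / c\<^sup>2)) * Q"
  proof (cases "1 \<le> M * \<omega>")
    \<comment> \<open>For M \<omega> < 1 there is no oscillation to exploit, and the trivial bound M
      is already below \<open>Q\<close>.\<close>
    case False
    have "(\<integral>x. D (poly P x) * W x \<partial>lborel) \<le> (\<integral>x. M * W x \<partial>lborel)"
    proof (rule integral_mono[OF Dint])
      show "integrable lborel (\<lambda>x. M * W x)" using integrable_W by simp
      show "D (poly P x) * W x \<le> M * W x" for x using DM[of "poly P x"] nonneg[of x] by (intro mult_right_mono) auto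
    qed
    also have "\<dots> = M" using mass by simp
    also have "\<dots> \<le> Q"
    proof -
      have "1 \<le> (M * \<omega>) powr (- 1 / d)"
        using False M om d powr_mono2'[of "- 1 / d" "M * \<omega>" 1] by simp
      then have "M * 1 \<le> M * (M * \<omega>) powr (- 1 / d)" using M by (intro mult_left_mono) auto
      also have "\<dots> = Q" using M om powr_add[of M 1 "- 1 / d"] by (simp add: Q_def powr_mult)
      finally show ?thesis by simp
    qed
    also have "\<dots> \<le> (1 + E * (1 + 32 / c\<^sup>2)) * Q" using Q E0 by simp
    finally show ?thesis .
  next
    case True
    obtain x0 where x0: "0 < W x0" "\<And>x. W x \<le> 2 * W x0" by (rule near_max) blast
    define \<kappa> where "\<kappa> = c\<^sup>2 / 16"
    have kp: "0 < \<kappa>" "0 < \<kappa> * W x0" using c x0 by (simp_all add: \<kappa>_def)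
    define J where "J = level (\<kappa> * W x0)"
    obtain x where x: "x \<in> J" "poly P x \<le> a"
      using core_level_nonempty[OF x0(1) c(1) \<kappa>_def _ Na] by (auto simp: J_def)
    obtain y where y: "y \<in> J" "b \<le> poly P y"
      using core_level_nonempty[OF x0(1) c(1) \<kappa>_def _ Nb] by (auto simp: J_def)
    have xy: "x \<noteq> y" "\<omega> \<le> poly P y - poly P x" using x y ab by (auto simp: \<omega>_def)
    define m where "m = (\<lambda>s. measure lborel (level s))"
    have inner: "(\<integral>x. indicator (level s) x * D (poly P x) \<partial>lborel) \<le> E * (m s + m (\<kappa> * W x0)) * Q"
      if s: "0 \<le> s" "level s \<noteq> {}" for s
    proof -
      define l r where "l = Inf (level s)" and "r = Sup (level s)"
      have lr: "l \<le> r" "m s = r - l" "level s \<subseteq> {l..r}"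
        using level_measure[OF s] level_interval[OF s] by (auto simp: l_def r_def m_def)
      have J: "J \<noteq> {}" using x by auto
      define l' r' where "l' = Inf J" and "r' = Sup J"
      have lr': "l' \<le> r'" "m (\<kappa> * W x0) = r' - l'" "J \<subseteq> {l'..r'}"
        using level_measure[of "\<kappa> * W x0"] level_interval[of "\<kappa> * W x0"] kp J by (auto simp: l'_def r'_def m_def J_def)
      have "integral {l..r} (\<lambda>x. D (poly P x)) \<le> E * (m s + m (\<kappa> * W x0)) * Q"
      proof (cases "s \<le> \<kappa> * W x0")
        case s': True
        then have sub: "J \<subseteq> {l..r}" using level_antimono[OF s'] lr by (auto simp: J_def)
        then have "x \<in> {l..r}" "y \<in> {l..r}" using x y by auto
        then have "l < r" using xy(1) by auto
        then have "integral {l..r} (\<lambda>x. D (poly P x)) \<le> E * (r - l) * Q"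
          unfolding Q_def using sub x y lr
          by (intro oscillatory_integralD[OF E d(2) t M om True _ _ _ xy(2)]) auto
        also have "\<dots> \<le> E * (m s + m (\<kappa> * W x0)) * Q"
          using E0 Q lr lr' by (intro mult_right_mono mult_left_mono) auto
        finally show ?thesis .
      next
        \<comment> \<open>The level set may miss x and y here; the oscillation is seen on the larger
          interval spanned by J, of which it spans a subinterval.\<close>
        case False
        then have sub: "level s \<subseteq> J" using level_antimono[of "\<kappa> * W x0" s] by (auto simp: J_def)
        have bb: "bdd_below J" "bdd_above J"
          using bdd_below_mono[OF bdd_below_Icc lr'(3)] bdd_above_mono[OF bdd_above_Icc lr'(3)] by auto
        have "l' \<le> l" "r \<le> r'"
          unfolding l_def r_def l'_def r'_def using sub bb s by (auto intro: cInf_superset_mono cSup_subset_mono)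
        moreover have "x \<in> {l'..r'}" "y \<in> {l'..r'}" using lr'(3) x y by auto
        moreover from this have "l' < r'" using xy(1) by auto
        ultimately have "integral {l..r} (\<lambda>x. D (poly P x)) \<le> E * (r' - l') * Q"
          unfolding Q_def using x y lr lr'
          by (intro oscillatory_integralD[OF E d(2) t M om True _ _ _ xy(2)]) auto
        also have "\<dots> \<le> E * (m s + m (\<kappa> * W x0)) * Q"
          using E0 Q lr lr' by (intro mult_right_mono mult_left_mono) auto
        finally show ?thesis .
      qed
      then show ?thesis using level_integral[OF s Dc] by (simp add: l_def r_def)
    qed
    have mint: "integrable lborel (\<lambda>s. indicator {0..} s * m s)" "(\<integral>s. indicator {0..} s * m s \<partial>lborel) = 1"
      using layer_cake[of "\<lambda>_. 1" 1] mass by (auto simp: m_def)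
    \<comment> \<open>Levels above 2 W(x0) are empty, so the length of J is charged on a bounded
      range of s.\<close>
    have Jint: "integrable lborel (\<lambda>s. indicator {0..2 * W x0} s * m (\<kappa> * W x0))"
      by (intro integrable_mult_left integrable_real_indicator) (auto simp: emeasure_lborel_Icc_eq)
    have "(\<integral>x. D (poly P x) * W x \<partial>lborel)
        = (\<integral>s. indicator {0..} s * (\<integral>x. indicator (level s) x * D (poly P x) \<partial>lborel) \<partial>lborel)"
      by (rule layer_cake[OF Dm DM])
    also have "\<dots> \<le> (\<integral>s. E * Q * (indicator {0..} s * m s + indicator {0..2 * W x0} s * m (\<kappa> * W x0)) \<partial>lborel)"
    proof (rule integral_mono)
      show "integrable lborel (\<lambda>s. indicator {0..} s * (\<integral>x. indicator (level s) x * D (poly P x) \<partial>lborel))"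
        by (rule layer_cake[OF Dm DM])
      show "integrable lborel (\<lambda>s. E * Q * (indicator {0..} s * m s + indicator {0..2 * W x0} s * m (\<kappa> * W x0)))"
        by (intro integrable_mult_right Bochner_Integration.integrable_add mint Jint)
      fix s :: real
      show "indicator {0..} s * (\<integral>x. indicator (level s) x * D (poly P x) \<partial>lborel)
         \<le> E * Q * (indicator {0..} s * m s + indicator {0..2 * W x0} s * m (\<kappa> * W x0))"
      proof (cases "0 \<le> s \<and> level s \<noteq> {}")
        case s: True
        then obtain z where "s < W z" by (auto simp: level_def)
        then have "s \<le> 2 * W x0" using x0(2)[of z] by linarith
        then show ?thesis using inner[of s] s by (simp add: mult_ac)
      next
        case False
        then consider "s < 0" | "level s = {}" by linarith
        then show ?thesis
          by cases (use E0 Q in \<open>auto simp: m_def intro!: mult_nonneg_nonneg\<close>)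
      qed
    qed
    also have "\<dots> = E * Q * (1 + 2 * W x0 * m (\<kappa> * W x0))"
    proof -
      have "(\<integral>s. indicator {0..} s * m s + indicator {0..2 * W x0} s * m (\<kappa> * W x0) \<partial>lborel)
         = (\<integral>s. indicator {0..} s * m s \<partial>lborel) + (\<integral>s. indicator {0..2 * W x0} s * m (\<kappa> * W x0) \<partial>lborel)"
        by (rule Bochner_Integration.integral_add[OF mint(1) Jint])
      also have "(\<integral>s. indicator {0..2 * W x0} s * m (\<kappa> * W x0) \<partial>lborel) = 2 * W x0 * m (\<kappa> * W x0)"
        using x0 by simp
      finally show ?thesis using mint(2) by simp
    qed
    also have "\<dots> \<le> E * Q * (1 + 32 / c\<^sup>2)"
    proof -
      have "m (\<kappa> * W x0) * W x0 \<le> 1 / \<kappa>"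
        using powr_level_measure[OF x0(1) _ kp(2), of 1] x0 kp by (simp add: m_def)
      then have "2 * W x0 * m (\<kappa> * W x0) \<le> 2 * (1 / \<kappa>)" by (simp add: mult_ac)
      then show ?thesis using E0 Q by (simp add: \<kappa>_def)
    qed
    also have "\<dots> \<le> (1 + E * (1 + 32 / c\<^sup>2)) * Q" using Q by (simp add: algebra_simps)
    finally show ?thesis .
  qed
  then show ?thesis by (simp add: Q_def \<omega>_def)
qed

text \<open>P is at most D in modulus on a portion of J of definite length, so on a level set
  containing x and J it grows at most like the d-th power of the length. That length is controlled
  by a small power of W(x0) / W(x). With n = 4 d the square of P costs W^(-1/2), and the integral of
  sqrt(W) that remains has an explicit bound.\<close>

theorem needle_second_moment:
  assumes E: "oscillation_constant d E" and d: "1 \<le> d" "degree P \<le> d" and D: "0 < D"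
    and c: "0 < c" "c \<le> 1"
    and N: "c \<le> (\<integral>x. indicator {x. \<bar>poly P x\<bar> \<le> D} x * W x \<partial>lborel)"
  shows "(\<integral>x. (poly P x)\<^sup>2 * W x \<partial>lborel) \<le> (8 + 4 * ((16 * d * pi * E / c) ^ d)\<^sup>2 * sqrt (32 / c\<^sup>2)) * D\<^sup>2"
proof -
  define G where "G = (16 * d * pi * E / c) ^ d"
  define \<kappa> where "\<kappa> = c\<^sup>2 / 16"
  have E0: "0 < E" using E by (simp add: oscillation_constant_def)
  have G0: "0 \<le> G" using E0 c by (simp add: G_def)
  have Pm[measurable]: "poly P \<in> borel_measurable borel"
    by (intro borel_measurable_continuous_onI continuous_intros)
  obtain x0 where x0: "0 < W x0" "\<And>x. W x \<le> 2 * W x0" by (rule near_max) blast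
  have kp: "0 < \<kappa>" "0 < \<kappa> * W x0" "\<kappa> \<le> 1"
    using c x0 power_le_one[of c 2] by (auto simp: \<kappa>_def)
  define A where "A = {x. \<bar>poly P x\<bar> \<le> D}"
  have Am[measurable]: "A \<in> sets borel" unfolding A_def by measurable
  define J where "J = level (\<kappa> * W x0)"
  have Jm[measurable]: "J \<in> sets borel" by (simp add: J_def)
  have N': "c / 2 \<le> (\<integral>x. indicator (A \<inter> J) x * W x \<partial>lborel)"
    unfolding J_def using N by (intro core_level[OF x0(1) c(1) \<kappa>_def]) (auto simp: A_def)
  obtain y where y: "y \<in> A" "y \<in> J"
    using core_level_nonempty[OF x0(1) c(1) \<kappa>_def Am] N by (auto simp: J_def A_def)
  \<comment> \<open>A mass of c / 2 under a density of at most 2 W(x0) occupies length at least c /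
    (4 W(x0)).\<close>
  define m0 where "m0 = c / (4 * W x0)"
  have m0: "0 < m0" using c x0 by (simp add: m0_def)
  have fin: "emeasure lborel (Z \<inter> level s) < \<infinity>" if "0 \<le> s" "Z \<in> sets borel" for Z s
    using level_finite[OF that(1)] emeasure_mono[of "Z \<inter> level s" "level s" lborel] by (auto intro: le_less_trans)
  have mA: "m0 \<le> measure lborel (A \<inter> J)"
  proof -
    have "(\<integral>x. indicator (A \<inter> J) x * W x \<partial>lborel) \<le> (\<integral>x. 2 * W x0 * indicator (A \<inter> J) x \<partial>lborel)"
    proof (rule integral_mono)
      show "integrable lborel (\<lambda>x. indicat_real (A \<inter> J) x * W x)"
        by (rule integrable_mult[where K = 1]) (auto simp: indicator_def)
      show "integrable lborel (\<lambda>x. 2 * W x0 * indicat_real (A \<inter> J) x)"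
        using fin[of "\<kappa> * W x0" A] kp by (intro integrable_mult_right integrable_real_indicator) (auto simp: J_def)
      show "indicat_real (A \<inter> J) x * W x \<le> 2 * W x0 * indicat_real (A \<inter> J) x" for x
        using x0(2)[of x] by (auto simp: indicator_def)
    qed
    also have "\<dots> = 2 * W x0 * measure lborel (A \<inter> J)" by simp
    finally show ?thesis using N' x0 by (simp add: m0_def field_simps)
  qed
  have pt: "(poly P x)\<^sup>2 * W x \<le> D\<^sup>2 * (8 * W x + 2 * G\<^sup>2 * sqrt (2 / \<kappa>) * sqrt (W x0) * W x powr (1/2))" for x
  proof (cases "W x = 0")
    case False
    then have Wx: "0 < W x" using nonneg[of x] by simp
    \<comment> \<open>Low enough for the level set to contain both x and J, yet not below \<kappa> /
      2 times W(x).\<close>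
    define s where "s = min (W x / 2) (\<kappa> * W x0)"
    have s: "0 < s" "s \<le> \<kappa> * W x0" "s < W x" using Wx kp by (auto simp: s_def)
    have sl: "\<kappa> / 2 * W x \<le> s"
      using kp Wx x0(2)[of x] mult_left_mono[of "W x" "2 * W x0" \<kappa>] mult_right_mono[of \<kappa> 1 "W x"]
      by (auto simp: s_def)
    define l r where "l = Inf (level s)" and "r = Sup (level s)"
    have xl: "x \<in> level s" using s by (simp add: level_def)
    have sub: "J \<subseteq> level s" using level_antimono s by (simp add: J_def)
    have lr: "measure lborel (level s) = r - l" "level s \<subseteq> {l..r}" "{l<..<r} \<subseteq> level s"
      using level_measure(1)[of s] level_interval[of s] s xl by (auto simp: l_def r_def)
    have xy: "x \<in> {l..r}" "y \<in> {l..r}" using lr xl y sub by auto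
    have px: "\<bar>poly P x\<bar> \<le> D * (2 + G * (2 * W x0 / (\<kappa> * W x)) powr (1/4))"
    proof (cases "x = y")
      case True
      have "D * 1 \<le> D * (2 + G * (2 * W x0 / (\<kappa> * W x)) powr (1/4))"
        using D G0 by (intro mult_left_mono add_increasing2) auto
      then show ?thesis using y True by (simp add: A_def)
    next
      case False
      then have lr': "l < r" using xy by auto
      have m: "m0 \<le> measure lborel ({l..r} \<inter> {x. \<bar>poly P x\<bar> \<le> D})"
      proof -
        have "measure lborel (A \<inter> J) \<le> measure lborel ({l..r} \<inter> A)"
        proof (rule measure_mono_fmeasurable)
          show "A \<inter> J \<subseteq> {l..r} \<inter> A" using sub lr by auto
          have "emeasure lborel ({l..r} \<inter> A) \<le> emeasure lborel {l..r}" by (intro emeasure_mono) auto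
          then show "{l..r} \<inter> A \<in> fmeasurable lborel"
            using lr' by (intro fmeasurableI) (auto simp: emeasure_lborel_Icc_eq intro: le_less_trans)
        qed auto
        then show ?thesis using mA by (simp add: A_def)
      qed
      have "\<bar>poly P x - poly P y\<bar> \<le> D * (1 + (pi * E * (r - l) / m0) ^ d)"
        by (rule poly_interval_bound[OF E d D lr' xy(2,1) m0 m])
      also have "(pi * E * (r - l) / m0) ^ d \<le> G * (2 * W x0 / (\<kappa> * W x)) powr (1/4)"
      proof -
        \<comment> \<open>The exponent 1 / (4 d) becomes 1/4 after the d-th power and 1/2 after
          squaring P.\<close>
        have n: "(1::nat) \<le> 4 * d" using d by simp
        have "pi * E * (r - l) / m0 = 4 * pi * E / c * ((r - l) * W x0)" using c x0 by (simp add: m0_def)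
        also have "\<dots> \<le> 4 * pi * E / c * ((4 * d) * (W x0 / s) powr (1 / (4 * d)))"
          using powr_level_measure[OF x0(1) n s(1)] lr E0 c by (intro mult_left_mono) auto
        also have "\<dots> = (16 * d * pi * E / c) * (W x0 / s) powr (1 / (4 * d))" by simp
        finally have "(pi * E * (r - l) / m0) ^ d \<le> ((16 * d * pi * E / c) * (W x0 / s) powr (1 / (4 * d))) ^ d"
          using E0 lr' m0 by (intro power_mono) auto
        also have "\<dots> = G * ((W x0 / s) powr (1 / (4 * d))) ^ d" unfolding G_def by (rule power_mult_distrib)
        also have "((W x0 / s) powr (1 / (4 * d))) ^ d = (W x0 / s) powr (1 / 4)"
        proof -
          have "((W x0 / s) powr (1 / (4 * d))) ^ d = (W x0 / s) powr (1 / (4 * d) * d)"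
            using x0 s by (simp add: powr_powr flip: powr_realpow)
          then show ?thesis using d by simp
        qed
        also have "(W x0 / s) powr (1 / 4) \<le> (2 * W x0 / (\<kappa> * W x)) powr (1/4)"
        proof (rule powr_mono2)
          have "W x0 / s \<le> W x0 / (\<kappa> / 2 * W x)" using sl x0 s kp Wx by (intro divide_left_mono) auto
          then show "W x0 / s \<le> 2 * W x0 / (\<kappa> * W x)" by (simp add: mult.commute)
        qed (use x0 s in auto)
        finally show ?thesis using G0 by (simp add: mult_left_mono)
      qed
      finally have "\<bar>poly P x - poly P y\<bar> \<le> D * (1 + G * (2 * W x0 / (\<kappa> * W x)) powr (1/4))"
        using D by (simp add: mult_left_mono)
      moreover have "\<bar>poly P y\<bar> \<le> D" using y by (simp add: A_def)
      ultimately show ?thesis by (simp add: algebra_simps)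
    qed
    define q where "q = (2 * W x0 / (\<kappa> * W x)) powr (1/4)"
    have "(poly P x)\<^sup>2 \<le> (D * (2 + G * q))\<^sup>2"
      using px unfolding q_def[symmetric] by (metis abs_ge_zero power2_abs power_mono)
    also have "\<dots> \<le> D\<^sup>2 * (8 + 2 * (G\<^sup>2 * q\<^sup>2))"
    proof -
      have "(2 + G * q)\<^sup>2 \<le> 8 + 2 * (G * q)\<^sup>2" using zero_le_power2[of "2 - G * q"] by (simp add: power2_eq_square algebra_simps)
      then show ?thesis unfolding power_mult_distrib by (intro mult_left_mono) auto
    qed
    finally have "(poly P x)\<^sup>2 * W x \<le> D\<^sup>2 * (8 + 2 * (G\<^sup>2 * q\<^sup>2)) * W x" using Wx by (intro mult_right_mono) auto
    also have "q\<^sup>2 = sqrt (2 / \<kappa>) * sqrt (W x0) / sqrt (W x)"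
    proof -
      have "q\<^sup>2 = (2 * W x0 / (\<kappa> * W x)) powr (1/4 * 2)"
        unfolding q_def using x0 kp Wx by (simp add: powr_powr flip: powr_numeral)
      also have "\<dots> = sqrt (2 * W x0 / (\<kappa> * W x))" using x0 kp Wx by (simp add: powr_half_sqrt)
      finally show ?thesis by (simp add: real_sqrt_mult real_sqrt_divide)
    qed
    also have "D\<^sup>2 * (8 + 2 * (G\<^sup>2 * (sqrt (2 / \<kappa>) * sqrt (W x0) / sqrt (W x)))) * W x
       = D\<^sup>2 * (8 * W x + 2 * G\<^sup>2 * sqrt (2 / \<kappa>) * sqrt (W x0) * (W x / sqrt (W x)))" by (simp add: algebra_simps)
    also have "W x / sqrt (W x) = W x powr (1/2)" using Wx by (simp add: powr_half_sqrt real_div_sqrt)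
    finally show ?thesis .
  qed simp
  have "(\<integral>x. (poly P x)\<^sup>2 * W x \<partial>lborel)
     \<le> (\<integral>x. D\<^sup>2 * (8 * W x + 2 * G\<^sup>2 * sqrt (2 / \<kappa>) * sqrt (W x0) * W x powr (1/2)) \<partial>lborel)"
  proof (rule integral_mono)
    have "compact (poly P ` {-R..R})" by (intro compact_continuous_image continuous_intros) auto
    then have "bounded (poly P ` {-R..R})" by (rule compact_imp_bounded)
    then obtain K where "\<forall>y\<in>poly P ` {-R..R}. norm y \<le> K" unfolding bounded_iff by blast
    then have K: "\<And>x. x \<in> {-R..R} \<Longrightarrow> \<bar>poly P x\<bar> \<le> K" by simp
    show "integrable lborel (\<lambda>x. (poly P x)\<^sup>2 * W x)"
    proof (rule integrable_mult[where K = "K\<^sup>2"])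
      fix x assume "\<bar>x\<bar> \<le> R"
      then have "\<bar>poly P x\<bar> \<le> K" by (intro K) auto
      from power_mono[OF this, of 2] show "\<bar>(poly P x)\<^sup>2\<bar> \<le> K\<^sup>2" by simp
    qed measurable
    show "integrable lborel (\<lambda>x. D\<^sup>2 * (8 * W x + 2 * G\<^sup>2 * sqrt (2 / \<kappa>) * sqrt (W x0) * W x powr (1/2)))"
      by (intro integrable_mult_right Bochner_Integration.integrable_add integrable_W powr_integrable) auto
  qed (rule pt)
  also have "\<dots> = D\<^sup>2 * (8 + 2 * G\<^sup>2 * sqrt (2 / \<kappa>) * sqrt (W x0) * (\<integral>x. W x powr (1/2) \<partial>lborel))"
    using integrable_W powr_integrable[of "1/2"] mass by (simp add: Bochner_Integration.integral_add)
  also have "\<dots> \<le> D\<^sup>2 * (8 + 2 * G\<^sup>2 * sqrt (2 / \<kappa>) * sqrt (W x0) * (2 / sqrt (W x0)))"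
  proof -
    have "(\<integral>x. W x powr (1/2) \<partial>lborel) \<le> 2 / sqrt (W x0)"
      using powr_integral_le[OF x0(1), of 2] x0(1) powr_minus_divide[of "W x0" "1/2"] by (simp add: powr_half_sqrt)
    then show ?thesis using kp x0 by (intro mult_left_mono add_left_mono) auto
  qed
  also have "\<dots> = (8 + 4 * G\<^sup>2 * sqrt (32 / c\<^sup>2)) * D\<^sup>2" using x0 by (simp add: \<kappa>_def)
  finally show ?thesis by (simp add: G_def)
qed

end

section \<open>The Prekopa-Leindler inequality\<close>

lemma measure_affine_vimage:
  fixes A :: "real set"
  assumes "0 < t" "A \<in> sets borel"
  shows "measure lborel {z. (z - c) / t \<in> A} = t * measure lborel A"
proof -
  have "measure lborel {z. (z - c) / t \<in> A} = (\<integral>z. indicat_real A ((z - c) / t) \<partial>lborel)"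
  proof -
    have "(\<integral>z. indicat_real A ((z - c) / t) \<partial>lborel) = (\<integral>z. indicat_real {z. (z - c) / t \<in> A} z \<partial>lborel)"
      by (intro Bochner_Integration.integral_cong) (auto simp: indicator_def)
    then show ?thesis by simp
  qed
  also have "\<dots> = \<bar>t\<bar> *\<^sub>R (\<integral>x. indicat_real A ((c + t * x - c) / t) \<partial>lborel)"
    by (rule lborel_integral_real_affine) (use assms in auto)
  also have "\<dots> = t * measure lborel A" using assms by simp
  finally show ?thesis .
qed

text \<open>Take a near the supremum of A and b near the infimum of B. Up to the cuts at a and b,
  the copies t A + (1 - t) b and t a + (1 - t) B lie in Z on different sides of t a + (1 - t) b, so
  their lengths add. Each cut costs at most e, since the extrema need not be attained.\<close>

lemma brunn_minkowski_1:
  fixes A B Z :: "real set"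
  assumes t: "0 < t" "t < 1" and [measurable]: "A \<in> sets borel" "B \<in> sets borel" "Z \<in> sets borel"
    and ne: "A \<noteq> {}" "B \<noteq> {}" and bd: "\<And>x. x \<in> A \<union> B \<union> Z \<Longrightarrow> \<bar>x\<bar> \<le> R"
    and sum: "\<And>x y. x \<in> A \<Longrightarrow> y \<in> B \<Longrightarrow> t * x + (1 - t) * y \<in> Z"
  shows "t * measure lborel A + (1 - t) * measure lborel B \<le> measure lborel Z"
proof (rule field_le_epsilon)
  fix e :: real assume e: "0 < e"
  have fm: "S \<in> fmeasurable lborel" if "S \<in> sets borel" "\<And>x. x \<in> S \<Longrightarrow> \<bar>x\<bar> \<le> r" for S and r :: real
  proof (rule fmeasurableI)
    have "emeasure lborel S \<le> emeasure lborel {-r..r}"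
      using that(2) by (intro emeasure_mono) (auto simp: abs_le_iff minus_le_iff)
    also have "\<dots> < \<infinity>" by (simp add: emeasure_lborel_Icc_eq)
    finally show "emeasure lborel S < \<infinity>" .
  qed (use that in simp)
  have bA: "bdd_above A" using bd by (auto intro!: bdd_aboveI[of _ R] simp: abs_le_iff)
  have bB: "bdd_below B" using bd by (force intro!: bdd_belowI[of _ "-R"] simp: abs_le_iff)
  obtain a where a: "a \<in> A" "Sup A - e < a" using less_cSup_iff[OF ne(1) bA, of "Sup A - e"] e by auto
  obtain b where b: "b \<in> B" "b < Inf B + e" using cInf_less_iff[OF ne(2) bB, of "Inf B + e"] e by auto
  define A1 B1 where "A1 = A \<inter> {..a}" and "B1 = B \<inter> {b..}"
  have [measurable]: "A1 \<in> sets borel" "B1 \<in> sets borel" by (auto simp: A1_def B1_def)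
  have mA: "measure lborel A \<le> measure lborel A1 + e"
  proof -
    have "measure lborel A \<le> measure lborel (A1 \<union> {a..Sup A})"
      using bA by (intro measure_mono_fmeasurable fmeasurable.Un fm[of A1 R] fm[of "{a..Sup A}" "\<bar>a\<bar> + \<bar>Sup A\<bar>"])
        (auto simp: A1_def intro: cSup_upper bd)
    also have "\<dots> \<le> measure lborel A1 + measure lborel {a..Sup A}"
      by (intro measure_Un_le) auto
    also have "measure lborel {a..Sup A} \<le> e" using a cSup_upper[OF a(1) bA] by simp
    finally show ?thesis by simp
  qed
  have mB: "measure lborel B \<le> measure lborel B1 + e"
  proof -
    have "measure lborel B \<le> measure lborel (B1 \<union> {Inf B..b})"
      using bB by (intro measure_mono_fmeasurable fmeasurable.Un fm[of B1 R] fm[of "{Inf B..b}" "\<bar>b\<bar> + \<bar>Inf B\<bar>"])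
        (auto simp: B1_def intro: cInf_lower bd)
    also have "\<dots> \<le> measure lborel B1 + measure lborel {Inf B..b}"
      by (intro measure_Un_le) auto
    also have "measure lborel {Inf B..b} \<le> e" using b cInf_lower[OF b(1) bB] by simp
    finally show ?thesis by simp
  qed
  define p where "p = t * a + (1 - t) * b"
  define Z1 Z2 where "Z1 = {z. (z - (1 - t) * b) / t \<in> A1}" and "Z2 = {z. (z - t * a) / (1 - t) \<in> B1}"
  have [measurable]: "Z1 \<in> sets borel" "Z2 \<in> sets borel" by (auto simp: Z1_def Z2_def)
  have Z1: "Z1 \<subseteq> Z \<inter> {..p}"
  proof
    fix z assume "z \<in> Z1"
    then have z: "(z - (1 - t) * b) / t \<in> A" "(z - (1 - t) * b) / t \<le> a" by (auto simp: Z1_def A1_def)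
    then show "z \<in> Z \<inter> {..p}" using sum[OF z(1) b(1)] t by (auto simp: p_def field_simps)
  qed
  have Z2: "Z2 \<subseteq> Z \<inter> {p..}"
  proof
    fix z assume "z \<in> Z2"
    then have z: "(z - t * a) / (1 - t) \<in> B" "b \<le> (z - t * a) / (1 - t)" by (auto simp: Z2_def B1_def)
    have e: "t * a + (1 - t) * ((z - t * a) / (1 - t)) = z" using t by simp
    have "z \<in> Z" using sum[OF a(1) z(1)] unfolding e .
    moreover have "p \<le> z" using z(2) t by (simp add: p_def field_simps)
    ultimately show "z \<in> Z \<inter> {p..}" by simp
  qed
  have fmZ: "Z \<in> fmeasurable lborel" "Z1 \<in> fmeasurable lborel" "Z2 \<in> fmeasurable lborel"
    using Z1 Z2 bd by (auto intro!: fm[of _ R])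
  \<comment> \<open>The two copies can share only the point p.\<close>
  have "measure lborel Z1 + measure lborel Z2 = measure lborel (Z1 - {p}) + measure lborel Z2"
  proof -
    have "measure lborel (Z1 - {p}) = measure lborel Z1"
      by (rule measure_Diff_null_set) auto
    then show ?thesis by simp
  qed
  also have "\<dots> = measure lborel ((Z1 - {p}) \<union> Z2)"
    by (rule measure_Un_AE[symmetric]) (use Z1 Z2 fmZ in \<open>force intro!: fmeasurable_Diff\<close>)+
  also have "\<dots> \<le> measure lborel Z" using Z1 Z2 fmZ by (intro measure_mono_fmeasurable) auto
  finally have "measure lborel Z1 + measure lborel Z2 \<le> measure lborel Z" .
  moreover have "measure lborel Z1 = t * measure lborel A1"
    unfolding Z1_def by (rule measure_affine_vimage) (use t in auto)
  moreover have "measure lborel Z2 = (1 - t) * measure lborel B1"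
    unfolding Z2_def by (rule measure_affine_vimage) (use t in auto)
  moreover have "t * measure lborel A \<le> t * (measure lborel A1 + e)" "(1 - t) * measure lborel B \<le> (1 - t) * (measure lborel B1 + e)"
    using mA mB t by (auto intro: mult_left_mono)
  ultimately show "t * measure lborel A + (1 - t) * measure lborel B \<le> measure lborel Z + e"
    by (simp add: algebra_simps)
qed

lemma powr_mult_ge_min:
  fixes m :: real
  assumes "0 < t" "t < 1" "0 < m" "m \<le> a" "m \<le> b"
  shows "m \<le> a powr t * b powr (1 - t)"
proof -
  have "m = m powr t * m powr (1 - t)" using assms by (simp flip: powr_add)
  also have "\<dots> \<le> a powr t * b powr (1 - t)" using assms by (intro mult_mono powr_mono2) auto
  finally show ?thesis .
qed

text \<open>With both suprema equal to 1, the sets {f > s} and {g > s} are nonempty for the same s,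
  and their combination lies in {h > s}. Integrating Brunn-Minkowski over s gives the arithmetic
  mean, which is stronger than the geometric one.\<close>

lemma prekopa_leindler_normalised:
  fixes f g h :: "real \<Rightarrow> real"
  assumes t: "0 < t" "t < 1" and [measurable]: "f \<in> borel_measurable borel" "g \<in> borel_measurable borel" "h \<in> borel_measurable borel"
    and nn: "\<And>x. 0 \<le> f x" "\<And>x. 0 \<le> g x" "\<And>x. 0 \<le> h x"
    and bd: "\<And>x. f x \<le> 1" "\<And>x. g x \<le> 1" "\<And>x. h x \<le> B"
    and supp: "\<And>x. R < \<bar>x\<bar> \<Longrightarrow> f x = 0" "\<And>x. R < \<bar>x\<bar> \<Longrightarrow> g x = 0" "\<And>x. R < \<bar>x\<bar> \<Longrightarrow> h x = 0"
    and sup: "\<And>s. s < 1 \<Longrightarrow> \<exists>x. s < f x" "\<And>s. s < 1 \<Longrightarrow> \<exists>x. s < g x"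
    and pl: "\<And>x y. f x powr t * g y powr (1 - t) \<le> h (t * x + (1 - t) * y)"
  shows "t * (\<integral>x. f x \<partial>lborel) + (1 - t) * (\<integral>x. g x \<partial>lborel) \<le> (\<integral>x. h x \<partial>lborel)"
proof -
  have lc: "(\<integral>x. w x \<partial>lborel) = (\<integral>s. indicator {0..} s * measure lborel {x. s < w x} \<partial>lborel)"
    "integrable lborel (\<lambda>s. indicator {0..} s * measure lborel {x. s < w x})"
    if [measurable]: "w \<in> borel_measurable borel" and "\<And>x. 0 \<le> w x" "\<And>x. w x \<le> K" "\<And>x. R < \<bar>x\<bar> \<Longrightarrow> w x = 0" for w and K :: real
    using layer_cake_integral[of w K R "\<lambda>_. 1" 1] that by auto
  note F = lc[of f 1, OF _ nn(1) bd(1) supp(1)] and G = lc[of g 1, OF _ nn(2) bd(2) supp(2)]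
    and H = lc[of h B, OF _ nn(3) bd(3) supp(3)]
  have "t * (\<integral>x. f x \<partial>lborel) + (1 - t) * (\<integral>x. g x \<partial>lborel)
     = (\<integral>s. t * (indicator {0..} s * measure lborel {x. s < f x}) + (1 - t) * (indicator {0..} s * measure lborel {x. s < g x}) \<partial>lborel)"
    using F G by (subst Bochner_Integration.integral_add) auto
  also have "\<dots> \<le> (\<integral>s. indicator {0..} s * measure lborel {x. s < h x} \<partial>lborel)"
  proof (rule integral_mono)
    fix s :: real
    show "t * (indicator {0..} s * measure lborel {x. s < f x}) + (1 - t) * (indicator {0..} s * measure lborel {x. s < g x})
       \<le> indicator {0..} s * measure lborel {x. s < h x}"
    proof (cases "0 \<le> s \<and> s < 1")
      case True
      have supp': "\<bar>x\<bar> \<le> R" if "s < w x" "R < \<bar>x\<bar> \<Longrightarrow> w x = 0" for w :: "real \<Rightarrow> real" and x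
        using that True by force
      have "t * measure lborel {x. s < f x} + (1 - t) * measure lborel {x. s < g x} \<le> measure lborel {x. s < h x}"
      proof (rule brunn_minkowski_1[OF t, where R = R])
        show "{x. s < f x} \<noteq> {}" "{x. s < g x} \<noteq> {}" using sup[of s] True by auto
        fix x y assume "x \<in> {x. s < f x}" "y \<in> {x. s < g x}"
        then have "s < min (f x) (g y)" by auto
        also have "\<dots> \<le> f x powr t * g y powr (1 - t)"
          using \<open>s < min (f x) (g y)\<close> True t by (intro powr_mult_ge_min) auto
        also have "\<dots> \<le> h (t * x + (1 - t) * y)" by (rule pl)
        finally show "t * x + (1 - t) * y \<in> {x. s < h x}" by simp
      qed (use supp supp' in auto)
      then show ?thesis using True by simp
    next
      case False
      have "measure lborel {x. s < f x} = 0" "measure lborel {x. s < g x} = 0" if "1 \<le> s"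
      proof -
        have "{x. s < f x} = {}" "{x. s < g x} = {}" using that bd(1,2) by (auto simp: not_less intro: order_trans)
        then show "measure lborel {x. s < f x} = 0" "measure lborel {x. s < g x} = 0" by simp_all
      qed
      then show ?thesis using False by (auto simp: indicator_def)
    qed
  qed (use F G H in \<open>auto intro!: Bochner_Integration.integrable_add integrable_mult_right\<close>)
  also have "\<dots> = (\<integral>x. h x \<partial>lborel)" using H by simp
  finally show ?thesis .
qed

text \<open>Dividing f and g by their suprema and h by the matching geometric mean \<open>e\<close>
  preserves the hypothesis; Young's inequality then passes from the arithmetic to the geometric
  mean.\<close>

lemma prekopa_leindler_1:
  fixes f g h :: "real \<Rightarrow> real"
  assumes t: "0 < t" "t < 1" and [measurable]: "f \<in> borel_measurable borel" "g \<in> borel_measurable borel" "h \<in> borel_measurable borel"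
    and nn: "\<And>x. 0 \<le> f x" "\<And>x. 0 \<le> g x" "\<And>x. 0 \<le> h x"
    and bd: "\<And>x. f x \<le> B" "\<And>x. g x \<le> B" "\<And>x. h x \<le> B"
    and supp: "\<And>x. R < \<bar>x\<bar> \<Longrightarrow> f x = 0" "\<And>x. R < \<bar>x\<bar> \<Longrightarrow> g x = 0" "\<And>x. R < \<bar>x\<bar> \<Longrightarrow> h x = 0"
    and pl: "\<And>x y. f x powr t * g y powr (1 - t) \<le> h (t * x + (1 - t) * y)"
  shows "(\<integral>x. f x \<partial>lborel) powr t * (\<integral>x. g x \<partial>lborel) powr (1 - t) \<le> (\<integral>x. h x \<partial>lborel)"
proof (cases "(\<integral>x. f x \<partial>lborel) = 0 \<or> (\<integral>x. g x \<partial>lborel) = 0")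
  case True
  then show ?thesis using nn by (auto intro!: Bochner_Integration.integral_nonneg)
next
  case False
  define a where "a = Sup (range f)"
  define b where "b = Sup (range g)"
  have bdd: "bdd_above (range f)" "bdd_above (range g)" using bd by (auto intro!: bdd_aboveI[of _ B])
  have le: "f x \<le> a" "g x \<le> b" for x unfolding a_def b_def using bdd by (auto intro: cSup_upper)
  have pos: "0 < a" "0 < b"
  proof -
    have "\<exists>x. w x \<noteq> 0" if "(\<integral>x. w x \<partial>lborel) \<noteq> 0" for w :: "real \<Rightarrow> real"
      using that by (metis Bochner_Integration.integral_zero Bochner_Integration.integral_cong)
    then obtain x y where "f x \<noteq> 0" "g y \<noteq> 0" using False by blast
    then have "0 < f x" "0 < g y" using nn(1)[of x] nn(2)[of y] by auto
    then show "0 < a" "0 < b" using le(1)[of x] le(2)[of y] by linarith+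
  qed
  define e where "e = a powr t * b powr (1 - t)"
  have e: "0 < e" using pos by (simp add: e_def)
  have "t * (\<integral>x. f x / a \<partial>lborel) + (1 - t) * (\<integral>x. g x / b \<partial>lborel) \<le> (\<integral>x. h x / e \<partial>lborel)"
  proof (rule prekopa_leindler_normalised[OF t])
    show "\<exists>x. s < f x / a" if "s < 1" for s
    proof -
      have "s * a < a" using that pos by simp
      then obtain x where "s * a < f x" using less_cSup_iff[OF _ bdd(1), of "s * a"] by (auto simp: a_def)
      then show ?thesis using pos by (auto simp: field_simps intro!: exI[of _ x])
    qed
    show "\<exists>x. s < g x / b" if "s < 1" for s
    proof -
      have "s * b < b" using that pos by simp
      then obtain x where "s * b < g x" using less_cSup_iff[OF _ bdd(2), of "s * b"] by (auto simp: b_def)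
      then show ?thesis using pos by (auto simp: field_simps intro!: exI[of _ x])
    qed
    show "h x / e \<le> B / e" for x using bd e by (intro divide_right_mono) auto
    show "(f x / a) powr t * (g y / b) powr (1 - t) \<le> h (t * x + (1 - t) * y) / e" for x y
    proof -
      have "(f x / a) powr t * (g y / b) powr (1 - t) = f x powr t * g y powr (1 - t) / e"
        using nn pos by (simp add: powr_divide e_def)
      also have "\<dots> \<le> h (t * x + (1 - t) * y) / e" using pl e by (intro divide_right_mono) auto
      finally show ?thesis .
    qed
  qed (use nn le pos e supp in auto)
  then have n: "t * ((\<integral>x. f x \<partial>lborel) / a) + (1 - t) * ((\<integral>x. g x \<partial>lborel) / b) \<le> (\<integral>x. h x \<partial>lborel) / e" by simp
  have "(\<integral>x. f x \<partial>lborel) > 0" "(\<integral>x. g x \<partial>lborel) > 0"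
    using False Bochner_Integration.integral_nonneg[of lborel f, OF nn(1)] Bochner_Integration.integral_nonneg[of lborel g, OF nn(2)]
    by auto
  then have "((\<integral>x. f x \<partial>lborel) / a) powr t * ((\<integral>x. g x \<partial>lborel) / b) powr (1 - t)
     \<le> t * ((\<integral>x. f x \<partial>lborel) / a) + (1 - t) * ((\<integral>x. g x \<partial>lborel) / b)"
    using t pos by (intro Youngs_inequality_0) auto
  also note n
  finally have "(\<integral>x. f x \<partial>lborel) powr t * (\<integral>x. g x \<partial>lborel) powr (1 - t) / e \<le> (\<integral>x. h x \<partial>lborel) / e"
    using nn pos by (simp add: powr_divide e_def)
  then show ?thesis using e by (simp add: divide_le_cancel)
qed

section \<open>Product spaces and marginals\<close>

interpretation lborel_PiM: product_sigma_finite "\<lambda>_::nat. lborel :: real measure"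
  by standard

lemma integrable_PiM_bounded:
  fixes F :: "(nat \<Rightarrow> real) \<Rightarrow> real"
  assumes I: "finite I" and [measurable]: "F \<in> borel_measurable (PiM I (\<lambda>_. lborel))"
    and bd: "\<And>x. x \<in> PiE I (\<lambda>_. UNIV) \<Longrightarrow> \<bar>F x\<bar> \<le> B"
    and supp: "\<And>x i. x \<in> PiE I (\<lambda>_. UNIV) \<Longrightarrow> i \<in> I \<Longrightarrow> R < \<bar>x i\<bar> \<Longrightarrow> F x = 0"
  shows "integrable (PiM I (\<lambda>_. lborel)) F"
proof (rule Bochner_Integration.integrable_bound)
  have "emeasure (PiM I (\<lambda>_. lborel)) (PiE I (\<lambda>_. {-R..R})) = (\<Prod>i\<in>I. emeasure lborel {-R..R})"
    using I by (intro lborel_PiM.emeasure_PiM) auto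
  also have "\<dots> < \<infinity>" by (auto simp: power_less_top_ennreal emeasure_lborel_Icc_eq)
  finally show "integrable (PiM I (\<lambda>_. lborel)) (\<lambda>x. B * indicator (PiE I (\<lambda>_. {-R..R})) x :: real)"
    using I by (intro integrable_mult_right integrable_real_indicator sets_PiM_I_finite) auto
  show "AE x in PiM I (\<lambda>_. lborel). norm (F x) \<le> norm (B * indicat_real (PiE I (\<lambda>_. {-R..R})) x)"
  proof (intro AE_I2)
    fix x assume "x \<in> space (PiM I (\<lambda>_. lborel :: real measure))"
    then have x: "x \<in> PiE I (\<lambda>_. UNIV)" by (simp add: space_PiM)
    show "norm (F x) \<le> norm (B * indicat_real (PiE I (\<lambda>_. {-R..R})) x)"
    proof (cases "x \<in> PiE I (\<lambda>_. {-R..R})")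
      case True
      then show ?thesis using bd[OF x] by simp
    next
      case False
      then obtain i where "i \<in> I" "R < \<bar>x i\<bar>" using x by (force simp: PiE_iff abs_le_iff not_le)
      then show ?thesis using supp[OF x] by simp
    qed
  qed
qed simp

text \<open>The combination \<open>comb\<close> on an arbitrary index set, so that coordinates can
  be removed one at a time.\<close>

definition lin_comb :: "nat set \<Rightarrow> real \<Rightarrow> (nat \<Rightarrow> real) \<Rightarrow> (nat \<Rightarrow> real) \<Rightarrow> nat \<Rightarrow> real" where
  "lin_comb I t x y = restrict (\<lambda>j. t * x j + (1 - t) * y j) I"

lemma lin_comb_upd:
  assumes "i \<notin> I"
  shows "(lin_comb I t x y)(i := t * a + (1 - t) * b) = lin_comb (insert i I) t (x(i := a)) (y(i := b))"
  using assms by (auto simp: lin_comb_def fun_eq_iff)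

text \<open>The box keeps all integrals in the induction over the coordinates finite.\<close>

definition box_function :: "nat set \<Rightarrow> real \<Rightarrow> real \<Rightarrow> ((nat \<Rightarrow> real) \<Rightarrow> real) \<Rightarrow> bool" where
  "box_function I R B F \<longleftrightarrow> F \<in> borel_measurable (PiM I (\<lambda>_. lborel)) \<and> (\<forall>x. 0 \<le> F x) \<and>
     (\<forall>x\<in>PiE I (\<lambda>_. UNIV). F x \<le> B \<and> (\<forall>i\<in>I. R < \<bar>x i\<bar> \<longrightarrow> F x = 0))"

lemma box_function_integrable:
  assumes "finite I" "box_function I R B F"
  shows "integrable (PiM I (\<lambda>_. lborel)) F"
  using assms unfolding box_function_def by (intro integrable_PiM_bounded[where B = B and R = R]) auto

lemma measurable_upd_pair:
  "(\<lambda>(x, y). x(i := y)) \<in> measurable (PiM I (\<lambda>_. lborel :: real measure) \<Otimes>\<^sub>M lborel) (PiM (insert i I) (\<lambda>_. lborel))"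
  by (rule measurable_add_dim)

lemma box_function_section:
  assumes i: "i \<notin> I" and F: "box_function (insert i I) R B F" and x: "x \<in> PiE I (\<lambda>_. UNIV)"
  shows "(\<lambda>y. F (x(i := y))) \<in> borel_measurable borel" "F (x(i := y)) \<le> B" "R < \<bar>y\<bar> \<Longrightarrow> F (x(i := y)) = 0"
    "integrable lborel (\<lambda>y. F (x(i := y)))"
proof -
  have Fm: "F \<in> borel_measurable (PiM (insert i I) (\<lambda>_. lborel))" using F by (simp add: box_function_def)
  have "x \<in> space (PiM I (\<lambda>_. lborel :: real measure))" using x by (simp add: space_PiM)
  then have "(\<lambda>y. (x, y)) \<in> measurable lborel (PiM I (\<lambda>_. lborel :: real measure) \<Otimes>\<^sub>M lborel)" by measurable
  from measurable_compose[OF measurable_compose[OF this measurable_upd_pair] Fm]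
  show m: "(\<lambda>y. F (x(i := y))) \<in> borel_measurable borel" by simp
  have u: "x(i := y) \<in> PiE (insert i I) (\<lambda>_. UNIV)" for y using x by (auto simp: PiE_iff extensional_def)
  show b: "F (x(i := y)) \<le> B" for y using F u[of y] by (auto simp: box_function_def)
  show s: "F (x(i := y)) = 0" if "R < \<bar>y\<bar>" for y
    using F u[of y] that by (auto simp: box_function_def)
  have nn: "0 \<le> F z" for z using F by (simp add: box_function_def)
  show "integrable lborel (\<lambda>y. F (x(i := y)))"
    by (rule integrable_bounded_support[where R = R and B = B]) (use m b s nn in auto)
qed

text \<open>The bound grows by the factor 2 R with each integrated coordinate, which is why it must
  vary in the induction over the index set.\<close>

lemma box_function_marginal:
  assumes i: "i \<notin> I" and F: "box_function (insert i I) R B F" and R: "0 \<le> R"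
  shows "box_function I R (B * (2 * R)) (\<lambda>x. \<integral>y. F (x(i := y)) \<partial>lborel)"
  unfolding box_function_def
proof (intro conjI ballI allI impI)
  have Fm: "F \<in> borel_measurable (PiM (insert i I) (\<lambda>_. lborel))" and nn: "\<And>x. 0 \<le> F x"
    using F by (auto simp: box_function_def)
  have "(\<lambda>(x, y). F (x(i := y))) \<in> borel_measurable (PiM I (\<lambda>_. lborel) \<Otimes>\<^sub>M lborel)"
    using measurable_compose[OF measurable_upd_pair Fm] by (simp add: case_prod_beta')
  then show "(\<lambda>x. \<integral>y. F (x(i := y)) \<partial>lborel) \<in> borel_measurable (PiM I (\<lambda>_. lborel))"
    by (rule lborel.borel_measurable_lebesgue_integral)
  show "0 \<le> (\<integral>y. F (x(i := y)) \<partial>lborel)" for x using nn by (intro Bochner_Integration.integral_nonneg)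
  fix x assume x: "x \<in> PiE I (\<lambda>_. UNIV :: real set)"
  note sec = box_function_section[OF i F x]
  have "(\<integral>y. F (x(i := y)) \<partial>lborel) \<le> (\<integral>y. B * indicator {-R..R} y \<partial>lborel)"
  proof (rule integral_mono[OF sec(4)])
    show "integrable lborel (\<lambda>y. B * indicator {-R..R} y)"
      by (intro integrable_mult_right integrable_real_indicator) (auto simp: emeasure_lborel_Icc_eq)
    show "F (x(i := y)) \<le> B * indicator {-R..R} y" for y
      using sec(2,3)[of y] by (auto simp: indicator_def abs_le_iff)
  qed
  then show "(\<integral>y. F (x(i := y)) \<partial>lborel) \<le> B * (2 * R)" using R by simp
  fix j assume j: "j \<in> I" "R < \<bar>x j\<bar>"
  have "F (x(i := y)) = 0" for y
  proof -
    have "x(i := y) \<in> PiE (insert i I) (\<lambda>_. UNIV)" using x by (auto simp: PiE_iff extensional_def)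
    moreover have "(x(i := y)) j = x j" using j i by auto
    ultimately show ?thesis using F j unfolding box_function_def by (metis insertCI)
  qed
  then show "(\<integral>y. F (x(i := y)) \<partial>lborel) = 0" by simp
qed

text \<open>Tensorisation: for fixed x and y the one-dimensional inequality for the sections is
  exactly the hypothesis for the marginals. In the base case the product space has one point and the
  inequality is the hypothesis itself.\<close>

theorem prekopa_leindler:
  assumes "finite I" and t: "0 < t" "t < 1" and R: "0 \<le> R"
    and "box_function I R B F" "box_function I R B G" "box_function I R B H"
    and "\<And>x y. x \<in> PiE I (\<lambda>_. UNIV) \<Longrightarrow> y \<in> PiE I (\<lambda>_. UNIV) \<Longrightarrow> F x powr t * G y powr (1 - t) \<le> H (lin_comb I t x y)"
  shows "(\<integral>x. F x \<partial>PiM I (\<lambda>_. lborel)) powr t * (\<integral>x. G x \<partial>PiM I (\<lambda>_. lborel)) powr (1 - t)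
    \<le> (\<integral>x. H x \<partial>PiM I (\<lambda>_. lborel))"
  using assms(1,5-)
proof (induction I arbitrary: B F G H rule: finite_induct)
  case empty
  show ?case using empty(4)[of "\<lambda>_. undefined" "\<lambda>_. undefined"]
    by (simp add: PiM_empty lebesgue_integral_count_space_finite lin_comb_def restrict_def)
next
  case (insert i I)
  define marg where "marg = (\<lambda>(F :: (nat \<Rightarrow> real) \<Rightarrow> real) x. \<integral>y. F (x(i := y)) \<partial>lborel)"
  have int: "(\<integral>x. w x \<partial>PiM (insert i I) (\<lambda>_. lborel)) = (\<integral>x. marg w x \<partial>PiM I (\<lambda>_. lborel))"
    if "box_function (insert i I) R B w" for w
    unfolding marg_def using insert.hyps box_function_integrable[OF _ that]
    by (intro lborel_PiM.product_integral_insert) auto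
  have bm: "box_function I R (B * (2 * R)) (marg w)" if "box_function (insert i I) R B w" for w
    unfolding marg_def using box_function_marginal[OF insert.hyps(2) that R] .
  have nn: "0 \<le> w x" if "box_function (insert i I) R B w" for w x using that by (simp add: box_function_def)
  show ?case
    unfolding int[OF insert.prems(1)] int[OF insert.prems(2)] int[OF insert.prems(3)]
  proof (rule insert.IH[OF bm bm bm], fact+)
    fix x y :: "nat \<Rightarrow> real"
    assume x: "x \<in> PiE I (\<lambda>_. UNIV)" and y: "y \<in> PiE I (\<lambda>_. UNIV)"
    have z: "lin_comb I t x y \<in> PiE I (\<lambda>_. UNIV)" by (simp add: lin_comb_def)
    note sF = box_function_section[OF insert.hyps(2) insert.prems(1) x]
    note sG = box_function_section[OF insert.hyps(2) insert.prems(2) y]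
    note sH = box_function_section[OF insert.hyps(2) insert.prems(3) z]
    show "marg F x powr t * marg G y powr (1 - t) \<le> marg H (lin_comb I t x y)"
      unfolding marg_def
    proof (rule prekopa_leindler_1[OF t sF(1) sG(1) sH(1), where B = B and R = R])
      fix a b
      have "x(i := a) \<in> PiE (insert i I) (\<lambda>_. UNIV)" "y(i := b) \<in> PiE (insert i I) (\<lambda>_. UNIV)"
        using x y by (auto simp: PiE_iff extensional_def)
      from insert.prems(4)[OF this]
      show "F (x(i := a)) powr t * G (y(i := b)) powr (1 - t) \<le> H ((lin_comb I t x y)(i := t * a + (1 - t) * b))"
        unfolding lin_comb_upd[OF insert.hyps(2)] .
    qed (use nn insert.prems sF sG sH in auto)
  qed
qed

definition log_concave_on :: "nat set \<Rightarrow> ((nat \<Rightarrow> real) \<Rightarrow> real) \<Rightarrow> bool" where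
  "log_concave_on I w \<longleftrightarrow> (\<forall>t x y. 0 < t \<longrightarrow> t < 1 \<longrightarrow> x \<in> PiE I (\<lambda>_. UNIV) \<longrightarrow> y \<in> PiE I (\<lambda>_. UNIV) \<longrightarrow>
     w x powr t * w y powr (1 - t) \<le> w (lin_comb I t x y))"

text \<open>The marginal at z integrates the section x i = z; Prekopa-Leindler for the sections at
  two points and at their combination is its log-concavity. The second conclusion identifies W as
  the law of the i-th coordinate by Fubini. There v is bounded on [-R, R] instead of the whole line,
  because polynomials will be inserted.\<close>

theorem marginal_exists:
  assumes I: "finite I" "i \<notin> I" and R: "0 \<le> R" and w: "box_function (insert i I) R B w" "log_concave_on (insert i I) w"
    and mass: "(\<integral>x. w x \<partial>PiM (insert i I) (\<lambda>_. lborel)) = 1"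
  obtains W where "log_concave_density W R (B * (2 * R) ^ card I)"
    "\<And>v K. v \<in> borel_measurable borel \<Longrightarrow> (\<And>z. \<bar>z\<bar> \<le> R \<Longrightarrow> \<bar>v z\<bar> \<le> K) \<Longrightarrow>
       (\<integral>x. v (x i) * w x \<partial>PiM (insert i I) (\<lambda>_. lborel)) = (\<integral>z. v z * W z \<partial>lborel)"
proof -
  define W where "W = (\<lambda>z. \<integral>x. w (x(i := z)) \<partial>PiM I (\<lambda>_. lborel))"
  interpret pI: sigma_finite_measure "PiM I (\<lambda>_. lborel :: real measure)"
    using I(1) by (rule lborel_PiM.sigma_finite)
  interpret pair: pair_sigma_finite "PiM I (\<lambda>_. lborel :: real measure)" "lborel :: real measure" ..
  have wm[measurable]: "w \<in> borel_measurable (PiM (insert i I) (\<lambda>_. lborel))" and nn: "0 \<le> w x" for x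
    using w by (auto simp: box_function_def)
  have wm2: "(\<lambda>(x, y). w (x(i := y))) \<in> borel_measurable (PiM I (\<lambda>_. lborel) \<Otimes>\<^sub>M lborel)"
    using measurable_compose[OF measurable_upd_pair wm] by (simp add: case_prod_beta')
  have wm3: "(\<lambda>(y, x). w (x(i := y))) \<in> borel_measurable (lborel \<Otimes>\<^sub>M PiM I (\<lambda>_. lborel))"
    using measurable_pair_swap[OF wm2] by (simp add: case_prod_beta')
  have u: "x(i := y) \<in> PiE (insert i I) (\<lambda>_. UNIV)" if "x \<in> PiE I (\<lambda>_. UNIV)" for x and y :: real
    using that by (auto simp: PiE_iff extensional_def)
  have wb: "w (x(i := z)) \<le> B" if "x \<in> PiE I (\<lambda>_. UNIV)" for x z
    using u[OF that, of z] w(1) by (auto simp: box_function_def)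
  have ws: "w (x(i := z)) = 0" if "x \<in> PiE I (\<lambda>_. UNIV)" "R < \<bar>z\<bar> \<or> (\<exists>j\<in>I. R < \<bar>x j\<bar>)" for x z
  proof -
    have "\<exists>j\<in>insert i I. R < \<bar>(x(i := z)) j\<bar>" using that I(2) by (auto intro: bexI[of _ i])
    then show ?thesis using u[OF that(1), of z] w(1) by (auto simp: box_function_def simp del: fun_upd_apply)
  qed
  have bf: "box_function I R B (\<lambda>x. w (x(i := z)))" for z
    unfolding box_function_def
  proof (intro conjI ballI allI impI nn wb)
    have "(\<lambda>x. (x, z)) \<in> measurable (PiM I (\<lambda>_. lborel :: real measure)) (PiM I (\<lambda>_. lborel :: real measure) \<Otimes>\<^sub>M lborel)" by measurable
    from measurable_compose[OF measurable_compose[OF this measurable_upd_pair] wm]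
    show "(\<lambda>x. w (x(i := z))) \<in> borel_measurable (PiM I (\<lambda>_. lborel))" by simp
  qed (use ws in auto)
  have Fub: "(\<integral>x. v (x i) * w x \<partial>PiM (insert i I) (\<lambda>_. lborel)) = (\<integral>z. v z * W z \<partial>lborel)"
    if [measurable]: "v \<in> borel_measurable borel" and v: "\<And>z. \<bar>z\<bar> \<le> R \<Longrightarrow> \<bar>v z\<bar> \<le> K" for v K
  proof -
    have K: "0 \<le> K" using v[of 0] R by force
    have vb: "\<bar>v z * w (x(i := z))\<bar> \<le> K * B" if "x \<in> PiE I (\<lambda>_. UNIV)" for x z
    proof (cases "\<bar>z\<bar> \<le> R")
      case True
      then show ?thesis unfolding abs_mult using v[OF True] nn[of "x(i := z)"] wb[OF that, of z] by (intro mult_mono) auto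
    next
      case False
      then have "w (x(i := z)) = 0" using ws[OF that] by simp
      moreover have "0 \<le> B" using nn[of "x(i := z)"] wb[OF that, of z] by linarith
      ultimately show ?thesis using K by simp
    qed
    have "(\<integral>x. v (x i) * w x \<partial>PiM (insert i I) (\<lambda>_. lborel))
        = (\<integral>x. (\<integral>y. v ((x(i := y)) i) * w (x(i := y)) \<partial>lborel) \<partial>PiM I (\<lambda>_. lborel))"
    proof (rule lborel_PiM.product_integral_insert[OF I])
      show "integrable (PiM (insert i I) (\<lambda>_. lborel)) (\<lambda>x. v (x i) * w x)"
      proof (rule integrable_PiM_bounded[where B = "K * B" and R = R])
        fix x :: "nat \<Rightarrow> real" assume x: "x \<in> PiE (insert i I) (\<lambda>_. UNIV)"
        have "restrict x I \<in> PiE I (\<lambda>_. UNIV)" "(restrict x I)(i := x i) = x"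
          using x I(2) by (auto simp: PiE_iff extensional_def fun_eq_iff)
        then show "\<bar>v (x i) * w x\<bar> \<le> K * B" using vb[of "restrict x I" "x i"] by simp
        fix j assume "j \<in> insert i I" "R < \<bar>x j\<bar>"
        then show "v (x i) * w x = 0" using w(1) x unfolding box_function_def by auto
      qed (use I in auto)
    qed
    also have "\<dots> = (\<integral>x. (\<integral>y. v y * w (x(i := y)) \<partial>lborel) \<partial>PiM I (\<lambda>_. lborel))" by simp
    also have "\<dots> = (\<integral>y. (\<integral>x. v y * w (x(i := y)) \<partial>PiM I (\<lambda>_. lborel)) \<partial>lborel)"
    proof (rule pair.Fubini_integral[symmetric])
      show "integrable (PiM I (\<lambda>_. lborel) \<Otimes>\<^sub>M lborel) (\<lambda>(x, y). v y * w (x(i := y)))"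
      proof (rule Bochner_Integration.integrable_bound)
        have bx: "PiE I (\<lambda>_. {-R..R}) \<in> sets (PiM I (\<lambda>_. lborel :: real measure))"
          using I by (intro sets_PiM_I_finite) auto
        have "emeasure (PiM I (\<lambda>_. lborel)) (PiE I (\<lambda>_. {-R..R})) = (\<Prod>i\<in>I. emeasure lborel {-R..R})"
          using I by (intro lborel_PiM.emeasure_PiM) auto
        also have "\<dots> < \<infinity>" by (auto simp: power_less_top_ennreal emeasure_lborel_Icc_eq)
        finally have fin: "emeasure (PiM I (\<lambda>_. lborel)) (PiE I (\<lambda>_. {-R..R})) < \<infinity>" .
        show "integrable (PiM I (\<lambda>_. lborel) \<Otimes>\<^sub>M lborel) (\<lambda>x. K * B * indicator (PiE I (\<lambda>_. {-R..R}) \<times> {-R..R}) x :: real)"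
          using bx fin by (intro integrable_mult_right integrable_real_indicator pair_measureI)
            (auto simp: lborel.emeasure_pair_measure_Times emeasure_lborel_Icc_eq ennreal_mult_less_top)
        show "AE p in PiM I (\<lambda>_. lborel) \<Otimes>\<^sub>M lborel. norm (case p of (x, y) \<Rightarrow> v y * w (x(i := y)))
            \<le> norm (K * B * indicat_real (PiE I (\<lambda>_. {-R..R}) \<times> {-R..R}) p)"
        proof (intro AE_I2, clarify)
          fix x y assume "(x, y) \<in> space (PiM I (\<lambda>_. lborel :: real measure) \<Otimes>\<^sub>M (lborel :: real measure))"
          then have x: "x \<in> PiE I (\<lambda>_. UNIV)" by (simp add: space_pair_measure space_PiM)
          show "norm (v y * w (x(i := y))) \<le> norm (K * B * indicat_real (PiE I (\<lambda>_. {-R..R}) \<times> {-R..R}) (x, y))"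
          proof (cases "(x, y) \<in> PiE I (\<lambda>_. {-R..R}) \<times> {-R..R}")
            case True
            then show ?thesis using vb[OF x, of y] by simp
          next
            case False
            then have "R < \<bar>y\<bar> \<or> (\<exists>j\<in>I. R < \<bar>x j\<bar>)" using x by (force simp: PiE_iff abs_le_iff not_le)
            then show ?thesis using ws[OF x] by simp
          qed
        qed
        show "(\<lambda>(x, y). v y * w (x(i := y))) \<in> borel_measurable (PiM I (\<lambda>_. lborel) \<Otimes>\<^sub>M lborel)"
        proof -
          have "(\<lambda>p. v (snd p)) \<in> borel_measurable (PiM I (\<lambda>_. lborel :: real measure) \<Otimes>\<^sub>M (lborel :: real measure))"
            by measurable
          from borel_measurable_times[OF this wm2] show ?thesis by (simp add: case_prod_beta')
        qed
      qed
    qed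
    also have "\<dots> = (\<integral>z. v z * W z \<partial>lborel)" by (simp add: W_def)
    finally show ?thesis .
  qed
  have Wb: "W z \<le> B * (2 * R) ^ card I" for z
  proof -
    have "W z \<le> (\<integral>x. B * indicator (PiE I (\<lambda>_. {-R..R})) x \<partial>PiM I (\<lambda>_. lborel))"
      unfolding W_def
    proof (rule integral_mono[OF box_function_integrable[OF I(1) bf]])
      show "integrable (PiM I (\<lambda>_. lborel)) (\<lambda>x. B * indicator (PiE I (\<lambda>_. {-R..R})) x :: real)"
      proof (rule integrable_PiM_bounded[OF I(1), where B = "\<bar>B\<bar>" and R = R])
        show "(\<lambda>x. B * indicator (PiE I (\<lambda>_. {-R..R})) x) \<in> borel_measurable (PiM I (\<lambda>_. lborel))"
          using I by (intro borel_measurable_times borel_measurable_const borel_measurable_indicator sets_PiM_I_finite) auto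
      qed (force simp: indicator_def PiE_iff abs_le_iff)+
      fix x assume "x \<in> space (PiM I (\<lambda>_. lborel :: real measure))"
      then have x: "x \<in> PiE I (\<lambda>_. UNIV)" by (simp add: space_PiM)
      show "w (x(i := z)) \<le> B * indicator (PiE I (\<lambda>_. {-R..R})) x"
      proof (cases "x \<in> PiE I (\<lambda>_. {-R..R})")
        case False
        then have "\<exists>j\<in>I. R < \<bar>x j\<bar>" using x by (force simp: PiE_iff abs_le_iff not_le)
        then show ?thesis using ws[OF x] False by simp
      qed (use wb[OF x] in simp)
    qed
    also have "\<dots> = B * measure (PiM I (\<lambda>_. lborel)) (PiE I (\<lambda>_. {-R..R}))"
      using I by (simp add: sets_PiM_I_finite)
    also have "measure (PiM I (\<lambda>_. lborel)) (PiE I (\<lambda>_. {-R..R})) = (2 * R) ^ card I"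
    proof -
      have "emeasure (PiM I (\<lambda>_. lborel)) (PiE I (\<lambda>_. {-R..R})) = (\<Prod>i\<in>I. ennreal (2 * R))"
        using I R by (subst lborel_PiM.emeasure_PiM) auto
      also have "\<dots> = ennreal ((2 * R) ^ card I)" using R by (simp add: ennreal_power)
      finally show ?thesis using R by (simp add: measure_def)
    qed
    finally show ?thesis .
  qed
  have "log_concave_density W R (B * (2 * R) ^ card I)"
  proof
    show "0 \<le> W x" for x unfolding W_def using nn by (intro Bochner_Integration.integral_nonneg)
    show "W x powr t * W y powr (1 - t) \<le> W (t * x + (1 - t) * y)" if t: "0 < t" "t < 1" for t x y
      unfolding W_def
    proof (rule prekopa_leindler[OF I(1) t R bf bf bf])
      fix a b :: "nat \<Rightarrow> real"
      assume a: "a \<in> PiE I (\<lambda>_. UNIV)" and b: "b \<in> PiE I (\<lambda>_. UNIV)"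
      show "w (a(i := x)) powr t * w (b(i := y)) powr (1 - t) \<le> w ((lin_comb I t a b)(i := t * x + (1 - t) * y))"
        unfolding lin_comb_upd[OF I(2)] using w(2) t u[OF a] u[OF b] unfolding log_concave_on_def by blast
    qed
    have "(\<lambda>z. \<integral>x. w (x(i := z)) \<partial>PiM I (\<lambda>_. lborel)) \<in> borel_measurable lborel"
      by (rule pI.borel_measurable_lebesgue_integral[OF wm3])
    then show "W \<in> borel_measurable borel" by (simp add: W_def)
    show "W x = 0" if "R < \<bar>x\<bar>" for x
    proof -
      have "W x = (\<integral>x. 0 \<partial>PiM I (\<lambda>_. lborel :: real measure))"
        unfolding W_def using that by (intro Bochner_Integration.integral_cong refl ws) (auto simp: space_PiM)
      then show ?thesis by simp
    qed
    show "W x \<le> B * (2 * R) ^ card I" for x by (rule Wb)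
    show "(\<integral>x. W x \<partial>lborel) = 1" using Fub[of "\<lambda>_. 1" 1] mass by simp
  qed
  then show ?thesis using Fub by (rule that)
qed

section \<open>Bisection into thin cells\<close>

text \<open>Once all other coordinates are fixed, the equation determines x i, and single points are
  null.\<close>

lemma AE_hyperplane_aux:
  fixes a b p q :: real and i j :: nat
  assumes I: "finite I" "i \<in> I" "j \<in> I" "i \<noteq> j" and a: "a \<noteq> 0"
  shows "AE x in PiM I (\<lambda>_. lborel). a * (x i - p) + b * (x j - q) \<noteq> 0"
proof -
  define N where "N = {x \<in> space (PiM I (\<lambda>_. lborel :: real measure)). a * (x i - p) + b * (x j - q) = 0}"
  define I' where "I' = I - {i}"
  have ins: "I = insert i I'" "i \<notin> I'" "finite I'" using I by (auto simp: I'_def)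
  have [measurable]: "(\<lambda>x. x i) \<in> borel_measurable (PiM I (\<lambda>_. lborel :: real measure))"
    "(\<lambda>x. x j) \<in> borel_measurable (PiM I (\<lambda>_. lborel :: real measure))"
    using I by (auto intro: measurable_component_singleton[where M = "\<lambda>_. lborel :: real measure", simplified])
  have Nm: "N \<in> sets (PiM I (\<lambda>_. lborel))" unfolding N_def by measurable
  have "emeasure (PiM I (\<lambda>_. lborel)) N = (\<integral>\<^sup>+ x. indicator N x \<partial>PiM I (\<lambda>_. lborel))" using Nm by simp
  also have "\<dots> = (\<integral>\<^sup>+ x. (\<integral>\<^sup>+ y. indicator N (x(i := y)) \<partial>lborel) \<partial>PiM I' (\<lambda>_. lborel))"
    using lborel_PiM.product_nn_integral_insert[OF ins(3,2), of "indicator N"] Nm ins(1) by simp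
  also have "\<dots> = (\<integral>\<^sup>+ x. 0 \<partial>PiM I' (\<lambda>_. lborel :: real measure))"
  proof (intro nn_integral_cong)
    fix x :: "nat \<Rightarrow> real"
    define c where "c = p - b * (x j - q) / a"
    have "indicator N (x(i := y)) \<le> (indicator {c} y :: ennreal)" for y
    proof (cases "x(i := y) \<in> N")
      case True
      then have "a * (y - p) + b * (x j - q) = 0" using I by (simp add: N_def)
      then have "y = c" using a by (simp add: c_def field_simps)
      then show ?thesis by (simp add: indicator_def)
    qed simp
    then have "(\<integral>\<^sup>+ y. indicator N (x(i := y)) \<partial>lborel) \<le> (\<integral>\<^sup>+ y. indicator {c} y \<partial>lborel)"
      by (intro nn_integral_mono)
    then show "(\<integral>\<^sup>+ y. indicator N (x(i := y)) \<partial>lborel) = 0" by simp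
  qed
  finally have "N \<in> null_sets (PiM I (\<lambda>_. lborel))" using Nm by (auto simp: null_sets_def)
  then show ?thesis by (rule AE_I'[of N]) (auto simp: N_def)
qed

lemma AE_hyperplane:
  fixes a b p q :: real and i j :: nat
  assumes I: "finite I" "i \<in> I" "j \<in> I" "i \<noteq> j" and ab: "a \<noteq> 0 \<or> b \<noteq> 0"
  shows "AE x in PiM I (\<lambda>_. lborel). a * (x i - p) + b * (x j - q) \<noteq> 0"
proof (cases "a = 0")
  case True
  then show ?thesis using AE_hyperplane_aux[of I j i b q a p] I ab by (simp add: add.commute)
qed (use AE_hyperplane_aux[OF I] in simp)

text \<open>Bounded on the box instead of everywhere, since functions of polynomials are the
  intended instances; the densities vanish outside the box.\<close>

definition bounded_fun :: "nat set \<Rightarrow> real \<Rightarrow> ((nat \<Rightarrow> real) \<Rightarrow> real) \<Rightarrow> bool" where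
  "bounded_fun I R h \<longleftrightarrow> h \<in> borel_measurable (PiM I (\<lambda>_. lborel)) \<and>
     (\<exists>K. \<forall>x\<in>PiE I (\<lambda>_. UNIV). (\<forall>i\<in>I. \<bar>x i\<bar> \<le> R) \<longrightarrow> \<bar>h x\<bar> \<le> K)"

lemma bounded_fun_bound:
  assumes "bounded_fun I R h" "box_function I R B w"
  obtains K where "\<And>x. x \<in> PiE I (\<lambda>_. UNIV) \<Longrightarrow> \<bar>h x * w x\<bar> \<le> K"
proof -
  obtain K where K: "\<And>x. x \<in> PiE I (\<lambda>_. UNIV) \<Longrightarrow> (\<forall>i\<in>I. \<bar>x i\<bar> \<le> R) \<Longrightarrow> \<bar>h x\<bar> \<le> K"
    using assms(1) unfolding bounded_fun_def by blast
  have "\<bar>h x * w x\<bar> \<le> \<bar>K * B\<bar>" if x: "x \<in> PiE I (\<lambda>_. UNIV)" for x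
  proof (cases "\<forall>i\<in>I. \<bar>x i\<bar> \<le> R")
    case True
    have "\<bar>h x\<bar> * \<bar>w x\<bar> \<le> \<bar>K\<bar> * \<bar>B\<bar>"
      using K[OF x True] x assms(2) unfolding box_function_def by (intro mult_mono) force+
    then show ?thesis by (simp add: abs_mult)
  next
    case False
    then have "w x = 0" using x assms(2) unfolding box_function_def by (meson not_le)
    then show ?thesis by simp
  qed
  then show ?thesis by (rule that)
qed

lemma bounded_fun_integrable:
  assumes "finite I" "bounded_fun I R h" "box_function I R B w"
  shows "integrable (PiM I (\<lambda>_. lborel)) (\<lambda>x. h x * w x)"
proof -
  obtain K where K: "\<And>x. x \<in> PiE I (\<lambda>_. UNIV) \<Longrightarrow> \<bar>h x * w x\<bar> \<le> K" using bounded_fun_bound[OF assms(2,3)] by blast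
  show ?thesis
    by (rule integrable_PiM_bounded[OF assms(1) _ K, where R = R])
      (use assms in \<open>auto simp: bounded_fun_def box_function_def\<close>)
qed

text \<open>Rotate a half-space about the set x i = p, x j = q of codimension two. The integral over
  it depends continuously on the angle and, the total being zero, changes sign after a half turn, so
  it vanishes at some angle.\<close>

lemma bisection:
  fixes p q :: real
  assumes I: "finite I" "i \<in> I" "j \<in> I" "i \<noteq> j" and h: "bounded_fun I R h" and w: "box_function I R B w"
    and z: "(\<integral>x. h x * w x \<partial>PiM I (\<lambda>_. lborel)) = 0"
  obtains a b where "a \<noteq> 0 \<or> b \<noteq> 0"
    "(\<integral>x. h x * (w x * indicator {x. 0 \<le> a * (x i - p) + b * (x j - q)} x) \<partial>PiM I (\<lambda>_. lborel)) = 0"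
proof -
  define \<mu> where "\<mu> = PiM I (\<lambda>_. lborel :: real measure)"
  have [measurable]: "(\<lambda>x. x i) \<in> borel_measurable \<mu>" "(\<lambda>x. x j) \<in> borel_measurable \<mu>"
    using I unfolding \<mu>_def by (auto intro: measurable_component_singleton[where M = "\<lambda>_. lborel :: real measure", simplified])
  define H where "H = (\<lambda>\<theta> x. cos \<theta> * (x i - p) + sin \<theta> * (x j - q) :: real)"
  have Hm[measurable]: "H \<theta> \<in> borel_measurable \<mu>" for \<theta> unfolding H_def by measurable
  have int: "integrable \<mu> (\<lambda>x. h x * w x)" unfolding \<mu>_def by (rule bounded_fun_integrable[OF I(1) h w])
  have hw[measurable]: "(\<lambda>x. h x * w x) \<in> borel_measurable \<mu>" using int by simp
  define F where "F = (\<lambda>\<theta> x. h x * w x * indicat_real {x. 0 \<le> H \<theta> x} x)"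
  have Fm[measurable]: "F \<theta> \<in> borel_measurable \<mu>" for \<theta>
  proof -
    have "F \<theta> = (\<lambda>x. if 0 \<le> H \<theta> x then h x * w x else 0)" by (auto simp: F_def)
    also have "\<dots> \<in> borel_measurable \<mu>" by measurable
    finally show ?thesis .
  qed
  have Fint: "integrable \<mu> (F \<theta>)" for \<theta>
    by (rule Bochner_Integration.integrable_bound[OF int]) (auto simp: F_def indicator_def)
  have nz: "AE x in \<mu>. H \<theta> x \<noteq> 0" for \<theta>
  proof -
    have "cos \<theta> \<noteq> 0 \<or> sin \<theta> \<noteq> 0" using sin_cos_squared_add[of \<theta>] by (metis add.left_neutral power_zero_numeral zero_neq_one)
    then show ?thesis unfolding H_def \<mu>_def using AE_hyperplane[OF I] by blast
  qed
  define \<Phi> where "\<Phi> = (\<lambda>\<theta>. \<integral>x. F \<theta> x \<partial>\<mu>)"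
  \<comment> \<open>Dominated convergence: off the bounding hyperplane the indicator is locally
    constant in the angle, and the hyperplane is null.\<close>
  have cont: "continuous_on {0..pi} \<Phi>"
  proof (rule continuous_at_imp_continuous_on, intro ballI)
    fix \<theta> :: real
    show "isCont \<Phi> \<theta>"
      unfolding continuous_at_sequentially \<Phi>_def
    proof (intro allI impI)
      fix s :: "nat \<Rightarrow> real" assume s: "s \<longlonglongrightarrow> \<theta>"
      have "(\<lambda>n. \<integral>x. F (s n) x \<partial>\<mu>) \<longlonglongrightarrow> (\<integral>x. F \<theta> x \<partial>\<mu>)"
      proof (rule integral_dominated_convergence[where w = "\<lambda>x. \<bar>h x * w x\<bar>"])
        show "AE x in \<mu>. (\<lambda>n. F (s n) x) \<longlonglongrightarrow> F \<theta> x"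
          using nz[of \<theta>]
        proof eventually_elim
          case (elim x)
          have lim: "(\<lambda>n. H (s n) x) \<longlonglongrightarrow> H \<theta> x" unfolding H_def by (intro tendsto_intros s)
          have "\<forall>\<^sub>F n in sequentially. F (s n) x = F \<theta> x"
          proof (cases "H \<theta> x > 0")
            case True
            then have "\<forall>\<^sub>F n in sequentially. H (s n) x > 0" using lim by (rule order_tendstoD(1)[rotated])
            then show ?thesis by (rule eventually_mono) (use True in \<open>auto simp: F_def indicator_def\<close>)
          next
            case False
            then have "H \<theta> x < 0" using elim by simp
            then have "\<forall>\<^sub>F n in sequentially. H (s n) x < 0" using lim by (rule order_tendstoD(2)[rotated])
            then show ?thesis by (rule eventually_mono) (use \<open>H \<theta> x < 0\<close> in \<open>auto simp: F_def indicator_def\<close>)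
          qed
          then show ?case by (rule tendsto_eventually)
        qed
      qed (use int in \<open>auto simp: F_def indicator_def\<close>)
      then show "((\<lambda>\<theta>. \<integral>x. F \<theta> x \<partial>\<mu>) \<circ> s) \<longlonglongrightarrow> (\<integral>x. F \<theta> x \<partial>\<mu>)" by (simp add: o_def)
    qed
  qed
  have "\<Phi> 0 + \<Phi> pi = (\<integral>x. F 0 x + F pi x \<partial>\<mu>)" unfolding \<Phi>_def by (rule Bochner_Integration.integral_add[symmetric]) (rule Fint)+
  also have "\<dots> = (\<integral>x. h x * w x \<partial>\<mu>)"
  proof (rule integral_cong_AE)
    show "AE x in \<mu>. F 0 x + F pi x = h x * w x"
      using nz[of 0] by eventually_elim (auto simp: F_def H_def indicator_def)
  qed auto
  \<comment> \<open>The half-spaces for the angles 0 and pi are complementary up to a null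
    set.\<close>
  finally have anti: "\<Phi> pi = - \<Phi> 0" using z by (simp add: \<mu>_def)
  have "\<exists>\<theta>. \<Phi> \<theta> = 0"
  proof (cases "\<Phi> 0 \<le> 0")
    case True
    then show ?thesis using IVT'[of \<Phi> 0 0 pi] anti cont by auto
  next
    case False
    then show ?thesis using IVT2'[of \<Phi> pi 0 0] anti cont by auto
  qed
  then obtain \<theta> where \<theta>: "\<Phi> \<theta> = 0" by blast
  show ?thesis
  proof (rule that[of "cos \<theta>" "sin \<theta>"])
    show "cos \<theta> \<noteq> 0 \<or> sin \<theta> \<noteq> 0" using sin_cos_squared_add[of \<theta>] by (metis add.left_neutral power_zero_numeral zero_neq_one)
    show "(\<integral>x. h x * (w x * indicator {x. 0 \<le> cos \<theta> * (x i - p) + sin \<theta> * (x j - q)} x) \<partial>PiM I (\<lambda>_. lborel)) = 0"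
      using \<theta> by (simp add: \<Phi>_def F_def H_def \<mu>_def mult.assoc)
  qed
qed

section \<open>Repeated cutting\<close>

text \<open>The trace left by a cut through (p, q) in the plane of the coordinates i and j. It
  passes to every density that vanishes where w does, so the traces of successive cuts
  accumulate.\<close>

definition separated :: "nat set \<Rightarrow> ((nat \<Rightarrow> real) \<Rightarrow> real) \<Rightarrow> nat \<times> nat \<times> real \<times> real \<Rightarrow> bool" where
  "separated I w = (\<lambda>(i, j, p, q). \<exists>a b. (a \<noteq> 0 \<or> b \<noteq> 0) \<and>
     (\<forall>x\<in>PiE I (\<lambda>_. UNIV). w x \<noteq> 0 \<longrightarrow> 0 \<le> a * (x i - p) + b * (x j - q)))"

lemma cut_box_function:
  fixes a b p q :: real
  assumes I: "i \<in> I" "j \<in> I" and w: "box_function I R B w"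
  shows "box_function I R B (\<lambda>x. w x * indicator {x. 0 \<le> a * (x i - p) + b * (x j - q)} x)"
proof -
  have [measurable]: "(\<lambda>x. x i) \<in> borel_measurable (PiM I (\<lambda>_. lborel :: real measure))"
    "(\<lambda>x. x j) \<in> borel_measurable (PiM I (\<lambda>_. lborel :: real measure))"
    "w \<in> borel_measurable (PiM I (\<lambda>_. lborel))"
    using I w by (auto intro: measurable_component_singleton[where M = "\<lambda>_. lborel :: real measure", simplified] simp: box_function_def)
  have "(\<lambda>x. w x * indicator {x. 0 \<le> a * (x i - p) + b * (x j - q)} x) = (\<lambda>x. if 0 \<le> a * (x i - p) + b * (x j - q) then w x else 0)"
    by auto
  also have "\<dots> \<in> borel_measurable (PiM I (\<lambda>_. lborel))" by measurable
  finally show ?thesis using w unfolding box_function_def by (auto simp: indicator_def intro: order_trans)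
qed

text \<open>Half-spaces are convex: if both points lie in one, so does their combination; otherwise
  the left-hand side is zero.\<close>

lemma cut_log_concave:
  fixes a b p q :: real
  assumes I: "i \<in> I" "j \<in> I" and w: "log_concave_on I w"
  shows "log_concave_on I (\<lambda>x. w x * indicator {x. 0 \<le> a * (x i - p) + b * (x j - q)} x)"
  unfolding log_concave_on_def
proof (intro allI impI)
  fix t :: real and x y :: "nat \<Rightarrow> real"
  assume t: "0 < t" "t < 1" and xy: "x \<in> PiE I (\<lambda>_. UNIV)" "y \<in> PiE I (\<lambda>_. UNIV)"
  define H where "H = (\<lambda>x. a * (x i - p) + b * (x j - q))"
  have lc: "w x powr t * w y powr (1 - t) \<le> w (lin_comb I t x y)" using w t xy unfolding log_concave_on_def by blast
  have nn: "0 \<le> w x powr t * w y powr (1 - t)" by simp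
  have ind: "indicator {x. 0 \<le> a * (x i - p) + b * (x j - q)} = indicat_real {x. 0 \<le> H x}" by (simp add: H_def)
  have "0 \<le> H (lin_comb I t x y)" if "0 \<le> H x" "0 \<le> H y"
  proof -
    have "H (lin_comb I t x y) = t * H x + (1 - t) * H y" using I by (simp add: H_def lin_comb_def algebra_simps)
    then show ?thesis using that t by simp
  qed
  then show "(w x * indicator {x. 0 \<le> a * (x i - p) + b * (x j - q)} x) powr t
      * (w y * indicator {x. 0 \<le> a * (x i - p) + b * (x j - q)} y) powr (1 - t)
      \<le> w (lin_comb I t x y) * indicator {x. 0 \<le> a * (x i - p) + b * (x j - q)} (lin_comb I t x y)"
    unfolding ind using lc order_trans[OF nn lc] by (auto simp: indicator_def)
qed

text \<open>Each bisection keeps the constraint on both halves, while the integral of u is additive;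
  hence its sign on the final cells passes back to w. The inclusion of supports in the last
  hypothesis carries the separations of earlier cuts to the final cells.\<close>

lemma localization_list:
  assumes I: "finite I" and h: "bounded_fun I R h" and u: "bounded_fun I R u"
    and L: "\<And>i j p q. (i, j, p, q) \<in> set L \<Longrightarrow> i \<in> I \<and> j \<in> I \<and> i \<noteq> j"
    and "box_function I R B w" "log_concave_on I w" "(\<integral>x. h x * w x \<partial>PiM I (\<lambda>_. lborel)) = 0"
    and "\<And>w'. box_function I R B w' \<Longrightarrow> log_concave_on I w' \<Longrightarrow> (\<integral>x. h x * w' x \<partial>PiM I (\<lambda>_. lborel)) = 0 \<Longrightarrow>
       (\<And>x. w x = 0 \<Longrightarrow> w' x = 0) \<Longrightarrow> (\<And>c. c \<in> set L \<Longrightarrow> separated I w' c) \<Longrightarrow> (\<integral>x. u x * w' x \<partial>PiM I (\<lambda>_. lborel)) \<le> 0"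
  shows "(\<integral>x. u x * w x \<partial>PiM I (\<lambda>_. lborel)) \<le> 0"
  using L assms(5-)
proof (induction L arbitrary: w)
  case Nil
  show ?case by (rule Nil.prems(5)) (use Nil.prems in auto)
next
  case (Cons c L)
  obtain i j p q where c: "c = (i, j, p, q)" by (cases c)
  have ij: "i \<in> I" "j \<in> I" "i \<noteq> j" using Cons.prems(1)[of i j p q] c by auto
  obtain a b where ab: "a \<noteq> 0 \<or> b \<noteq> 0" and
    half: "(\<integral>x. h x * (w x * indicator {x. 0 \<le> a * (x i - p) + b * (x j - q)} x) \<partial>PiM I (\<lambda>_. lborel)) = 0"
    using bisection[OF I ij h Cons.prems(2,4)] by blast
  \<comment> \<open>The signs s = 1 and s = -1 give the two closed halves, which overlap in a null
    hyperplane.\<close>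
  define C where "C = (\<lambda>s x. w x * indicat_real {x. 0 \<le> (s * a) * (x i - p) + (s * b) * (x j - q)} x)"
  have Cb: "box_function I R B (C s)" "log_concave_on I (C s)" for s
    unfolding C_def using ij Cons.prems by (auto intro: cut_box_function cut_log_concave)
  have split: "(\<integral>x. g x * w x \<partial>PiM I (\<lambda>_. lborel)) = (\<integral>x. g x * C 1 x \<partial>PiM I (\<lambda>_. lborel)) + (\<integral>x. g x * C (-1) x \<partial>PiM I (\<lambda>_. lborel))"
    if g: "bounded_fun I R g" for g
  proof -
    note int = bounded_fun_integrable[OF I g Cb(1)]
    have "(\<integral>x. g x * C 1 x \<partial>PiM I (\<lambda>_. lborel)) + (\<integral>x. g x * C (-1) x \<partial>PiM I (\<lambda>_. lborel))
       = (\<integral>x. g x * C 1 x + g x * C (-1) x \<partial>PiM I (\<lambda>_. lborel))"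
      by (rule Bochner_Integration.integral_add[symmetric]) (rule int)+
    also have "\<dots> = (\<integral>x. g x * w x \<partial>PiM I (\<lambda>_. lborel))"
    proof (rule integral_cong_AE)
      show "AE x in PiM I (\<lambda>_. lborel). g x * C 1 x + g x * C (-1) x = g x * w x"
        using AE_hyperplane[OF I ij ab, of p q]
        by eventually_elim (auto simp: C_def indicator_def)
      show "(\<lambda>x. g x * w x) \<in> borel_measurable (PiM I (\<lambda>_. lborel))"
        using bounded_fun_integrable[OF I g Cons.prems(2)] by simp
    qed (use int[of 1] int[of "-1"] in simp)
    finally show ?thesis by simp
  qed
  have h1: "(\<integral>x. h x * C 1 x \<partial>PiM I (\<lambda>_. lborel)) = 0" using half by (simp add: C_def)
  have h2: "(\<integral>x. h x * C (-1) x \<partial>PiM I (\<lambda>_. lborel)) = 0" using split[OF h] h1 Cons.prems(4) by simp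
  have sub: "(\<integral>x. u x * C s x \<partial>PiM I (\<lambda>_. lborel)) \<le> 0"
    if s: "(\<integral>x. h x * C s x \<partial>PiM I (\<lambda>_. lborel)) = 0" "s \<noteq> 0" for s
  proof (rule Cons.IH)
    show "i \<in> I \<and> j \<in> I \<and> i \<noteq> j" if "(i, j, p, q) \<in> set L" for i j p q
      using Cons.prems(1)[of i j p q] that by simp
    fix w' assume w': "box_function I R B w'" "log_concave_on I w'" "(\<integral>x. h x * w' x \<partial>PiM I (\<lambda>_. lborel)) = 0"
      "\<And>x. C s x = 0 \<Longrightarrow> w' x = 0" "\<And>c. c \<in> set L \<Longrightarrow> separated I w' c"
    show "(\<integral>x. u x * w' x \<partial>PiM I (\<lambda>_. lborel)) \<le> 0"
    proof (rule Cons.prems(5)[OF w'(1-3)])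
      show "w' x = 0" if "w x = 0" for x using w'(4)[of x] that by (simp add: C_def)
      fix c' assume "c' \<in> set (c # L)"
      then consider "c' = c" | "c' \<in> set L" by auto
      then show "separated I w' c'"
      proof cases
        case 1
        have "0 \<le> (s * a) * (x i - p) + (s * b) * (x j - q)" if "w' x \<noteq> 0" for x
        proof -
          have "C s x \<noteq> 0" using w'(4) that by blast
          then show ?thesis by (auto simp: C_def indicator_def split: if_splits)
        qed
        moreover have "s * a \<noteq> 0 \<or> s * b \<noteq> 0" using ab s by simp
        ultimately show ?thesis unfolding 1 c separated_def by blast
      qed (rule w'(5))
    qed
  qed (use Cb s in auto)
  show ?case using split[OF u] sub[OF h1] sub[OF h2] by simp
qed


section \<open>Cells separated at all grid points are thin\<close>

text \<open>Here v is the signed vertical distance of z from the line through p and q. The triangle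
  is fat on the scale \<delta>, so the barycentric coordinates of r differ from 1/3 by at most 1/10
  and r is interior. An affine function that vanishes at r and is nonnegative at the vertices
  vanishes at all three, and the triangle is nondegenerate.\<close>

lemma triangle_grid_point:
  fixes p1 p2 q1 q2 z1 z2 r1 r2 a b \<delta> :: real
  assumes d: "0 < \<delta>" and L: "L = q1 - p1" "100 * \<delta> \<le> L" and s: "s = (q2 - p2) / L" "\<bar>s\<bar> \<le> 2"
    and z: "\<bar>z1 - p1\<bar> \<le> 2 * L" and v: "v = z2 - p2 - s * (z1 - p1)" "100 * \<delta> < \<bar>v\<bar>"
    and r: "\<bar>r1 - (p1 + q1 + z1) / 3\<bar> \<le> \<delta>" "\<bar>r2 - (p2 + q2 + z2) / 3\<bar> \<le> \<delta>"
    and h: "0 \<le> a * (p1 - r1) + b * (p2 - r2)" "0 \<le> a * (q1 - r1) + b * (q2 - r2)" "0 \<le> a * (z1 - r1) + b * (z2 - r2)"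
  shows "a = 0 \<and> b = 0"
proof -
  have L0: "0 < L" using d L by linarith
  have v0: "v \<noteq> 0" using d v by auto
  define e1 e2 where "e1 = r1 - (p1 + q1 + z1) / 3" and "e2 = r2 - (p2 + q2 + z2) / 3"
  have q2: "q2 - p2 = s * L" using s L0 by simp
  \<comment> \<open>Barycentric coordinates of r: \<open>lz\<close> is read off from the vertical
    distance to the line through p and q, \<open>lq\<close> from the first coordinate.\<close>
  define lz where "lz = (r2 - p2 - s * (r1 - p1)) / v"
  define lq where "lq = (r1 - p1 - lz * (z1 - p1)) / L"
  define lp where "lp = 1 - lq - lz"
  have lzv: "lz * v = r2 - p2 - s * (r1 - p1)" using v0 by (simp add: lz_def)
  have lqL: "lq * L = r1 - p1 - lz * (z1 - p1)" using L0 by (simp add: lq_def)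
  have "(lz - 1/3) * v = e2 - s * e1"
  proof -
    have "(lz - 1/3) * v = (r2 - p2 - s * (r1 - p1)) - (z2 - p2 - s * (z1 - p1)) / 3"
    proof -
      have "(lz - 1/3) * v = lz * v - v / 3" by (simp add: left_diff_distrib)
      then show ?thesis by (simp only: lzv) (simp only: v(1)[symmetric])
    qed
    also have "\<dots> = e2 - s * e1 + ((q2 - p2) - s * (q1 - p1)) / 3"
      by (simp add: e1_def e2_def field_simps)
    finally show ?thesis using q2 L(1) by simp
  qed
  moreover have "\<bar>e2 - s * e1\<bar> \<le> 3 * \<delta>"
  proof -
    have "\<bar>s * e1\<bar> \<le> 2 * \<delta>" unfolding abs_mult using s r by (intro mult_mono) (auto simp: e1_def)
    then show ?thesis using r by (simp add: e2_def)
  qed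
  ultimately have "\<bar>lz - 1/3\<bar> * \<bar>v\<bar> \<le> 3 * \<delta>" by (simp add: abs_mult[symmetric])
  moreover have "\<bar>lz - 1/3\<bar> * (100 * \<delta>) \<le> \<bar>lz - 1/3\<bar> * \<bar>v\<bar>" using v by (intro mult_left_mono) auto
  ultimately have "(\<bar>lz - 1/3\<bar> * 100) * \<delta> \<le> 3 * \<delta>" by linarith
  then have bz: "\<bar>lz - 1/3\<bar> \<le> 3/100" using d by simp
  have "(lq - 1/3) * L = e1 - (lz - 1/3) * (z1 - p1)"
  proof -
    have "(lq - 1/3) * L = lq * L - L / 3" by (simp add: left_diff_distrib)
    also have "\<dots> = r1 - p1 - lz * (z1 - p1) - (q1 - p1) / 3" by (simp only: lqL) (simp only: L(1))
    also have "\<dots> = e1 - (lz - 1/3) * (z1 - p1)" by (simp add: e1_def field_simps)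
    finally show ?thesis .
  qed
  moreover have "\<bar>(lz - 1/3) * (z1 - p1)\<bar> \<le> 3/100 * (2 * L)"
    unfolding abs_mult using bz z by (intro mult_mono) auto
  moreover have "\<bar>e1\<bar> \<le> L / 100" using r L by (simp add: e1_def)
  ultimately have "\<bar>lq - 1/3\<bar> * L \<le> 7/100 * L" using L0 abs_mult[of "lq - 1/3" L] by linarith
  then have bq: "\<bar>lq - 1/3\<bar> \<le> 7/100" using L0 by simp
  have pos: "0 < lz" "0 < lq" "0 < lp" using bz bq unfolding lp_def by linarith+
  have r1: "lp * p1 + lq * q1 + lz * z1 = r1"
    using lqL L(1) by (simp add: lp_def algebra_simps)
  have r2: "lp * p2 + lq * q2 + lz * z2 = r2"
  proof -
    have "lp * p2 + lq * q2 + lz * z2 = p2 + lq * (q2 - p2) + lz * (z2 - p2)" by (simp add: lp_def algebra_simps)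
    also have "\<dots> = p2 + s * (lq * L) + lz * (z2 - p2)" by (simp add: q2)
    also have "\<dots> = p2 + s * (r1 - p1 - lz * (z1 - p1)) + lz * (z2 - p2)" by (simp only: lqL)
    also have "\<dots> = p2 + s * (r1 - p1) + lz * v" by (simp add: v(1) algebra_simps)
    finally show ?thesis by (simp add: lzv)
  qed
  define A where "A = (\<lambda>x y. a * (x - r1) + b * (y - r2))"
  have "lp * A p1 p2 + lq * A q1 q2 + lz * A z1 z2
      = a * ((lp * p1 + lq * q1 + lz * z1) - (lp + lq + lz) * r1) + b * ((lp * p2 + lq * q2 + lz * z2) - (lp + lq + lz) * r2)"
    by (simp add: A_def algebra_simps)
  also have "\<dots> = 0" unfolding r1 r2 by (simp add: lp_def)
  finally have sum0: "lp * A p1 p2 + lq * A q1 q2 + lz * A z1 z2 = 0" .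
  have "0 \<le> lp * A p1 p2" "0 \<le> lq * A q1 q2" "0 \<le> lz * A z1 z2" using pos h by (auto simp: A_def)
  with sum0 have "lp * A p1 p2 = 0" "lq * A q1 q2 = 0" "lz * A z1 z2 = 0" by linarith+
  then have A0: "A p1 p2 = 0" "A q1 q2 = 0" "A z1 z2 = 0" using pos by auto
  have "A q1 q2 - A p1 p2 = a * (q1 - p1) + b * (q2 - p2)" by (simp add: A_def algebra_simps)
  then have "a * L + b * (s * L) = 0" using A0(1,2) L(1) q2 by simp
  then have "(a + b * s) * L = 0" by (simp add: algebra_simps)
  then have a: "a = - (b * s)" using L0 by simp
  have "A z1 z2 - A p1 p2 = a * (z1 - p1) + b * (z2 - p2)" by (simp add: A_def algebra_simps)
  then have "a * (z1 - p1) + b * (z2 - p2) = 0" using A0(1,3) by simp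
  then have "b * v = 0" unfolding v(1) a by (simp add: algebra_simps)
  then show ?thesis using v0 a by simp
qed

text \<open>Multiples of \<delta> that cover [-R, R], with a spare step on each side for
  rounding.\<close>

definition grid :: "real \<Rightarrow> real \<Rightarrow> real set" where
  "grid \<delta> R = (\<lambda>m. \<delta> * real_of_int m) ` {- \<lceil>R / \<delta>\<rceil> - 1..\<lceil>R / \<delta>\<rceil> + 1}"

lemma finite_grid: "finite (grid \<delta> R)"
  by (simp add: grid_def)

lemma grid_approx:
  assumes "0 < \<delta>" "\<bar>c\<bar> \<le> R"
  obtains r where "r \<in> grid \<delta> R" "\<bar>r - c\<bar> \<le> \<delta>"
proof (rule that[of "\<delta> * real_of_int \<lfloor>c / \<delta>\<rfloor>"])
  have 1: "c / \<delta> \<le> R / \<delta>" "- (R / \<delta>) \<le> c / \<delta>"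
    using assms by (auto simp: divide_simps abs_le_iff)
  have "\<lfloor>c / \<delta>\<rfloor> \<in> {- \<lceil>R / \<delta>\<rceil> - 1..\<lceil>R / \<delta>\<rceil> + 1}" using 1 by (auto, linarith+)
  then show "\<delta> * real_of_int \<lfloor>c / \<delta>\<rfloor> \<in> grid \<delta> R" by (auto simp: grid_def)
  have "\<bar>real_of_int \<lfloor>c / \<delta>\<rfloor> - c / \<delta>\<bar> \<le> 1" by linarith
  then have "\<delta> * \<bar>real_of_int \<lfloor>c / \<delta>\<rfloor> - c / \<delta>\<bar> \<le> \<delta> * 1" using assms by (intro mult_left_mono) auto
  also have "\<delta> * \<bar>real_of_int \<lfloor>c / \<delta>\<rfloor> - c / \<delta>\<bar> = \<bar>\<delta> * real_of_int \<lfloor>c / \<delta>\<rfloor> - c\<bar>"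
  proof -
    have "\<delta> * (real_of_int \<lfloor>c / \<delta>\<rfloor> - c / \<delta>) = \<delta> * real_of_int \<lfloor>c / \<delta>\<rfloor> - c"
      using assms by (simp add: right_diff_distrib)
    then show ?thesis using abs_mult[of \<delta> "real_of_int \<lfloor>c / \<delta>\<rfloor> - c / \<delta>"] assms by simp
  qed
  finally show "\<bar>\<delta> * real_of_int \<lfloor>c / \<delta>\<rfloor> - c\<bar> \<le> \<delta>" by simp
qed

text \<open>Otherwise the projection of the cell to some coordinate plane contains a fat triangle; a grid point near its
  centroid lies strictly inside, which contradicts separation.\<close>

lemma thin_cell:
  assumes I: "finite I" "I \<noteq> {}" and d: "0 < \<delta>" and w: "box_function I R B w"
    and sep: "\<And>i j p q. i \<in> I \<Longrightarrow> j \<in> I \<Longrightarrow> i \<noteq> j \<Longrightarrow> p \<in> grid \<delta> R \<Longrightarrow> q \<in> grid \<delta> R \<Longrightarrow> separated I w (i, j, p, q)"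
  obtains i a s where "i \<in> I"
    "\<And>x j. x \<in> PiE I (\<lambda>_. UNIV) \<Longrightarrow> w x \<noteq> 0 \<Longrightarrow> j \<in> I \<Longrightarrow> \<bar>x j - (a j + s j * x i)\<bar> \<le> 200 * \<delta>"
proof (cases "\<exists>x\<in>PiE I (\<lambda>_. UNIV). w x \<noteq> 0")
  case False
  then show ?thesis using I that by blast
next
  case True
  define S where "S = {x \<in> PiE I (\<lambda>_. UNIV). w x \<noteq> 0}"
  obtain x0 where x0: "x0 \<in> S" using True by (auto simp: S_def)
  have Sb: "\<bar>x i\<bar> \<le> R" if "x \<in> S" "i \<in> I" for x i
    using w that unfolding box_function_def S_def by (metis (mono_tags, lifting) mem_Collect_eq not_le)
  \<comment> \<open>The supremum of these differences is the largest extent of the cell along a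
    coordinate axis.\<close>
  define T where "T = {x i - y i | i x y. i \<in> I \<and> x \<in> S \<and> y \<in> S}"
  have Tb: "bdd_above T"
  proof (rule bdd_aboveI[of _ "2 * R"])
    fix t assume "t \<in> T"
    then obtain i x y where t: "t = x i - y i" "i \<in> I" "x \<in> S" "y \<in> S" by (auto simp: T_def)
    show "t \<le> 2 * R" using Sb[OF t(3,2)] Sb[OF t(4,2)] t(1) by (simp add: abs_le_iff)
  qed
  obtain i0 where i0: "i0 \<in> I" using I by auto
  have T0: "0 \<in> T" unfolding T_def using i0 x0 by force
  define \<sigma> where "\<sigma> = Sup T"
  have s0: "0 \<le> \<sigma>" unfolding \<sigma>_def using T0 Tb by (rule cSup_upper)
  \<comment> \<open>The supremum need not be attained; half of it is, which costs the factor 2 in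
    the bound \<open>2 * L\<close> below.\<close>
  have "\<exists>t\<in>T. \<sigma> / 2 \<le> t"
  proof (cases "\<sigma> = 0")
    case True then show ?thesis using T0 by auto
  next
    case False
    then have "\<sigma> / 2 < Sup T" using s0 by (simp add: \<sigma>_def)
    then show ?thesis using less_cSup_iff[OF _ Tb, of "\<sigma> / 2"] T0 by (auto intro: less_imp_le)
  qed
  then obtain i p q where i: "i \<in> I" and pq: "p \<in> S" "q \<in> S" and half: "\<sigma> / 2 \<le> q i - p i"
    by (auto simp: T_def)
  define L where "L = q i - p i"
  have ext: "\<bar>x j - y j\<bar> \<le> 2 * L" if "x \<in> S" "y \<in> S" "j \<in> I" for x y j
  proof -
    have "x j - y j \<in> T" "y j - x j \<in> T" using that by (auto simp: T_def)
    then have "x j - y j \<le> \<sigma>" "y j - x j \<le> \<sigma>" unfolding \<sigma>_def using Tb by (auto intro: cSup_upper)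
    then show ?thesis using half by (simp add: L_def abs_le_iff)
  qed
  show ?thesis
  \<comment> \<open>A cell this short in every direction is close to the single point p, so slope 0
    will do. Otherwise the line runs through p and q, parametrised by its i-th coordinate.\<close>
  proof (cases "L < 100 * \<delta>")
    case True
    show ?thesis
    proof (rule that[of i p "\<lambda>_. 0"])
      fix x j assume "x \<in> PiE I (\<lambda>_. UNIV)" "w x \<noteq> 0" "j \<in> I"
      then show "\<bar>x j - (p j + 0 * x i)\<bar> \<le> 200 * \<delta>" using ext[of x p j] pq True by (simp add: S_def)
    qed (rule i)
  next
    case False
    then have L: "100 * \<delta> \<le> L" and L0: "0 < L" using d by auto
    define s where "s = (\<lambda>j. (q j - p j) / L)"
    define a where "a = (\<lambda>j. p j - s j * p i)"
    show ?thesis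
    proof (rule that[of i a s])
      fix z j assume "z \<in> PiE I (\<lambda>_. UNIV)" "w z \<noteq> 0" and j: "j \<in> I"
      then have z: "z \<in> S" by (simp add: S_def)
      have e: "z j - (a j + s j * z i) = z j - p j - s j * (z i - p i)" by (simp add: a_def algebra_simps)
      show "\<bar>z j - (a j + s j * z i)\<bar> \<le> 200 * \<delta>"
      proof (cases "j = i")
        case True
        have "s i = 1" using L0 by (simp add: s_def L_def)
        then have "z j - (a j + s j * z i) = 0" unfolding e using True by simp
        then show ?thesis using d by simp
      next
        case ji: False
        show ?thesis
        proof (rule ccontr)
          assume "\<not> ?thesis"
          then have v: "100 * \<delta> < \<bar>z j - p j - s j * (z i - p i)\<bar>" using d unfolding e by linarith
          have cb: "\<bar>(p m + q m + z m) / 3\<bar> \<le> R" if "m \<in> I" for m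
            using Sb[OF pq(1) that] Sb[OF pq(2) that] Sb[OF z that] by (simp add: abs_le_iff)
          obtain r1 where r1: "r1 \<in> grid \<delta> R" "\<bar>r1 - (p i + q i + z i) / 3\<bar> \<le> \<delta>"
            using grid_approx[OF d cb[OF i]] by blast
          obtain r2 where r2: "r2 \<in> grid \<delta> R" "\<bar>r2 - (p j + q j + z j) / 3\<bar> \<le> \<delta>"
            using grid_approx[OF d cb[OF j]] by blast
          have "separated I w (i, j, r1, r2)" using sep[OF i j ji[symmetric] r1(1) r2(1)] .
          then obtain A C where ac: "A \<noteq> 0 \<or> C \<noteq> 0" and
            h: "\<And>x. x \<in> S \<Longrightarrow> 0 \<le> A * (x i - r1) + C * (x j - r2)"
            unfolding separated_def S_def by auto
          have "\<bar>s j\<bar> \<le> 2" using ext[OF pq(2,1) j] L0 by (simp add: s_def abs_divide pos_divide_le_eq)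
          then have "A = 0 \<and> C = 0"
            using triangle_grid_point[OF d L_def L s_def[THEN fun_cong] _ ext[OF z pq(1) i] refl v r1(2) r2(2) h[OF pq(1)] h[OF pq(2)] h[OF z]]
            by simp
          then show False using ac by simp
        qed
      qed
    qed (rule i)
  qed
qed

section \<open>Localization\<close>

text \<open>The algebraic information that survives the passage to cells: on a needle, F is compared
  with its values on one line.\<close>

definition poly_on_lines :: "nat \<Rightarrow> nat \<Rightarrow> ((nat \<Rightarrow> real) \<Rightarrow> real) \<Rightarrow> bool" where
  "poly_on_lines k d F \<longleftrightarrow> (\<forall>a s. \<exists>P. degree P \<le> d \<and> (\<forall>t. F (restrict (\<lambda>j. a j + s j * t) {..<k}) = poly P t))"

text \<open>The radius is arbitrary because the line that approximates a cell may leave the box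
  containing the cell.\<close>

definition box_lipschitz :: "nat \<Rightarrow> ((nat \<Rightarrow> real) \<Rightarrow> real) \<Rightarrow> bool" where
  "box_lipschitz k F \<longleftrightarrow> (\<forall>R. \<exists>K\<ge>0. (\<forall>x\<in>PiE {..<k} (\<lambda>_. UNIV). \<forall>y\<in>PiE {..<k} (\<lambda>_. UNIV).
     (\<forall>j<k. \<bar>x j\<bar> \<le> R \<and> \<bar>y j\<bar> \<le> R) \<longrightarrow> \<bar>F x - F y\<bar> \<le> K * (\<Sum>j<k. \<bar>x j - y j\<bar>)))"

text \<open>A normalised thin cell: w is its density, i the coordinate along which it extends, P the
  polynomial of x i that is \<eta>-close to F on the support, and W the density of x i. The clause
  over v and K is what says that W is this marginal.\<close>

definition needle :: "nat \<Rightarrow> nat \<Rightarrow> ((nat \<Rightarrow> real) \<Rightarrow> real) \<Rightarrow> real \<Rightarrow> real \<Rightarrow> ((nat \<Rightarrow> real) \<Rightarrow> real) \<Rightarrow> nat \<Rightarrow> real poly \<Rightarrow> (real \<Rightarrow> real) \<Rightarrow> bool" where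
  "needle k d F R \<eta> w i P W \<longleftrightarrow> i < k \<and> degree P \<le> d \<and> (\<exists>B. box_function {..<k} R B w) \<and> (\<exists>B. log_concave_density W R B) \<and>
     (\<integral>x. w x \<partial>lebRn k) = 1 \<and>
     (\<forall>v K. v \<in> borel_measurable borel \<longrightarrow> (\<forall>z. \<bar>z\<bar> \<le> R \<longrightarrow> \<bar>v z\<bar> \<le> K) \<longrightarrow> (\<integral>x. v (x i) * w x \<partial>lebRn k) = (\<integral>z. v z * W z \<partial>lborel)) \<and>
     (\<forall>x\<in>PiE {..<k} (\<lambda>_. UNIV). w x \<noteq> 0 \<longrightarrow> \<bar>F x - poly P (x i)\<bar> \<le> \<eta>)"

lemma lin_comb_range: "lin_comb I t x y \<in> PiE I (\<lambda>_. UNIV)"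
  by (simp add: lin_comb_def)

text \<open>The thinness \<delta> is fixed in advance from the Lipschitz constant of F on a larger
  box. Cutting at every grid point of every coordinate plane leaves thin cells, each of which
  becomes a needle after normalisation; cells of mass zero contribute nothing. Both integrals are
  linear in the density, so the number of cells causes no loss.\<close>

theorem localization:
  assumes k: "0 < k" and R: "0 \<le> R" and w: "box_function {..<k} R B w" "log_concave_on {..<k} w"
    and F: "poly_on_lines k d F" "box_lipschitz k F" and eta: "0 < \<eta>"
    and h: "bounded_fun {..<k} R h" and u: "bounded_fun {..<k} R u"
    and z: "(\<integral>x. h x * w x \<partial>lebRn k) = 0"
    and needles: "\<And>w' i P W. needle k d F R \<eta> w' i P W \<Longrightarrow> (\<integral>x. h x * w' x \<partial>lebRn k) = 0 \<Longrightarrow> (\<integral>x. u x * w' x \<partial>lebRn k) \<le> 0"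
  shows "(\<integral>x. u x * w x \<partial>lebRn k) \<le> 0"
proof -
  obtain K where K: "0 \<le> K" and lip: "\<And>x y. x \<in> PiE {..<k} (\<lambda>_. UNIV) \<Longrightarrow> y \<in> PiE {..<k} (\<lambda>_. UNIV) \<Longrightarrow>
     (\<And>j. j < k \<Longrightarrow> \<bar>x j\<bar> \<le> R + 200 \<and> \<bar>y j\<bar> \<le> R + 200) \<Longrightarrow> \<bar>F x - F y\<bar> \<le> K * (\<Sum>j<k. \<bar>x j - y j\<bar>)"
    using F(2)[unfolded box_lipschitz_def, rule_format, of "R + 200"] by auto
  \<comment> \<open>The coordinatewise distances of a cell point from the line add up to at most 200
    k \<delta>, so F varies by at most \<eta>. The cap 1 keeps the comparison points in the box of
    radius R + 200.\<close>
  define \<delta> where "\<delta> = min 1 (\<eta> / (200 * k * K + 1))"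
  have den: "0 < 200 * k * K + 1" using K by (simp add: add_nonneg_pos)
  have d0: "0 < \<delta>" "\<delta> \<le> 1" using eta den by (auto simp: \<delta>_def)
  have d1: "K * (k * (200 * \<delta>)) \<le> \<eta>"
  proof -
    have "\<delta> \<le> \<eta> / (200 * k * K + 1)" by (simp add: \<delta>_def)
    then have "\<delta> * (200 * k * K + 1) \<le> \<eta>" using den by (simp add: pos_le_divide_eq)
    moreover have "K * (k * (200 * \<delta>)) \<le> \<delta> * (200 * k * K + 1)" using d0 by (simp add: algebra_simps)
    ultimately show ?thesis by linarith
  qed
  define Ls where "Ls = {(i, j, p, q). i < k \<and> j < k \<and> i \<noteq> j \<and> p \<in> grid \<delta> R \<and> q \<in> grid \<delta> R}"
  have "finite Ls"
  proof (rule finite_subset)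
    show "Ls \<subseteq> {..<k} \<times> {..<k} \<times> grid \<delta> R \<times> grid \<delta> R" by (auto simp: Ls_def)
  qed (simp add: finite_grid)
  then obtain L where L: "set L = Ls" using finite_list by blast
  show ?thesis
    unfolding lebRn_def
  proof (rule localization_list[OF _ h u _ w])
    show "i \<in> {..<k} \<and> j \<in> {..<k} \<and> i \<noteq> j" if "(i, j, p, q) \<in> set L" for i j p q
      using that by (auto simp: L Ls_def)
    show "(\<integral>x. h x * w x \<partial>PiM {..<k} (\<lambda>_. lborel)) = 0" using z by (simp add: lebRn_def)
    fix w' assume w': "box_function {..<k} R B w'" "log_concave_on {..<k} w'"
      "(\<integral>x. h x * w' x \<partial>PiM {..<k} (\<lambda>_. lborel)) = 0"
      and sep: "\<And>c. c \<in> set L \<Longrightarrow> separated {..<k} w' c"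
    define m where "m = (\<integral>x. w' x \<partial>lebRn k)"
    have int: "integrable (lebRn k) w'" unfolding lebRn_def by (rule box_function_integrable[OF _ w'(1)]) simp
    have nn: "0 \<le> w' x" for x using w'(1) by (simp add: box_function_def)
    have m0: "0 \<le> m" unfolding m_def using nn by (intro Bochner_Integration.integral_nonneg)
    have "(\<integral>x. u x * w' x \<partial>lebRn k) \<le> 0"
    proof (cases "m = 0")
      case True
      then have "AE x in lebRn k. w' x = 0" using integral_nonneg_eq_0_iff_AE[OF int] nn by (simp add: m_def)
      then have "AE x in lebRn k. u x * w' x = 0" by eventually_elim simp
      then have "(\<integral>x. u x * w' x \<partial>lebRn k) = (\<integral>x. 0 \<partial>lebRn k)"
        using bounded_fun_integrable[OF _ u w'(1)] by (intro integral_cong_AE) (auto simp: lebRn_def)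
      then show ?thesis by simp
    next
      case False
      then have m: "0 < m" using m0 by simp
      obtain i a s where i: "i < k" and
        thin: "\<And>x j. x \<in> PiE {..<k} (\<lambda>_. UNIV) \<Longrightarrow> w' x \<noteq> 0 \<Longrightarrow> j < k \<Longrightarrow> \<bar>x j - (a j + s j * x i)\<bar> \<le> 200 * \<delta>"
      proof (rule thin_cell[OF _ _ d0(1) w'(1)])
        show "separated {..<k} w' (i, j, p, q)"
          if "i \<in> {..<k}" "j \<in> {..<k}" "i \<noteq> j" "p \<in> grid \<delta> R" "q \<in> grid \<delta> R" for i j p q
          using that by (intro sep) (simp add: L Ls_def)
      qed (use k in auto)
      obtain P where P: "degree P \<le> d" "\<And>t. F (restrict (\<lambda>j. a j + s j * t) {..<k}) = poly P t"
        using F(1) unfolding poly_on_lines_def by meson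
      have near: "\<bar>F x - poly P (x i)\<bar> \<le> \<eta>" if x: "x \<in> PiE {..<k} (\<lambda>_. UNIV)" "w' x \<noteq> 0" for x
      proof -
        define y where "y = restrict (\<lambda>j. a j + s j * x i) {..<k}"
        have xR: "\<bar>x j\<bar> \<le> R" if "j < k" for j
          using w'(1) x that unfolding box_function_def by (meson lessThan_iff not_le)
        have xy: "\<bar>x j - y j\<bar> \<le> 200 * \<delta>" if "j < k" for j using thin[OF x that] that by (simp add: y_def)
        have "\<bar>F x - F y\<bar> \<le> K * (\<Sum>j<k. \<bar>x j - y j\<bar>)"
        proof (rule lip[OF x(1)])
          show "y \<in> PiE {..<k} (\<lambda>_. UNIV)" by (simp add: y_def)
          fix j assume "j < k"
          then show "\<bar>x j\<bar> \<le> R + 200 \<and> \<bar>y j\<bar> \<le> R + 200" using xR[of j] xy[of j] d0 by (auto simp: abs_le_iff)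
        qed
        also have "\<dots> \<le> K * (k * (200 * \<delta>))"
          using sum_bounded_above[of "{..<k}" "\<lambda>j. \<bar>x j - y j\<bar>" "200 * \<delta>"] xy K by (intro mult_left_mono) auto
        also note d1
        finally show ?thesis using P(2)[of "x i"] by (simp add: y_def)
      qed
      define v where "v = (\<lambda>x. w' x / m)"
      have v: "box_function {..<k} R (B / m) v" "log_concave_on {..<k} v"
      proof -
        show "box_function {..<k} R (B / m) v"
          using w'(1) m unfolding box_function_def v_def by (auto intro!: divide_right_mono)
        show "log_concave_on {..<k} v"
          unfolding log_concave_on_def
        proof (intro allI impI)
          fix t :: real and x y :: "nat \<Rightarrow> real"
          assume t: "0 < t" "t < 1" and xy: "x \<in> PiE {..<k} (\<lambda>_. UNIV)" "y \<in> PiE {..<k} (\<lambda>_. UNIV)"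
          have "v x powr t * v y powr (1 - t) = w' x powr t * w' y powr (1 - t) / (m powr t * m powr (1 - t))"
            using nn m by (simp add: v_def powr_divide)
          also have "m powr t * m powr (1 - t) = m" using m by (simp flip: powr_add)
          also have "w' x powr t * w' y powr (1 - t) / m \<le> w' (lin_comb {..<k} t x y) / m"
            using w'(2) t xy m unfolding log_concave_on_def by (intro divide_right_mono) auto
          finally show "v x powr t * v y powr (1 - t) \<le> v (lin_comb {..<k} t x y)" by (simp add: v_def)
        qed
      qed
      have ins: "{..<k} = insert i ({..<k} - {i})" "i \<notin> {..<k} - {i}" "finite ({..<k} - {i})" using i by auto
      have vm: "(\<integral>x. v x \<partial>lebRn k) = 1" using m by (simp add: v_def m_def)
      obtain W B' where W: "log_concave_density W R B'"
        "\<And>g C. g \<in> borel_measurable borel \<Longrightarrow> (\<And>z. \<bar>z\<bar> \<le> R \<Longrightarrow> \<bar>g z\<bar> \<le> C) \<Longrightarrow>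
          (\<integral>x. g (x i) * v x \<partial>PiM (insert i ({..<k} - {i})) (\<lambda>_. lborel)) = (\<integral>z. g z * W z \<partial>lborel)"
      proof (rule marginal_exists[OF ins(3,2) R])
        show "box_function (insert i ({..<k} - {i})) R (B / m) v" "log_concave_on (insert i ({..<k} - {i})) v"
          "(\<integral>x. v x \<partial>PiM (insert i ({..<k} - {i})) (\<lambda>_. lborel)) = 1"
          unfolding ins(1)[symmetric] using v vm by (simp_all only: lebRn_def)
        fix W
        assume "log_concave_density W R (B / m * (2 * R) ^ card ({..<k} - {i}))"
          and "\<And>(g :: real \<Rightarrow> real) C. g \<in> borel_measurable borel \<Longrightarrow> (\<And>z. \<bar>z\<bar> \<le> R \<Longrightarrow> \<bar>g z\<bar> \<le> C) \<Longrightarrow>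
            (\<integral>x. g (x i) * v x \<partial>PiM (insert i ({..<k} - {i})) (\<lambda>_. lborel)) = (\<integral>z. g z * W z \<partial>lborel)"
        then show thesis by (rule that)
      qed
      have "needle k d F R \<eta> v i P W"
        unfolding needle_def
      proof (intro conjI allI impI ballI)
        show "\<exists>B. box_function {..<k} R B v" using v(1) by (rule exI)
        show "\<exists>B. log_concave_density W R B" using W(1) by (rule exI)
        fix g :: "real \<Rightarrow> real" and C assume "g \<in> borel_measurable (borel :: real measure)" "\<forall>z. \<bar>z\<bar> \<le> R \<longrightarrow> \<bar>g z\<bar> \<le> C"
        then show "(\<integral>x. g (x i) * v x \<partial>lebRn k) = (\<integral>z. g z * W z \<partial>lborel)"
          using W(2)[of g C] unfolding lebRn_def ins(1)[symmetric] by simp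
      next
        fix x assume "x \<in> PiE {..<k} (\<lambda>_. UNIV :: real set)" "v x \<noteq> 0"
        then show "\<bar>F x - poly P (x i)\<bar> \<le> \<eta>" by (intro near) (auto simp: v_def)
      qed (fact i P vm)+
      moreover have "(\<integral>x. h x * v x \<partial>lebRn k) = 0" using w'(3) by (simp add: v_def lebRn_def)
      ultimately have "(\<integral>x. u x * v x \<partial>lebRn k) \<le> 0" by (rule needles)
      then show ?thesis using m by (simp add: v_def divide_le_0_iff)
    qed
    then show "(\<integral>x. u x * w' x \<partial>PiM {..<k} (\<lambda>_. lborel)) \<le> 0" by (simp add: lebRn_def)
  qed simp
qed

text \<open>r is the infimum of the t at which the distribution function reaches q. Right continuity
  gives the first bound and the left limit at r the second; they concern different events because X
  may have an atom at r.\<close>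

lemma quantile_exists:
  fixes X :: "'a \<Rightarrow> real"
  assumes "prob_space M" and [measurable]: "X \<in> borel_measurable M" and q: "0 < q" "q < 1"
  obtains r where "q \<le> measure M {x\<in>space M. X x \<le> r}" "measure M {x\<in>space M. X x < r} \<le> q"
    "\<And>s. s < r \<Longrightarrow> measure M {x\<in>space M. X x \<le> s} < q"
proof -
  interpret prob_space M by fact
  define N where "N = distr M borel X"
  interpret N: real_distribution N unfolding N_def by (rule real_distribution_distr) simp
  have c: "cdf N t = measure M {x\<in>space M. X x \<le> t}" for t
    unfolding cdf_def N_def by (subst measure_distr) (auto intro!: arg_cong[where f = "measure M"])
  define T where "T = {t. q \<le> cdf N t}"
  have "eventually (\<lambda>t. q < cdf N t) at_top"
    using N.cdf_lim_at_top_prob q(2) by (rule order_tendstoD)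
  then obtain t1 where t1: "t1 \<in> T" unfolding eventually_at_top_linorder T_def by (metis less_imp_le mem_Collect_eq order_refl)
  have "eventually (\<lambda>t. cdf N t < q) at_bot"
    using N.cdf_lim_at_bot q(1) by (rule order_tendstoD)
  then obtain t0 where t0: "\<And>t. t \<le> t0 \<Longrightarrow> cdf N t < q" unfolding eventually_at_bot_linorder by blast
  have bdd: "bdd_below T" 
  proof (rule bdd_belowI[of _ t0])
    fix t assume "t \<in> T"
    then show "t0 \<le> t" using t0[of t] by (cases "t \<le> t0") (auto simp: T_def)
  qed
  define r where "r = Inf T"
  have low: "cdf N s < q" if "s < r" for s
    using cInf_lower[OF _ bdd, of s] that by (force simp: r_def T_def)
  have up: "q \<le> cdf N s" if "r < s" for s
  proof -
    have "T \<noteq> {}" using t1 by auto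
    from cInf_less_iff[OF this bdd, of s] that obtain t where "t \<in> T" "t < s" by (auto simp: r_def)
    then show ?thesis using N.cdf_nondecreasing[of t s] by (auto simp: T_def)
  qed
  have right: "(cdf N \<longlongrightarrow> cdf N r) (at_right r)" using N.cdf_is_right_cont[of r] by (simp add: continuous_within)
  have 1: "q \<le> cdf N r"
    by (rule tendsto_lowerbound[OF right]) (auto simp: eventually_at_right_less up intro: eventually_mono[OF eventually_at_right_less])
  have 2: "measure N {..<r} \<le> q"
    by (rule tendsto_upperbound[OF N.cdf_at_left]) (auto intro!: eventually_mono[OF eventually_at_left_real[of "r - 1" r]] less_imp_le low)
  have 3: "measure N {..<r} = measure M {x\<in>space M. X x < r}"
    unfolding N_def by (subst measure_distr) (auto intro!: arg_cong[where f = "measure M"])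
  show ?thesis by (rule that[of r]) (use 1 2 3 low c in auto)
qed

section \<open>Estimates on needles and on compactly supported densities\<close>

text \<open>An integral rather than a measure, so that cells of any total mass are covered and
  conditions on it are linear in w.\<close>

definition mass_of :: "nat \<Rightarrow> ((nat \<Rightarrow> real) \<Rightarrow> real) \<Rightarrow> ((nat \<Rightarrow> real) \<Rightarrow> bool) \<Rightarrow> real" where
  "mass_of k w Q = (\<integral>x. indicat_real {x. Q x} x * w x \<partial>lebRn k)"

lemma indicator_measurable_pred:
  assumes "{x \<in> space M. Q x} \<in> sets M"
  shows "indicat_real {x. Q x} \<in> borel_measurable M"
proof -
  have "indicat_real {x \<in> space M. Q x} \<in> borel_measurable M" using assms by simp
  then show ?thesis by (rule measurable_cong[THEN iffD1, rotated]) (auto simp: indicator_def)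
qed

lemma mass_of_integrable:
  assumes "box_function {..<k} R B w" "{x \<in> space (lebRn k). Q x} \<in> sets (lebRn k)"
  shows "integrable (lebRn k) (\<lambda>x. indicat_real {x. Q x} x * w x)"
proof -
  have "indicat_real {x. Q x} \<in> borel_measurable (PiM {..<k} (\<lambda>_. lborel))"
    using indicator_measurable_pred[OF assms(2)] by (simp only: lebRn_def)
  moreover have "\<bar>indicat_real {x. Q x} x\<bar> \<le> 1" for x by (simp add: indicator_def)
  ultimately have "bounded_fun {..<k} R (indicat_real {x. Q x})" unfolding bounded_fun_def by blast
  from bounded_fun_integrable[OF _ this assms(1)] show ?thesis by (simp add: lebRn_def)
qed

lemma mass_of_mono:
  assumes w: "box_function {..<k} R B w" and "{x \<in> space (lebRn k). Q x} \<in> sets (lebRn k)" "{x \<in> space (lebRn k). Q' x} \<in> sets (lebRn k)"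
    and "\<And>x. x \<in> PiE {..<k} (\<lambda>_. UNIV) \<Longrightarrow> w x \<noteq> 0 \<Longrightarrow> Q x \<Longrightarrow> Q' x"
  shows "mass_of k w Q \<le> mass_of k w Q'"
  unfolding mass_of_def
proof (rule integral_mono)
  fix x assume "x \<in> space (lebRn k)"
  then have x: "x \<in> PiE {..<k} (\<lambda>_. UNIV)" by (simp add: lebRn_def space_PiM)
  have "0 \<le> w x" using w by (simp add: box_function_def)
  then show "indicat_real {x. Q x} x * w x \<le> indicat_real {x. Q' x} x * w x"
    using assms(4)[OF x] by (cases "w x = 0") (auto simp: indicator_def)
qed (use assms in \<open>auto intro: mass_of_integrable\<close>)

lemma mass_of_union:
  assumes w: "box_function {..<k} R B w" and "{x \<in> space (lebRn k). Q x} \<in> sets (lebRn k)" "{x \<in> space (lebRn k). Q' x} \<in> sets (lebRn k)"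
  shows "mass_of k w (\<lambda>x. Q x \<or> Q' x) \<le> mass_of k w Q + mass_of k w Q'"
proof -
  have m: "{x \<in> space (lebRn k). Q x \<or> Q' x} \<in> sets (lebRn k)" 
  proof -
    have "{x \<in> space (lebRn k). Q x \<or> Q' x} = {x \<in> space (lebRn k). Q x} \<union> {x \<in> space (lebRn k). Q' x}" by auto
    then show ?thesis using assms(2,3) by auto
  qed
  have "mass_of k w (\<lambda>x. Q x \<or> Q' x) \<le> (\<integral>x. indicat_real {x. Q x} x * w x + indicat_real {x. Q' x} x * w x \<partial>lebRn k)"
    unfolding mass_of_def
  proof (rule integral_mono)
    show "indicat_real {x. Q x \<or> Q' x} x * w x \<le> indicat_real {x. Q x} x * w x + indicat_real {x. Q' x} x * w x" for x
      using w by (auto simp: indicator_def box_function_def)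
  qed (use w assms m in \<open>auto intro!: Bochner_Integration.integrable_add mass_of_integrable\<close>)
  also have "\<dots> = mass_of k w Q + mass_of k w Q'"
    unfolding mass_of_def by (intro Bochner_Integration.integral_add mass_of_integrable[OF w] assms)
  finally show ?thesis .
qed

lemma density_prob_space:
  assumes wm[measurable]: "w \<in> borel_measurable (lebRn k)" and nn: "\<And>x. 0 \<le> w x"
    and int: "integrable (lebRn k) w" and m: "(\<integral>x. w x \<partial>lebRn k) = 1"
  shows "prob_space (density (lebRn k) (\<lambda>x. ennreal (w x)))"
    and "{x \<in> space (lebRn k). Q x} \<in> sets (lebRn k) \<Longrightarrow>
      measure (density (lebRn k) (\<lambda>x. ennreal (w x))) {x \<in> space (lebRn k). Q x} = mass_of k w Q"
proof -
  show "prob_space (density (lebRn k) (\<lambda>x. ennreal (w x)))"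
  proof
    have "emeasure (density (lebRn k) (\<lambda>x. ennreal (w x))) (space (lebRn k)) = (\<integral>\<^sup>+ x. ennreal (w x) \<partial>lebRn k)"
      by (subst emeasure_density) (auto intro!: nn_integral_cong simp: indicator_def)
    also have "\<dots> = 1" using nn_integral_eq_integral[OF int] nn m by simp
    finally show "emeasure (density (lebRn k) (\<lambda>x. ennreal (w x))) (space (density (lebRn k) (\<lambda>x. ennreal (w x)))) = 1" by simp
  qed
  assume Q: "{x \<in> space (lebRn k). Q x} \<in> sets (lebRn k)"
  define A where "A = {x \<in> space (lebRn k). Q x}"
  have "measure (density (lebRn k) (\<lambda>x. ennreal (w x))) A = (\<integral>x. indicator A x \<partial>density (lebRn k) (\<lambda>x. ennreal (w x)))"
    using Q by (simp add: A_def)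
  also have "\<dots> = (\<integral>x. w x * indicator A x \<partial>lebRn k)"
    using Q nn by (subst integral_density) (auto simp: A_def)
  also have "\<dots> = mass_of k w Q" unfolding mass_of_def
    by (intro Bochner_Integration.integral_cong) (auto simp: A_def indicator_def)
  finally show "measure (density (lebRn k) (\<lambda>x. ennreal (w x))) {x \<in> space (lebRn k). Q x} = mass_of k w Q" by (simp add: A_def)
qed

lemma component_measurable:
  assumes "i < k"
  shows "(\<lambda>x. x i) \<in> borel_measurable (lebRn k)"
  unfolding lebRn_def using assms
  by (auto intro: measurable_component_singleton[where M = "\<lambda>_. lborel :: real measure", simplified])

lemma needle_integral:
  assumes "needle k d F R \<eta> w i P W" "v \<in> borel_measurable borel" "\<And>z. \<bar>z\<bar> \<le> R \<Longrightarrow> \<bar>v z\<bar> \<le> K"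
  shows "(\<integral>x. v (x i) * w x \<partial>lebRn k) = (\<integral>z. v z * W z \<partial>lborel)"
  using assms unfolding needle_def by blast

text \<open>On the support of a needle an event about F forces x i into A, because F is \<eta>-close
  to P(x i); its mass is then bounded by that of A under the marginal.\<close>

lemma needle_prob:
  assumes nd: "needle k d F R \<eta> w i P W" and A: "A \<in> sets borel"
    and Q: "{x \<in> space (lebRn k). Q x} \<in> sets (lebRn k)" "c \<le> mass_of k w Q"
    and im: "\<And>x. \<bar>F x - poly P (x i)\<bar> \<le> \<eta> \<Longrightarrow> Q x \<Longrightarrow> x i \<in> A"
  shows "c \<le> (\<integral>z. indicat_real A z * W z \<partial>lborel)"
proof -
  obtain B where w: "box_function {..<k} R B w" using nd by (auto simp: needle_def)
  have i: "i < k" using nd by (simp add: needle_def)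
  have [measurable]: "(\<lambda>x. x i) \<in> borel_measurable (lebRn k)" by (rule component_measurable[OF i])
  note A[measurable]
  have "mass_of k w Q \<le> mass_of k w (\<lambda>x. x i \<in> A)"
    by (rule mass_of_mono[OF w Q(1)]) (use nd im in \<open>auto simp: needle_def\<close>)
  also have "\<dots> = (\<integral>x. indicat_real A (x i) * w x \<partial>lebRn k)"
    unfolding mass_of_def by (intro Bochner_Integration.integral_cong) (auto simp: indicator_def)
  also have "\<dots> = (\<integral>z. indicat_real A z * W z \<partial>lborel)"
    using A by (intro needle_integral[OF nd, where K = 1]) (auto simp: indicator_def)
  finally show ?thesis using Q(2) by linarith
qed

text \<open>Write M as M^(1-1/d) M^(1/d): for a cut-off at most 1/M, the plateau of the weight
  compensates for the trivial bound of the derivative by M.\<close>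

lemma powr_scale_bound:
  assumes "0 < \<tau>" "\<tau> \<le> 1 / M" "0 < M" "0 < (d::nat)"
  shows "M \<le> M powr (1 - 1 / d) * \<tau> powr (- 1 / d)"
proof -
  have "M = M powr (1 - 1 / d) * M powr (1 / d)" using assms by (simp flip: powr_add)
  also have "M powr (1 / d) = (1 / M) powr (- 1 / d)" using assms by (simp add: powr_divide powr_minus_divide)
  also have "\<dots> \<le> \<tau> powr (- 1 / d)" using assms by (intro powr_mono2') auto
  finally show ?thesis by (simp add: mult_left_mono)
qed

lemma lower_half_integral:
  assumes w: "box_function {..<k} R B w" and Q: "{x \<in> space (lebRn k). Q x} \<in> sets (lebRn k)" "1 / 2 \<le> mass_of k w Q"
    and g: "g \<in> borel_measurable (lebRn k)" "\<And>x. 0 \<le> g x" "\<And>x. g x \<le> K" and low: "\<And>x. Q x \<Longrightarrow> a \<le> g x" "0 \<le> a"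
  shows "a \<le> 2 * (\<integral>x. g x * w x \<partial>lebRn k)"
proof -
  have "a / 2 \<le> a * mass_of k w Q" using mult_left_mono[OF Q(2) low(2)] by simp
  also have "\<dots> = (\<integral>x. a * (indicat_real {x. Q x} x * w x) \<partial>lebRn k)" by (simp add: mass_of_def)
  also have "\<dots> \<le> (\<integral>x. g x * w x \<partial>lebRn k)"
  proof (rule integral_mono)
    show "integrable (lebRn k) (\<lambda>x. g x * w x)"
      unfolding lebRn_def by (rule bounded_fun_integrable[OF _ _ w])
        (use g in \<open>auto simp: bounded_fun_def lebRn_def intro!: exI[of _ K]\<close>)
    show "a * (indicat_real {x. Q x} x * w x) \<le> g x * w x" for x
      using w low(1)[of x] g(2)[of x] by (auto simp: indicator_def box_function_def intro!: mult_right_mono)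
  qed (intro integrable_mult_right mass_of_integrable[OF w Q(1)])
  finally show ?thesis by simp
qed

text \<open>The weight |s|^(-1/d) with its singularity flattened at |s| = \<tau>. For positive
  \<tau> it is bounded and continuous, so \<open>bounded_fun_compose\<close> applies to it.\<close>

definition kernel :: "nat \<Rightarrow> real \<Rightarrow> real \<Rightarrow> real" where
  "kernel d \<tau> s = max \<bar>s\<bar> \<tau> powr (- 1 / d)"

lemma kernel_bounds: "0 < \<tau> \<Longrightarrow> 0 \<le> kernel d \<tau> s" "0 < \<tau> \<Longrightarrow> kernel d \<tau> s \<le> \<tau> powr (- 1 / d)"
  by (auto simp: kernel_def intro!: powr_mono2')

text \<open>Let r be the median of |F - m| on the needle. If r exceeds \<tau>, the half of the mass
  with |F - m| \<le> r bounds the weight integral from below by r^(-1/d) / 2. On the other half |F -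
  m| \<ge> r, so one of F \<ge> m + r and F \<le> m - r has mass 1/4, and with the mass c on the
  other side of m the polynomial oscillates by about r. The resulting rate r^(-1/d) is dominated by
  the weight integral.\<close>

lemma needle_oscillation_bound:
  assumes nd: "needle k d F R \<eta> w i P W" and Fm[measurable]: "F \<in> borel_measurable (lebRn k)"
    and E: "oscillation_constant d E" and d: "1 \<le> d" and t: "test_fun \<phi> D M" and M: "0 < M"
    and lip: "\<And>x y. \<bar>D x - D y\<bar> \<le> K * \<bar>x - y\<bar>" and c: "0 < c" "c \<le> 1 / 4"
    and tau: "0 < \<tau>" "\<tau> \<le> 1 / M" and eta: "0 < \<eta>" "\<eta> \<le> \<tau> / 4"
    and lo: "c \<le> mass_of k w (\<lambda>x. F x \<le> m)" and hi: "c \<le> mass_of k w (\<lambda>x. m \<le> F x)"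
  shows "(\<integral>x. D (F x) * w x \<partial>lebRn k)
    \<le> 4 * (1 + E * (1 + 32 / c\<^sup>2)) * M powr (1 - 1 / d) * (\<integral>x. kernel d \<tau> (F x - m) * w x \<partial>lebRn k) + K * \<eta>"
proof -
  obtain B where w: "box_function {..<k} R B w" using nd by (auto simp: needle_def)
  obtain B' where "log_concave_density W R B'" using nd by (auto simp: needle_def)
  then interpret W: log_concave_density W R B' .
  have i: "i < k" and P: "degree P \<le> d" and m1: "(\<integral>x. w x \<partial>lebRn k) = 1" using nd by (auto simp: needle_def)
  have E0: "0 < E" using E by (simp add: oscillation_constant_def)
  define CE where "CE = 1 + E * (1 + 32 / c\<^sup>2)"
  have CE: "1 \<le> CE" using E0 by (simp add: CE_def)
  define G where "G = (\<integral>x. kernel d \<tau> (F x - m) * w x \<partial>lebRn k)"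
  have DM: "\<bar>D x\<bar> \<le> M" for x using t unfolding test_fun_def by blast
  have Dc: "continuous_on UNIV D" using t by (simp add: test_fun_def)
  have Dm[measurable]: "D \<in> borel_measurable borel" using Dc by (rule borel_measurable_continuous_onI)
  have Pm[measurable]: "poly P \<in> borel_measurable borel" by (intro borel_measurable_continuous_onI continuous_intros)
  have [measurable]: "(\<lambda>x. x i) \<in> borel_measurable (lebRn k)" by (rule component_measurable[OF i])
  have wm[measurable]: "w \<in> borel_measurable (lebRn k)" using w by (simp add: box_function_def lebRn_def)
  have nn: "0 \<le> w x" for x using w by (simp add: box_function_def)
  have wint: "integrable (lebRn k) w" unfolding lebRn_def by (rule box_function_integrable[OF _ w]) simp
  have bint: "integrable (lebRn k) (\<lambda>x. g x * w x)" if "g \<in> borel_measurable (lebRn k)" "\<And>x. \<bar>g x\<bar> \<le> C" for g and C :: real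
    unfolding lebRn_def by (rule bounded_fun_integrable[OF _ _ w])
      (use that in \<open>auto simp: bounded_fun_def lebRn_def intro!: exI[of _ C]\<close>)
  define X where "X = (\<lambda>x. \<bar>F x - m\<bar>)"
  have Xm[measurable]: "X \<in> borel_measurable (lebRn k)" unfolding X_def by measurable
  define \<mu> where "\<mu> = density (lebRn k) (\<lambda>x. ennreal (w x))"
  have pr: "prob_space \<mu>" unfolding \<mu>_def by (rule density_prob_space(1)[OF wm nn wint m1])
  interpret prob_space \<mu> by (rule pr)
  have sp: "space \<mu> = space (lebRn k)" "sets \<mu> = sets (lebRn k)" by (auto simp: \<mu>_def)
  have "X \<in> borel_measurable \<mu>" by (simp add: \<mu>_def)
  then obtain r where r: "1/2 \<le> measure \<mu> {x\<in>space \<mu>. X x \<le> r}" "measure \<mu> {x\<in>space \<mu>. X x < r} \<le> 1/2"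
    by (rule quantile_exists[OF pr, of X "1/2"]) auto
  have r1: "1/2 \<le> mass_of k w (\<lambda>x. X x \<le> r)"
    using r(1) density_prob_space(2)[OF wm nn wint m1, of "\<lambda>x. X x \<le> r"] by (simp add: sp \<mu>_def)
  have r2: "1/2 \<le> mass_of k w (\<lambda>x. r \<le> X x)"
  proof -
    have "measure \<mu> {x\<in>space \<mu>. r \<le> X x} = 1 - measure \<mu> {x\<in>space \<mu>. X x < r}"
      by (subst prob_compl[symmetric]) (auto simp: sp intro!: arg_cong[where f = "measure \<mu>"])
    then show ?thesis using r(2) density_prob_space(2)[OF wm nn wint m1, of "\<lambda>x. r \<le> X x"] by (simp add: sp \<mu>_def)
  qed
  \<comment> \<open>For a median below \<tau> the weight is flat, and \<tau> takes the place of
    r.\<close>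
  define r' where "r' = max r \<tau>"
  have r'0: "0 < r'" using tau by (simp add: r'_def)
  have km: "(\<lambda>x. kernel d \<tau> (F x - m)) \<in> borel_measurable (lebRn k)" unfolding kernel_def by measurable
  have Glow: "r' powr (- 1 / d) \<le> 2 * G"
    unfolding G_def
  proof (rule lower_half_integral[OF w _ r1 km])
    show "{x \<in> space (lebRn k). X x \<le> r} \<in> sets (lebRn k)" by measurable
    show "r' powr (- 1 / d) \<le> kernel d \<tau> (F x - m)" if "X x \<le> r" for x
      unfolding kernel_def using that tau by (intro powr_mono2') (auto simp: r'_def X_def)
  qed (use kernel_bounds[OF tau(1)] in auto)
  have G0: "0 \<le> G" using Glow by (metis mult_le_cancel_left_pos mult_zero_right order_trans powr_ge_zero zero_less_numeral)
  have Q0: "0 \<le> M powr (1 - 1 / d)" by simp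
  have main: "(\<integral>x. D (F x) * w x \<partial>lebRn k) \<le> 4 * CE * (M powr (1 - 1 / d) * G) + K * \<eta>"
  proof (cases "r \<le> \<tau>")
    case True
    then have r': "r' = \<tau>" by (simp add: r'_def)
    have "(\<integral>x. D (F x) * w x \<partial>lebRn k) \<le> (\<integral>x. M * w x \<partial>lebRn k)"
    proof (rule integral_mono)
      show "integrable (lebRn k) (\<lambda>x. D (F x) * w x)" by (rule bint[OF _ DM]) measurable
      show "D (F x) * w x \<le> M * w x" for x using DM[of "F x"] nn[of x] by (intro mult_right_mono) auto
    qed (use wint in simp)
    also have "\<dots> = M" using m1 by simp
    also have "\<dots> \<le> M powr (1 - 1 / d) * \<tau> powr (- 1 / d)" using powr_scale_bound[OF tau M] d by simp
    also have "\<dots> \<le> M powr (1 - 1 / d) * (2 * G)" using Glow r' by (intro mult_left_mono) auto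
    also have "\<dots> \<le> 4 * CE * (M powr (1 - 1 / d) * G)"
    proof -
      have "2 * (M powr (1 - 1 / d) * G) \<le> (4 * CE) * (M powr (1 - 1 / d) * G)"
        using CE G0 by (intro mult_right_mono) auto
      then show ?thesis by simp
    qed
    also have "\<dots> \<le> \<dots> + K * \<eta>"
    proof -
      have "0 \<le> K" using lip[of 1 0] by (metis abs_ge_zero abs_one diff_zero mult.right_neutral order_trans)
      then show ?thesis using eta by simp
    qed
    finally show ?thesis .
  next
    case False
    then have r': "r' = r" and r0: "\<tau> < r" by (auto simp: r'_def)
    have "1/2 \<le> mass_of k w (\<lambda>x. m + r \<le> F x \<or> F x \<le> m - r)"
    proof (rule order_trans[OF r2 mass_of_mono[OF w]])
      show "{x \<in> space (lebRn k). r \<le> X x} \<in> sets (lebRn k)" by measurable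
      show "{x \<in> space (lebRn k). m + r \<le> F x \<or> F x \<le> m - r} \<in> sets (lebRn k)" by measurable
    qed (auto simp: X_def abs_if split: if_splits)
    also have "\<dots> \<le> mass_of k w (\<lambda>x. m + r \<le> F x) + mass_of k w (\<lambda>x. F x \<le> m - r)"
      by (rule mass_of_union[OF w]) measurable
    finally consider "1/4 \<le> mass_of k w (\<lambda>x. m + r \<le> F x)" | "1/4 \<le> mass_of k w (\<lambda>x. F x \<le> m - r)" by linarith
    then obtain a b where ab: "b - a = r - 2 * \<eta>"
      "c \<le> (\<integral>z. indicator {x. poly P x \<le> a} z * W z \<partial>lborel)"
      "c \<le> (\<integral>z. indicator {x. b \<le> poly P x} z * W z \<partial>lborel)"
    proof cases
      case 1
      show ?thesis
      proof (rule that[of "m + r - \<eta>" "m + \<eta>"])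
        show "c \<le> (\<integral>z. indicator {x. poly P x \<le> m + \<eta>} z * W z \<partial>lborel)"
          by (rule needle_prob[OF nd _ _ lo]) auto
        have "c \<le> mass_of k w (\<lambda>x. m + r \<le> F x)" using 1 c by simp
        then show "c \<le> (\<integral>z. indicator {x. m + r - \<eta> \<le> poly P x} z * W z \<partial>lborel)"
          by (rule needle_prob[OF nd, rotated 2]) auto
      qed simp
    next
      case 2
      show ?thesis
      proof (rule that[of "m - \<eta>" "m - r + \<eta>"])
        show "c \<le> (\<integral>z. indicator {x. m - \<eta> \<le> poly P x} z * W z \<partial>lborel)"
          by (rule needle_prob[OF nd _ _ hi]) auto
        have "c \<le> mass_of k w (\<lambda>x. F x \<le> m - r)" using 2 c by simp
        then show "c \<le> (\<integral>z. indicator {x. poly P x \<le> m - r + \<eta>} z * W z \<partial>lborel)"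
          by (rule needle_prob[OF nd, rotated 2]) auto
      qed simp
    qed
    \<comment> \<open>The approximation loses \<eta> at both events, and \<eta> \<le> \<tau> / 4 < r
      / 4 leaves half of the gap.\<close>
    have gap: "r / 2 \<le> b - a" using ab(1) eta r0 by simp
    then have "a < b" using tau r0 by linarith
    then have "(\<integral>z. D (poly P z) * W z \<partial>lborel) \<le> CE * (M powr (1 - 1 / d) * (b - a) powr (- 1 / d))"
      unfolding CE_def using c ab by (intro W.needle_oscillation[OF E d P t M]) auto
    also have "\<dots> \<le> CE * (M powr (1 - 1 / d) * (4 * G))"
    proof -
      have "(b - a) powr (- 1 / d) \<le> (r / 2) powr (- 1 / d)"
        using gap tau r0 by (intro powr_mono2') auto
      also have "\<dots> = 2 powr (1 / d) * r powr (- 1 / d)"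
        using tau r0 by (simp add: powr_divide powr_minus_divide)
      also have "\<dots> \<le> 2 * (2 * G)"
      proof (rule mult_mono)
        show "2 powr (1 / real d) \<le> 2" using d powr_mono[of "1 / real d" 1 2] by simp
      qed (use Glow r' in auto)
      finally show ?thesis using CE by (intro mult_left_mono) auto
    qed
    also have "\<dots> = 4 * CE * (M powr (1 - 1 / d) * G)" by simp
    finally have needle: "(\<integral>z. D (poly P z) * W z \<partial>lborel) \<le> 4 * CE * (M powr (1 - 1 / d) * G)" .
    \<comment> \<open>Returning from P to F costs the Lipschitz constant of D times \<eta>.\<close>
    have "(\<integral>x. D (F x) * w x \<partial>lebRn k) \<le> (\<integral>x. D (poly P (x i)) * w x + K * \<eta> * w x \<partial>lebRn k)"
    proof (rule integral_mono)
      show "integrable (lebRn k) (\<lambda>x. D (F x) * w x)" by (rule bint[OF _ DM]) measurable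
      show "integrable (lebRn k) (\<lambda>x. D (poly P (x i)) * w x + K * \<eta> * w x)"
        by (intro Bochner_Integration.integrable_add integrable_mult_right wint bint[OF _ DM]) measurable
      fix x assume "x \<in> space (lebRn k)"
      then have x: "x \<in> PiE {..<k} (\<lambda>_. UNIV)" by (simp add: lebRn_def space_PiM)
      show "D (F x) * w x \<le> D (poly P (x i)) * w x + K * \<eta> * w x"
      proof (cases "w x = 0")
        case False
        have "0 \<le> K" using lip[of 1 0] by (metis abs_ge_zero abs_one diff_zero mult.right_neutral order_trans)
        then have "\<bar>D (F x) - D (poly P (x i))\<bar> \<le> K * \<eta>"
          using lip[of "F x" "poly P (x i)"] nd x False unfolding needle_def by (meson mult_left_mono order_trans)
        then have "D (F x) \<le> D (poly P (x i)) + K * \<eta>" by linarith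
        then show ?thesis using mult_right_mono[OF _ nn[of x]] by (fastforce simp: distrib_right)
      qed simp
    qed
    also have "\<dots> = (\<integral>x. D (poly P (x i)) * w x \<partial>lebRn k) + K * \<eta> * (\<integral>x. w x \<partial>lebRn k)"
    proof -
      have "integrable (lebRn k) (\<lambda>x. D (poly P (x i)) * w x)" by (rule bint[OF _ DM]) measurable
      then show ?thesis using wint by simp
    qed
    also have "(\<integral>x. D (poly P (x i)) * w x \<partial>lebRn k) = (\<integral>z. D (poly P z) * W z \<partial>lborel)"
    proof -
      have "(\<lambda>z. D (poly P z)) \<in> borel_measurable borel" by measurable
      then show ?thesis using nd DM unfolding needle_def by blast
    qed
    finally show ?thesis using needle m1 by simp
  qed
  then show ?thesis by (simp add: CE_def G_def mult.assoc)
qed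

lemma box_lipschitz_bounded:
  assumes "box_lipschitz k F"
  obtains C where "\<And>x. x \<in> PiE {..<k} (\<lambda>_. UNIV) \<Longrightarrow> (\<And>j. j < k \<Longrightarrow> \<bar>x j\<bar> \<le> R) \<Longrightarrow> \<bar>F x\<bar> \<le> C"
proof -
  define R' where "R' = max R 0"
  define o' where "o' = restrict (\<lambda>_. 0 :: real) {..<k}"
  obtain K where K: "0 \<le> K" "\<And>x y. x \<in> PiE {..<k} (\<lambda>_. UNIV) \<Longrightarrow> y \<in> PiE {..<k} (\<lambda>_. UNIV) \<Longrightarrow>
     (\<And>j. j < k \<Longrightarrow> \<bar>x j\<bar> \<le> R' \<and> \<bar>y j\<bar> \<le> R') \<Longrightarrow> \<bar>F x - F y\<bar> \<le> K * (\<Sum>j<k. \<bar>x j - y j\<bar>)"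
    using assms[unfolded box_lipschitz_def, rule_format, of R'] by auto
  show ?thesis
  proof (rule that[of "\<bar>F o'\<bar> + K * (k * R')"])
    fix x assume x: "x \<in> PiE {..<k} (\<lambda>_. UNIV)" "\<And>j. j < k \<Longrightarrow> \<bar>x j\<bar> \<le> R"
    have "\<bar>F x - F o'\<bar> \<le> K * (\<Sum>j<k. \<bar>x j - o' j\<bar>)"
      using x by (intro K(2)) (force simp: o'_def R'_def)+
    also have "\<dots> \<le> K * (k * R')"
      using sum_bounded_above[of "{..<k}" "\<lambda>j. \<bar>x j - o' j\<bar>" R'] x(2) K(1)
      by (intro mult_left_mono) (force simp: o'_def R'_def)+
    finally show "\<bar>F x\<bar> \<le> \<bar>F o'\<bar> + K * (k * R')" by linarith
  qed
qed

lemma bounded_fun_compose: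
  assumes F: "box_lipschitz k F" "F \<in> borel_measurable (lebRn k)" and g: "continuous_on UNIV (g :: real \<Rightarrow> real)"
  shows "bounded_fun {..<k} R (\<lambda>x. g (F x))"
  unfolding bounded_fun_def
proof
  have "g \<in> borel_measurable borel" using g by (rule borel_measurable_continuous_onI)
  then show "(\<lambda>x. g (F x)) \<in> borel_measurable (PiM {..<k} (\<lambda>_. lborel))"
    using measurable_compose[OF F(2)] by (simp add: lebRn_def)
  obtain C where C: "\<And>x. x \<in> PiE {..<k} (\<lambda>_. UNIV) \<Longrightarrow> (\<And>j. j < k \<Longrightarrow> \<bar>x j\<bar> \<le> R) \<Longrightarrow> \<bar>F x\<bar> \<le> C"
    using box_lipschitz_bounded[OF F(1)] by blast
  have "compact (g ` {-C..C})" by (intro compact_continuous_image continuous_on_subset[OF g]) auto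
  then have "bounded (g ` {-C..C})" by (rule compact_imp_bounded)
  then obtain K where K: "\<forall>y\<in>g ` {-C..C}. norm y \<le> K" unfolding bounded_iff by blast
  show "\<exists>K. \<forall>x\<in>PiE {..<k} (\<lambda>_. UNIV). (\<forall>i\<in>{..<k}. \<bar>x i\<bar> \<le> R) \<longrightarrow> \<bar>g (F x)\<bar> \<le> K"
  proof (intro exI[of _ K] ballI impI)
    fix x :: "nat \<Rightarrow> real" assume "x \<in> PiE {..<k} (\<lambda>_. UNIV)" "\<forall>i\<in>{..<k}. \<bar>x i\<bar> \<le> R"
    then have "\<bar>F x\<bar> \<le> C" by (intro C) auto
    then show "\<bar>g (F x)\<bar> \<le> K" using K by (auto simp: abs_le_iff)
  qed
qed

definition moment_constant :: "nat \<Rightarrow> real \<Rightarrow> real \<Rightarrow> real" where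
  "moment_constant d E c = 8 + 4 * ((16 * d * pi * E / c) ^ d)\<^sup>2 * sqrt (32 / c\<^sup>2)"

lemma moment_constant_pos: "0 < moment_constant d E c"
  unfolding moment_constant_def by (intro add_pos_nonneg mult_nonneg_nonneg) auto

text \<open>\<open>needle_second_moment\<close> applied to P - m. The radius grows to r + \<eta>
  because the event is about F; splitting F - m into P - m and an error of at most \<eta> costs the
  factor 2.\<close>

lemma needle_second_moment_bound:
  assumes nd: "needle k d F R \<eta> w i P W" and F: "box_lipschitz k F" "F \<in> borel_measurable (lebRn k)"
    and E: "oscillation_constant d E" and d: "1 \<le> d" and c: "0 < c" "c \<le> 1" and r: "0 \<le> r" and eta: "0 < \<eta>"
    and mass: "c \<le> mass_of k w (\<lambda>x. \<bar>F x - m\<bar> \<le> r)"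
  shows "(\<integral>x. (F x - m)\<^sup>2 * w x \<partial>lebRn k) \<le> 2 * moment_constant d E c * (r + \<eta>)\<^sup>2 + 2 * \<eta>\<^sup>2"
proof -
  obtain B where w: "box_function {..<k} R B w" using nd by (auto simp: needle_def)
  obtain B' where "log_concave_density W R B'" using nd by (auto simp: needle_def)
  then interpret W: log_concave_density W R B' .
  have i: "i < k" and P: "degree P \<le> d" and m1: "(\<integral>x. w x \<partial>lebRn k) = 1" using nd by (auto simp: needle_def)
  note F(2)[measurable]
  have [measurable]: "(\<lambda>x. x i) \<in> borel_measurable (lebRn k)" by (rule component_measurable[OF i])
  have wm[measurable]: "w \<in> borel_measurable (lebRn k)" using w by (simp add: box_function_def lebRn_def)
  have nn: "0 \<le> w x" for x using w by (simp add: box_function_def)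
  have wint: "integrable (lebRn k) w" unfolding lebRn_def by (rule box_function_integrable[OF _ w]) simp
  define Q where "Q = P - [:m:]"
  have Q: "degree Q \<le> d" "\<And>x. poly Q x = poly P x - m"
    unfolding Q_def using P by (auto intro!: degree_diff_le)
  have Qm[measurable]: "poly Q \<in> borel_measurable borel" by (intro borel_measurable_continuous_onI continuous_intros)
  have "c \<le> (\<integral>z. indicat_real {z. \<bar>poly Q z\<bar> \<le> r + \<eta>} z * W z \<partial>lborel)"
  proof (rule needle_prob[OF nd _ _ mass])
    show "{z. \<bar>poly Q z\<bar> \<le> r + \<eta>} \<in> sets borel" by measurable
  qed (auto simp: Q(2))
  then have mom: "(\<integral>z. (poly Q z)\<^sup>2 * W z \<partial>lborel) \<le> moment_constant d E c * (r + \<eta>)\<^sup>2"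
    unfolding moment_constant_def using r eta by (intro W.needle_second_moment[OF E d Q(1) _ c]) auto
  have "compact ((\<lambda>z. (poly Q z)\<^sup>2) ` {-R..R})" by (intro compact_continuous_image continuous_intros) auto
  then have "bounded ((\<lambda>z. (poly Q z)\<^sup>2) ` {-R..R})" by (rule compact_imp_bounded)
  then obtain K where K: "\<forall>y\<in>(\<lambda>z. (poly Q z)\<^sup>2) ` {-R..R}. norm y \<le> K" unfolding bounded_iff by blast
  have Kb: "\<bar>(poly Q z)\<^sup>2\<bar> \<le> K" if "\<bar>z\<bar> \<le> R" for z using K that by (auto simp: abs_le_iff)
  have qint: "integrable (lebRn k) (\<lambda>x. (poly Q (x i))\<^sup>2 * w x)"
    unfolding lebRn_def
  proof (rule bounded_fun_integrable[OF _ _ w])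
    have "(\<lambda>x. (poly Q (x i))\<^sup>2) \<in> borel_measurable (lebRn k)" by measurable
    then show "bounded_fun {..<k} R (\<lambda>x. (poly Q (x i))\<^sup>2)"
      unfolding bounded_fun_def lebRn_def using Kb i by auto
  qed simp
  have "(\<integral>x. (F x - m)\<^sup>2 * w x \<partial>lebRn k) \<le> (\<integral>x. 2 * ((poly Q (x i))\<^sup>2 * w x) + 2 * \<eta>\<^sup>2 * w x \<partial>lebRn k)"
  proof (rule integral_mono)
    show "integrable (lebRn k) (\<lambda>x. (F x - m)\<^sup>2 * w x)"
      unfolding lebRn_def by (rule bounded_fun_integrable[OF _ _ w], simp, rule bounded_fun_compose[OF F]) (intro continuous_intros)
    show "integrable (lebRn k) (\<lambda>x. 2 * ((poly Q (x i))\<^sup>2 * w x) + 2 * \<eta>\<^sup>2 * w x)"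
      by (intro Bochner_Integration.integrable_add integrable_mult_right qint wint)
    fix x assume "x \<in> space (lebRn k)"
    then have x: "x \<in> PiE {..<k} (\<lambda>_. UNIV)" by (simp add: lebRn_def space_PiM)
    show "(F x - m)\<^sup>2 * w x \<le> 2 * ((poly Q (x i))\<^sup>2 * w x) + 2 * \<eta>\<^sup>2 * w x"
    proof (cases "w x = 0")
      case False
      then have "\<bar>F x - poly P (x i)\<bar> \<le> \<eta>" using nd x unfolding needle_def by blast
      then have 1: "(F x - poly P (x i))\<^sup>2 \<le> \<eta>\<^sup>2" using power_mono[of "\<bar>F x - poly P (x i)\<bar>" \<eta> 2] by simp
      have "(F x - m)\<^sup>2 \<le> 2 * (poly Q (x i))\<^sup>2 + 2 * (F x - poly P (x i))\<^sup>2"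
        using zero_le_power2[of "poly Q (x i) - (F x - poly P (x i))"] unfolding Q(2) by (simp add: power2_eq_square algebra_simps)
      then have "(F x - m)\<^sup>2 * w x \<le> (2 * (poly Q (x i))\<^sup>2 + 2 * \<eta>\<^sup>2) * w x"
        using 1 nn[of x] by (intro mult_right_mono) auto
      then show ?thesis by (simp add: distrib_right mult.assoc)
    qed simp
  qed
  also have "\<dots> = 2 * (\<integral>x. (poly Q (x i))\<^sup>2 * w x \<partial>lebRn k) + 2 * \<eta>\<^sup>2"
    using qint wint m1 by simp
  also have "(\<integral>x. (poly Q (x i))\<^sup>2 * w x \<partial>lebRn k) = (\<integral>z. (poly Q z)\<^sup>2 * W z \<partial>lborel)"
    using Kb by (intro needle_integral[OF nd, where K = K]) auto
  finally show ?thesis using mom by simp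
qed

section \<open>From needles to densities supported in a box\<close>

lemma indicator_bounded_fun:
  assumes "{x \<in> space (lebRn k). Q x} \<in> sets (lebRn k)"
  shows "bounded_fun {..<k} R (\<lambda>x. indicat_real {x. Q x} x - q)"
proof -
  have "indicat_real {x. Q x} \<in> borel_measurable (PiM {..<k} (\<lambda>_. lborel))"
    using indicator_measurable_pred[OF assms] by (simp only: lebRn_def)
  then have "(\<lambda>x. indicat_real {x. Q x} x - q) \<in> borel_measurable (PiM {..<k} (\<lambda>_. lborel))" by measurable
  moreover have "\<bar>indicat_real {x. Q x} x - q\<bar> \<le> 1 + \<bar>q\<bar>" for x
    using abs_triangle_ineq4[of 1 q] by (auto simp: indicator_def)
  ultimately show ?thesis unfolding bounded_fun_def by blast
qed

text \<open>With this integrand as the function h of the localization, vanishing of the integral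
  says that Q has proportion q of the mass; bisection transmits the proportion to every
  cell.\<close>

lemma mass_constraint:
  assumes w: "box_function {..<k} R B w" and Q: "{x \<in> space (lebRn k). Q x} \<in> sets (lebRn k)"
  shows "(\<integral>x. (indicat_real {x. Q x} x - q) * w x \<partial>lebRn k) = mass_of k w Q - q * (\<integral>x. w x \<partial>lebRn k)"
proof -
  have wint: "integrable (lebRn k) w" unfolding lebRn_def by (rule box_function_integrable[OF _ w]) simp
  show ?thesis unfolding mass_of_def left_diff_distrib
    using wint mass_of_integrable[OF w Q] by simp
qed

lemma mass_of_not:
  assumes w: "box_function {..<k} R B w" and Q: "{x \<in> space (lebRn k). Q x} \<in> sets (lebRn k)"
  shows "mass_of k w (\<lambda>x. \<not> Q x) = (\<integral>x. w x \<partial>lebRn k) - mass_of k w Q"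
proof -
  have wint: "integrable (lebRn k) w" unfolding lebRn_def by (rule box_function_integrable[OF _ w]) simp
  have "mass_of k w (\<lambda>x. \<not> Q x) = (\<integral>x. w x - indicat_real {x. Q x} x * w x \<partial>lebRn k)"
    unfolding mass_of_def by (intro Bochner_Integration.integral_cong) (auto simp: indicator_def)
  then show ?thesis unfolding mass_of_def using wint mass_of_integrable[OF w Q] by simp
qed

text \<open>The constraint is that {F \<le> m} has proportion p: every needle inherits p and so has
  mass at least c on both sides of m. The difference of the two sides of the needle bound is a
  single integral against the density, so its sign passes from the needles to w. Afterwards \<eta>
  tends to 0.\<close>

theorem compact_oscillation:
  assumes k: "0 < k" and R: "0 \<le> R" and w: "box_function {..<k} R B w" "log_concave_on {..<k} w"
    and F: "poly_on_lines k d F" "box_lipschitz k F" and Fm[measurable]: "F \<in> borel_measurable (lebRn k)"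
    and E: "oscillation_constant d E" and d: "1 \<le> d" and t: "test_fun \<phi> D M" and M: "0 < M"
    and lip: "\<And>x y. \<bar>D x - D y\<bar> \<le> K * \<bar>x - y\<bar>" and c: "0 < c" "c \<le> 1 / 4"
    and tau: "0 < \<tau>" "\<tau> \<le> 1 / M" and pos: "0 < (\<integral>x. w x \<partial>lebRn k)"
    and q: "c * (\<integral>x. w x \<partial>lebRn k) \<le> mass_of k w (\<lambda>x. F x \<le> m)" "mass_of k w (\<lambda>x. F x \<le> m) \<le> (1 - c) * (\<integral>x. w x \<partial>lebRn k)"
  shows "(\<integral>x. D (F x) * w x \<partial>lebRn k)
    \<le> 4 * (1 + E * (1 + 32 / c\<^sup>2)) * M powr (1 - 1 / d) * (\<integral>x. kernel d \<tau> (F x - m) * w x \<partial>lebRn k)"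
proof -
  define m0 where "m0 = (\<integral>x. w x \<partial>lebRn k)"
  define C where "C = 4 * (1 + E * (1 + 32 / c\<^sup>2)) * M powr (1 - 1 / d)"
  define p where "p = mass_of k w (\<lambda>x. F x \<le> m) / m0"
  have p: "c \<le> p" "p \<le> 1 - c" using q pos by (auto simp: p_def m0_def field_simps)
  have Q: "{x \<in> space (lebRn k). F x \<le> m} \<in> sets (lebRn k)" by measurable
  have K0: "0 \<le> K" using lip[of 1 0] by (metis abs_ge_zero abs_one diff_zero mult.right_neutral order_trans)
  have Dc: "continuous_on UNIV D" using t by (simp add: test_fun_def)
  have kc: "continuous_on UNIV (\<lambda>s. kernel d \<tau> (s - m))"
    unfolding kernel_def using tau by (intro continuous_intros) (auto simp: max_def)
  have wint: "integrable (lebRn k) v" if "box_function {..<k} R B' v" for v B'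
    unfolding lebRn_def by (rule box_function_integrable[OF _ that]) simp
  have i1: "integrable (lebRn k) (\<lambda>x. D (F x) * v x)" if "box_function {..<k} R B' v" for v B'
    unfolding lebRn_def by (rule bounded_fun_integrable[OF _ bounded_fun_compose[OF F(2) Fm Dc] that]) simp
  have i2: "integrable (lebRn k) (\<lambda>x. kernel d \<tau> (F x - m) * v x)" if "box_function {..<k} R B' v" for v B'
    unfolding lebRn_def by (rule bounded_fun_integrable[OF _ bounded_fun_compose[OF F(2) Fm kc] that]) simp
  have lin: "(\<integral>x. (D (F x) - C * kernel d \<tau> (F x - m) - a) * v x \<partial>lebRn k)
     = (\<integral>x. D (F x) * v x \<partial>lebRn k) - C * (\<integral>x. kernel d \<tau> (F x - m) * v x \<partial>lebRn k) - a * (\<integral>x. v x \<partial>lebRn k)"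
    if v: "box_function {..<k} R B' v" for v B' a
    unfolding left_diff_distrib mult.assoc using i1[OF v] i2[OF v] wint[OF v] by simp
  have approx: "(\<integral>x. D (F x) * w x \<partial>lebRn k) \<le> C * (\<integral>x. kernel d \<tau> (F x - m) * w x \<partial>lebRn k) + K * \<eta> * m0"
    if eta: "0 < \<eta>" "\<eta> \<le> \<tau> / 4" for \<eta>
  proof -
    have "(\<integral>x. (D (F x) - C * kernel d \<tau> (F x - m) - K * \<eta>) * w x \<partial>lebRn k) \<le> 0"
    proof (rule localization[OF k R w F eta(1) indicator_bounded_fun[OF Q, of _ p]])
      show "bounded_fun {..<k} R (\<lambda>x. D (F x) - C * kernel d \<tau> (F x - m) - K * \<eta>)"
        by (rule bounded_fun_compose[OF F(2) Fm]) (intro continuous_intros Dc kc)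
      show "(\<integral>x. (indicat_real {x. F x \<le> m} x - p) * w x \<partial>lebRn k) = 0"
        unfolding mass_constraint[OF w(1) Q] using pos by (simp add: p_def m0_def)
      fix w' i P W
      assume nd: "needle k d F R \<eta> w' i P W" and z: "(\<integral>x. (indicat_real {x. F x \<le> m} x - p) * w' x \<partial>lebRn k) = 0"
      obtain B' where w': "box_function {..<k} R B' w'" using nd by (auto simp: needle_def)
      have m1: "(\<integral>x. w' x \<partial>lebRn k) = 1" using nd by (simp add: needle_def)
      have lo: "mass_of k w' (\<lambda>x. F x \<le> m) = p" using z mass_constraint[OF w' Q, of p] m1 by simp
      have "1 - p = mass_of k w' (\<lambda>x. \<not> F x \<le> m)" using mass_of_not[OF w' Q] lo m1 by simp
      also have "\<dots> \<le> mass_of k w' (\<lambda>x. m \<le> F x)" by (rule mass_of_mono[OF w']) auto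
      finally have "c \<le> mass_of k w' (\<lambda>x. m \<le> F x)" using p by simp
      then have "(\<integral>x. D (F x) * w' x \<partial>lebRn k) \<le> C * (\<integral>x. kernel d \<tau> (F x - m) * w' x \<partial>lebRn k) + K * \<eta>"
        unfolding C_def using needle_oscillation_bound[OF nd Fm E d t M lip c tau eta] lo p by simp
      then show "(\<integral>x. (D (F x) - C * kernel d \<tau> (F x - m) - K * \<eta>) * w' x \<partial>lebRn k) \<le> 0"
        unfolding lin[OF w'] using m1 by simp
    qed
    then show ?thesis unfolding lin[OF w(1)] by (simp add: m0_def)
  qed
  have "(\<integral>x. D (F x) * w x \<partial>lebRn k) \<le> C * (\<integral>x. kernel d \<tau> (F x - m) * w x \<partial>lebRn k)"
  proof (rule field_le_epsilon)
    fix e :: real assume e: "0 < e"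
    have den: "0 < K * m0 + 1" using K0 pos by (simp add: m0_def add_nonneg_pos)
    \<comment> \<open>Small enough for the needle bound and for an error of at most e; the summand 1
      guards against a vanishing denominator.\<close>
    define \<eta> where "\<eta> = min (\<tau> / 4) (e / (K * m0 + 1))"
    have eta: "0 < \<eta>" "\<eta> \<le> \<tau> / 4" "\<eta> \<le> e / (K * m0 + 1)"
      unfolding \<eta>_def using tau e den by (simp_all only: min.cobounded1 min.cobounded2) simp
    then have "\<eta> * (K * m0 + 1) \<le> e" using den by (simp add: pos_le_divide_eq)
    then have "K * \<eta> * m0 \<le> e" using eta(1) by (simp add: algebra_simps)
    then show "(\<integral>x. D (F x) * w x \<partial>lebRn k) \<le> C * (\<integral>x. kernel d \<tau> (F x - m) * w x \<partial>lebRn k) + e"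
      using approx[OF eta(1,2)] by linarith
  qed
  then show ?thesis by (simp add: C_def)
qed

text \<open>The same scheme, with the proportion of {|F - m| \<le> r} as the constraint. The needle
  bound is continuous in \<eta>, so a one-sided limit removes it.\<close>

theorem compact_second_moment:
  assumes k: "0 < k" and R: "0 \<le> R" and w: "box_function {..<k} R B w" "log_concave_on {..<k} w"
    and F: "poly_on_lines k d F" "box_lipschitz k F" and Fm[measurable]: "F \<in> borel_measurable (lebRn k)"
    and E: "oscillation_constant d E" and d: "1 \<le> d" and c: "0 < c" "c \<le> 1" and r: "0 \<le> r"
    and pos: "0 < (\<integral>x. w x \<partial>lebRn k)"
    and q: "c * (\<integral>x. w x \<partial>lebRn k) \<le> mass_of k w (\<lambda>x. \<bar>F x - m\<bar> \<le> r)"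
  shows "(\<integral>x. (F x - m)\<^sup>2 * w x \<partial>lebRn k) \<le> 2 * moment_constant d E c * r\<^sup>2 * (\<integral>x. w x \<partial>lebRn k)"
proof -
  define m0 where "m0 = (\<integral>x. w x \<partial>lebRn k)"
  define C where "C = 2 * moment_constant d E c"
  have C0: "0 < C" using moment_constant_pos by (simp add: C_def)
  define p where "p = mass_of k w (\<lambda>x. \<bar>F x - m\<bar> \<le> r) / m0"
  have p: "c \<le> p" using q pos by (auto simp: p_def m0_def field_simps)
  have Q: "{x \<in> space (lebRn k). \<bar>F x - m\<bar> \<le> r} \<in> sets (lebRn k)" by measurable
  have gc: "continuous_on UNIV (\<lambda>s::real. (s - m)\<^sup>2 - a)" for a by (intro continuous_intros)
  have wint: "integrable (lebRn k) v" if "box_function {..<k} R B' v" for v B'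
    unfolding lebRn_def by (rule box_function_integrable[OF _ that]) simp
  have i1: "integrable (lebRn k) (\<lambda>x. (F x - m)\<^sup>2 * v x)" if "box_function {..<k} R B' v" for v B'
    unfolding lebRn_def using bounded_fun_integrable[OF _ bounded_fun_compose[OF F(2) Fm gc[of 0]] that] by simp
  have lin: "(\<integral>x. ((F x - m)\<^sup>2 - a) * v x \<partial>lebRn k) = (\<integral>x. (F x - m)\<^sup>2 * v x \<partial>lebRn k) - a * (\<integral>x. v x \<partial>lebRn k)"
    if v: "box_function {..<k} R B' v" for v B' a
    unfolding left_diff_distrib using i1[OF v] wint[OF v] by simp
  have approx: "(\<integral>x. (F x - m)\<^sup>2 * w x \<partial>lebRn k) \<le> (C * (r + \<eta>)\<^sup>2 + 2 * \<eta>\<^sup>2) * m0" if eta: "0 < \<eta>" for \<eta>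
  proof -
    have "(\<integral>x. ((F x - m)\<^sup>2 - (C * (r + \<eta>)\<^sup>2 + 2 * \<eta>\<^sup>2)) * w x \<partial>lebRn k) \<le> 0"
    proof (rule localization[OF k R w F eta indicator_bounded_fun[OF Q, of _ p]])
      show "bounded_fun {..<k} R (\<lambda>x. (F x - m)\<^sup>2 - (C * (r + \<eta>)\<^sup>2 + 2 * \<eta>\<^sup>2))"
        by (rule bounded_fun_compose[OF F(2) Fm gc])
      show "(\<integral>x. (indicat_real {x. \<bar>F x - m\<bar> \<le> r} x - p) * w x \<partial>lebRn k) = 0"
        unfolding mass_constraint[OF w(1) Q] using pos by (simp add: p_def m0_def)
      fix w' i P W
      assume nd: "needle k d F R \<eta> w' i P W" and z: "(\<integral>x. (indicat_real {x. \<bar>F x - m\<bar> \<le> r} x - p) * w' x \<partial>lebRn k) = 0"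
      obtain B' where w': "box_function {..<k} R B' w'" using nd by (auto simp: needle_def)
      have m1: "(\<integral>x. w' x \<partial>lebRn k) = 1" using nd by (simp add: needle_def)
      have "mass_of k w' (\<lambda>x. \<bar>F x - m\<bar> \<le> r) = p" using z mass_constraint[OF w' Q, of p] m1 by simp
      then have "(\<integral>x. (F x - m)\<^sup>2 * w' x \<partial>lebRn k) \<le> C * (r + \<eta>)\<^sup>2 + 2 * \<eta>\<^sup>2"
        unfolding C_def using p by (intro needle_second_moment_bound[OF nd F(2) Fm E d c r eta]) simp
      then show "(\<integral>x. ((F x - m)\<^sup>2 - (C * (r + \<eta>)\<^sup>2 + 2 * \<eta>\<^sup>2)) * w' x \<partial>lebRn k) \<le> 0"
        unfolding lin[OF w'] using m1 by simp
    qed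
    then show ?thesis unfolding lin[OF w(1)] by (simp add: m0_def)
  qed
  have "((\<lambda>\<eta>. (C * (r + \<eta>)\<^sup>2 + 2 * \<eta>\<^sup>2) * m0) \<longlongrightarrow> (C * (r + 0)\<^sup>2 + 2 * 0\<^sup>2) * m0) (at_right 0)"
    by (intro tendsto_intros)
  then have "(\<integral>x. (F x - m)\<^sup>2 * w x \<partial>lebRn k) \<le> (C * (r + 0)\<^sup>2 + 2 * 0\<^sup>2) * m0"
    by (rule tendsto_lowerbound) (auto intro!: eventually_at_right_less eventually_mono[OF eventually_at_right_less] approx)
  then show ?thesis by (simp add: C_def m0_def)
qed

section \<open>Borel versions of log-concave densities\<close>

text \<open>Continuous images of Borel sets need not be Borel, whereas this class is stable under
  continuous images and countable unions. Superlevel sets of a supremum of geometric means will be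
  such images.\<close>

definition sigma_compact :: "'a::topological_space set \<Rightarrow> bool" where
  "sigma_compact S \<longleftrightarrow> (\<exists>\<C>. countable \<C> \<and> (\<forall>C\<in>\<C>. compact C) \<and> S = \<Union>\<C>)"

lemma sigma_compact_UN:
  assumes "countable I" "\<And>i. i \<in> I \<Longrightarrow> sigma_compact (S i)"
  shows "sigma_compact (\<Union>i\<in>I. S i)"
proof -
  have "\<forall>i\<in>I. \<exists>\<C>. countable \<C> \<and> (\<forall>C\<in>\<C>. compact C) \<and> S i = \<Union>\<C>"
    using assms(2) by (simp add: sigma_compact_def)
  then obtain F where F: "\<And>i. i \<in> I \<Longrightarrow> countable (F i) \<and> (\<forall>C\<in>F i. compact C) \<and> S i = \<Union>(F i)" by metis
  show ?thesis unfolding sigma_compact_def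
    using assms(1) F by (intro exI[of _ "\<Union>i\<in>I. F i"]) auto
qed

lemma compact_imp_sigma_compact: "compact C \<Longrightarrow> sigma_compact C"
  unfolding sigma_compact_def by (intro exI[of _ "{C}"]) auto

lemma sigma_compact_Un: "sigma_compact S \<Longrightarrow> sigma_compact T \<Longrightarrow> sigma_compact (S \<union> T)"
  using sigma_compact_UN[of "UNIV :: bool set" "\<lambda>b. if b then S else T"] by (simp add: UNIV_bool Un_commute)

lemma sigma_compact_image:
  assumes J: "compact J" and S: "sigma_compact S" and T: "sigma_compact T"
    and f: "continuous_on UNIV f"
  shows "sigma_compact (f ` (J \<times> S \<times> T))"
proof -
  obtain C where C: "countable C" "\<forall>c\<in>C. compact c" "S = \<Union>C" using S by (auto simp: sigma_compact_def)
  obtain D where D: "countable D" "\<forall>c\<in>D. compact c" "T = \<Union>D" using T by (auto simp: sigma_compact_def)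
  have "f ` (J \<times> S \<times> T) = (\<Union>(c, d)\<in>C \<times> D. f ` (J \<times> c \<times> d))" unfolding C(3) D(3) by auto
  moreover have "sigma_compact \<dots>"
    using C D J by (intro sigma_compact_UN)
      (auto intro!: compact_imp_sigma_compact compact_continuous_image compact_Times continuous_on_subset[OF f])
  ultimately show ?thesis by simp
qed

lemma sigma_compact_borel: "sigma_compact (S :: (nat \<Rightarrow> real) set) \<Longrightarrow> S \<in> sets borel"
  unfolding sigma_compact_def by (auto intro!: sets.countable_Union simp: borel_compact subset_iff)

lemma lin_comb_continuous:
  "continuous_on UNIV (\<lambda>(t, x, y). lin_comb I t x y)"
proof -
  have "continuous_on UNIV (\<lambda>p. lin_comb I (fst p) (fst (snd p)) (snd (snd p)) j)" for j
  proof (cases "j \<in> I")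
    case True
    have c: "continuous_on UNIV (\<lambda>p :: real \<times> (nat \<Rightarrow> real) \<times> (nat \<Rightarrow> real). fst (snd p) j)"
      "continuous_on UNIV (\<lambda>p :: real \<times> (nat \<Rightarrow> real) \<times> (nat \<Rightarrow> real). snd (snd p) j)"
      by (rule continuous_on_product_then_coordinatewise, intro continuous_intros)+
    show ?thesis using True by (auto simp: lin_comb_def intro!: continuous_intros c)
  qed (simp add: lin_comb_def)
  then show ?thesis unfolding case_prod_beta' by (intro continuous_on_coordinatewise_then_product) auto
qed

text \<open>Points of the product space are \<open>undefined\<close> off \<open>{..<k}\<close>.
  Viewing them in the Polish space of all functions makes inner regularity by compact sets
  available.\<close>

lemma lebRn_id_measurable: "(\<lambda>x. x) \<in> measurable (lebRn k) (borel :: (nat \<Rightarrow> real) measure)"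
proof -
  have "(\<lambda>x. x) \<in> measurable (lebRn k) (PiM UNIV (\<lambda>_. borel :: real measure))"
  proof (rule measurable_PiM_single')
    fix j :: nat
    show "(\<lambda>x. x j) \<in> borel_measurable (lebRn k)"
    proof (cases "j < k")
      case True
      then show ?thesis unfolding lebRn_def
        by (auto intro: measurable_component_singleton[where M = "\<lambda>_. lborel :: real measure", simplified])
    next
      case False
      have "(\<lambda>x. undefined :: real) \<in> borel_measurable (lebRn k)" by simp
      then show ?thesis
        by (rule measurable_cong[THEN iffD1, rotated]) (use False in \<open>auto simp: lebRn_def space_PiM PiE_iff extensional_def\<close>)
    qed
  qed auto
  then show ?thesis using measurable_cong_sets[OF refl sets_PiM_equal_borel] by blast
qed

text \<open>A measurable set of the product space is its preimage under restriction, intersected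
  with the closed set of functions that are \<open>undefined\<close> off
  \<open>{..<k}\<close>.\<close>

lemma lebRn_sets_borel:
  assumes "A \<in> sets (lebRn k)"
  shows "A \<in> sets (borel :: (nat \<Rightarrow> real) measure)"
proof -
  have comp: "(\<lambda>x :: nat \<Rightarrow> real. x j) \<in> borel_measurable borel" for j
    by (intro borel_measurable_continuous_onI continuous_on_product_coordinates)
  have "(\<lambda>x. restrict x {..<k}) \<in> measurable (borel :: (nat \<Rightarrow> real) measure) (PiM {..<k} (\<lambda>_. lborel :: real measure))"
    by (rule measurable_restrict) (use comp in simp)
  then have r: "(\<lambda>x. restrict x {..<k}) -` A \<inter> space borel \<in> sets borel"
    using assms by (intro measurable_sets[of _ borel "lebRn k"]) (simp_all add: lebRn_def)
  have "closed {x :: nat \<Rightarrow> real. x j = undefined}" for j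
    by (intro closed_Collect_eq continuous_on_product_coordinates continuous_on_const)
  then have "closed (\<Inter>j\<in>{k..}. {x :: nat \<Rightarrow> real. x j = undefined})" by blast
  then have V: "(\<Inter>j\<in>{k..}. {x :: nat \<Rightarrow> real. x j = undefined}) \<in> sets borel" by simp
  have "A \<subseteq> PiE {..<k} (\<lambda>_. UNIV)" using sets.sets_into_space[OF assms] by (simp add: lebRn_def space_PiM)
  have "A = (\<lambda>x. restrict x {..<k}) -` A \<inter> (\<Inter>j\<in>{k..}. {x. x j = undefined})"
  proof (intro set_eqI iffI)
    fix x assume "x \<in> A"
    moreover from this have "x \<in> PiE {..<k} (\<lambda>_. UNIV)" using \<open>A \<subseteq> _\<close> by blast
    moreover from this have "restrict x {..<k} = x" by (simp add: PiE_iff extensional_restrict)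
    ultimately show "x \<in> (\<lambda>x. restrict x {..<k}) -` A \<inter> (\<Inter>j\<in>{k..}. {x. x j = undefined})"
      by (auto simp: PiE_iff extensional_def extensional_restrict)
  next
    fix x assume x: "x \<in> (\<lambda>x. restrict x {..<k}) -` A \<inter> (\<Inter>j\<in>{k..}. {x. x j = undefined})"
    then have "restrict x {..<k} = x" by (auto simp: fun_eq_iff restrict_def)
    then show "x \<in> A" using x by simp
  qed
  also have "\<dots> \<in> sets borel" using r V by simp
  finally show ?thesis .
qed

text \<open>The measure restricted to A is finite, so compact subsets of A exhaust its mass, and
  countably many of them suffice.\<close>

lemma inner_sigma_compact:
  assumes A: "A \<in> sets (lebRn k)" "emeasure (lebRn k) A < \<infinity>"
  obtains S where "sigma_compact S" "S \<subseteq> A" "S \<in> sets (lebRn k)" "A - S \<in> null_sets (lebRn k)"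
proof -
  define N where "N = distr (density (lebRn k) (indicator A)) (borel :: (nat \<Rightarrow> real) measure) (\<lambda>x. x)"
  have idm: "(\<lambda>x. x) \<in> measurable (density (lebRn k) (indicator A)) (borel :: (nat \<Rightarrow> real) measure)"
    using lebRn_id_measurable by simp
  have sN: "sets N = sets borel" by (simp add: N_def)
  have inN: "B \<inter> space (lebRn k) \<in> sets (lebRn k)" if "B \<in> sets borel" for B
    using measurable_sets[OF lebRn_id_measurable that] by (simp add: vimage_def Int_def)
  have eN: "emeasure N B = emeasure (lebRn k) (A \<inter> B)" if "B \<in> sets borel" for B
  proof -
    have "emeasure N B = emeasure (density (lebRn k) (indicator A)) (B \<inter> space (lebRn k))"
      unfolding N_def using that idm by (subst emeasure_distr) (auto simp: vimage_def Int_def)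
    also have "\<dots> = emeasure (lebRn k) (A \<inter> (B \<inter> space (lebRn k)))"
      using A inN[OF that] by (subst emeasure_density) (auto simp: indicator_inter_arith[symmetric])
    also have "A \<inter> (B \<inter> space (lebRn k)) = A \<inter> B" using sets.sets_into_space[OF A(1)] by auto
    finally show ?thesis .
  qed
  have Ab: "A \<in> sets borel" using A(1) by (rule lebRn_sets_borel)
  have fin: "emeasure N (space N) \<noteq> \<infinity>" using A(2) eN[of UNIV] by (simp add: N_def)
  have "emeasure N A = (SUP K\<in>{K. K \<subseteq> A \<and> compact K}. emeasure N K)"
    by (rule inner_regular[OF sN fin Ab])
  moreover have "{K. K \<subseteq> A \<and> compact K} \<noteq> {}" by (auto intro!: exI[of _ "{}"])
  ultimately obtain f :: "nat \<Rightarrow> ennreal" where f: "range f \<subseteq> emeasure N ` {K. K \<subseteq> A \<and> compact K}" "emeasure N A = (SUP n. f n)"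
    using ennreal_Sup_countable_SUP[of "emeasure N ` {K. K \<subseteq> A \<and> compact K}"] by auto
  have "\<forall>n. \<exists>K. K \<subseteq> A \<and> compact K \<and> f n = emeasure N K"
  proof
    fix n
    have "f n \<in> emeasure N ` {K. K \<subseteq> A \<and> compact K}" using f(1) by (simp add: image_subset_iff)
    then show "\<exists>K. K \<subseteq> A \<and> compact K \<and> f n = emeasure N K" by blast
  qed
  then obtain K where K: "\<And>n. K n \<subseteq> A" "\<And>n. compact (K n)" "\<And>n. f n = emeasure N (K n)" by metis
  define S where "S = (\<Union>n. K n)"
  have Kb: "K n \<in> sets borel" for n using K(2) by (simp add: borel_compact)
  have Sb: "S \<in> sets borel" unfolding S_def using Kb by auto
  have SA: "S \<subseteq> A" using K by (auto simp: S_def)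
  have Sl: "S \<in> sets (lebRn k)"
    using inN[OF Sb] SA sets.sets_into_space[OF A(1)] by (simp add: Int_absorb2 subset_trans)
  show ?thesis
  proof (rule that[of S])
    show "sigma_compact S" unfolding sigma_compact_def S_def using K by (intro exI[of _ "range K"]) auto
    have "emeasure (lebRn k) A = emeasure N A" using eN[OF Ab] by simp
    also have "\<dots> \<le> emeasure N S" unfolding f(2) K(3) by (intro SUP_least emeasure_mono) (use Sb in \<open>auto simp: S_def sN\<close>)
    also have "\<dots> = emeasure (lebRn k) S" using eN[OF Sb] SA by (simp add: Int_absorb1)
    finally have le: "emeasure (lebRn k) A \<le> emeasure (lebRn k) S" .
    have "emeasure (lebRn k) S \<le> emeasure (lebRn k) A" using SA A by (intro emeasure_mono) auto
    then have "emeasure (lebRn k) (A - S) = emeasure (lebRn k) A - emeasure (lebRn k) S"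
      using A Sl SA by (intro emeasure_Diff) (auto simp: top_unique less_top)
    also have "\<dots> = 0" using le A(2) by (simp add: diff_eq_0_iff_ennreal)
    finally show "A - S \<in> null_sets (lebRn k)" using A Sl by (auto simp: null_sets_def)
  qed (use SA Sl in auto)
qed

section \<open>Log-concave hull of a minorant\<close>

text \<open>The invariant of the construction below: v is Borel through its superlevel sets, and
  domination by w keeps the iteration bounded at each point.\<close>

definition sigma_compact_minorant :: "nat \<Rightarrow> ((nat \<Rightarrow> real) \<Rightarrow> real) \<Rightarrow> ((nat \<Rightarrow> real) \<Rightarrow> real) \<Rightarrow> bool" where
  "sigma_compact_minorant k w v \<longleftrightarrow> (\<forall>x. 0 \<le> v x) \<and> (\<forall>x. x \<notin> PiE {..<k} (\<lambda>_. UNIV) \<longrightarrow> v x = 0) \<and>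
     (\<forall>x\<in>PiE {..<k} (\<lambda>_. UNIV). v x \<le> w x) \<and> (\<forall>s\<ge>0. sigma_compact {x. s < v x})"

text \<open>Rational data turn the superlevel set of a supremum over all x, y and t into a countable
  union. The parameter t is enclosed in a closed interval inside (0, 1), so that the image is taken
  over a compact set of parameters.\<close>

lemma rational_geometric_mean:
  fixes s t p q :: real
  assumes s: "0 \<le> s" and t: "0 < t" "t < 1" and pq: "0 \<le> p" "0 \<le> q" "s < p powr t * q powr (1 - t)"
  obtains a b c e where "a \<in> \<rat>" "b \<in> \<rat>" "c \<in> \<rat>" "e \<in> \<rat>" "0 < a" "a < p" "0 < b" "b < q" "0 < c" "c \<le> t" "t \<le> e" "e < 1"
    "\<forall>\<tau>\<in>{c..e}. s < a powr \<tau> * b powr (1 - \<tau>)"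
proof -
  define G where "G = p powr t * q powr (1 - t)"
  have G: "0 < G" "s < G" using s pq by (auto simp: G_def)
  then have p: "0 < p" "0 < q" using pq by (auto simp: G_def less_le)
  \<comment> \<open>Shrinking both factors by \<theta> shrinks their mean by \<theta>; this value
    leaves it halfway between s and G.\<close>
  define \<theta> where "\<theta> = (s / G + 1) / 2"
  have th: "0 < \<theta>" "\<theta> < 1" "s < \<theta> * G" using G s by (auto simp: \<theta>_def field_simps)
  obtain a where a: "a \<in> \<rat>" "\<theta> * p < a" "a < p" using Rats_dense_in_real[of "\<theta> * p" p] th p by auto
  obtain b where b: "b \<in> \<rat>" "\<theta> * q < b" "b < q" using Rats_dense_in_real[of "\<theta> * q" q] th p by auto
  have a0: "0 < a" "0 < b" using a b th p by (meson less_trans mult_pos_pos)+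
  have "s < \<theta> * G" by (rule th)
  also have "\<dots> = (\<theta> * p) powr t * (\<theta> * q) powr (1 - t)"
  proof -
    have "\<theta> = \<theta> powr t * \<theta> powr (1 - t)" using th by (simp flip: powr_add)
    then show ?thesis using th p by (simp add: powr_mult G_def)
  qed
  also have "\<dots> \<le> a powr t * b powr (1 - t)" using a b th p t by (intro mult_mono powr_mono2) auto
  finally have st: "s < a powr t * b powr (1 - t)" .
  define U where "U = {\<tau>. s < a powr \<tau> * b powr (1 - \<tau>)} \<inter> {0<..<1}"
  have "open {\<tau>. s < a powr \<tau> * b powr (1 - \<tau>)}"
    using a0 by (intro open_Collect_less continuous_intros) auto
  then have "open U" unfolding U_def by auto
  moreover have "t \<in> U" using st t by (simp add: U_def)
  ultimately obtain \<epsilon> where ep: "0 < \<epsilon>" "\<And>y. dist y t < \<epsilon> \<Longrightarrow> y \<in> U" by (meson open_dist)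
  obtain c where c: "c \<in> \<rat>" "t - \<epsilon> < c" "c < t" using Rats_dense_in_real[of "t - \<epsilon>" t] ep by auto
  obtain e where e: "e \<in> \<rat>" "t < e" "e < t + \<epsilon>" using Rats_dense_in_real[of t "t + \<epsilon>"] ep by auto
  have sub: "\<tau> \<in> U" if "\<tau> \<in> {c..e}" for \<tau> using that c e by (intro ep(2)) (auto simp: dist_real_def)
  have "c \<in> U" "e \<in> U" using sub c e by auto
  then show ?thesis using sub a b c e a0 by (intro that[of a b c e]) (auto simp: U_def)
qed

text \<open>v' is the supremum of the geometric means of v over all pairs that combine to z. It
  stays below w because w is log-concave, and its superlevel sets are countable unions of continuous
  images of sigma-compact sets.\<close>

lemma concavify_step:
  assumes w: "log_concave_on {..<k} w" and v: "sigma_compact_minorant k w v"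
  shows "\<exists>v'. sigma_compact_minorant k w v' \<and> (\<forall>x. v x \<le> v' x) \<and>
    (\<forall>t x y. 0 < t \<longrightarrow> t < 1 \<longrightarrow> x \<in> PiE {..<k} (\<lambda>_. UNIV) \<longrightarrow> y \<in> PiE {..<k} (\<lambda>_. UNIV) \<longrightarrow>
       v x powr t * v y powr (1 - t) \<le> v' (lin_comb {..<k} t x y))"
proof -
  let ?V = "PiE {..<k} (\<lambda>_. UNIV) :: (nat \<Rightarrow> real) set"
  have nn: "0 \<le> v x" and out: "x \<notin> ?V \<Longrightarrow> v x = 0" and le: "x \<in> ?V \<Longrightarrow> v x \<le> w x"
    and sc: "0 \<le> s \<Longrightarrow> sigma_compact {x. s < v x}" for x s
    using v by (auto simp: sigma_compact_minorant_def)
  \<comment> \<open>Inserting v(z) makes the step increasing, and the set nonempty also off the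
    product space.\<close>
  define A where "A = (\<lambda>z. insert (v z) {v x powr t * v y powr (1 - t) | x y t. x \<in> ?V \<and> y \<in> ?V \<and> 0 < t \<and> t < 1 \<and> lin_comb {..<k} t x y = z})"
  define v' where "v' = (\<lambda>z. Sup (A z))"
  have ub: "a \<le> (if z \<in> ?V then w z else 0)" if a: "a \<in> A z" for a z
  proof -
    consider "a = v z" | x y t where "a = v x powr t * v y powr (1 - t)" "x \<in> ?V" "y \<in> ?V" "0 < t" "t < 1" "lin_comb {..<k} t x y = z"
      using a by (auto simp: A_def)
    then show ?thesis
    proof cases
      case 1 then show ?thesis using le[of z] out[of z] by auto
    next
      case (2 x y t)
      have "a \<le> w x powr t * w y powr (1 - t)"
        unfolding 2(1) using 2 le nn by (intro mult_mono powr_mono2) (auto intro: order_trans[OF nn le])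
      also have "\<dots> \<le> w z" using w 2 unfolding log_concave_on_def by blast
      moreover have "z \<in> ?V" using 2 lin_comb_range[of "{..<k}" t x y] by auto
      ultimately show ?thesis by auto
    qed
  qed
  have bdd: "bdd_above (A z)" for z using ub by (auto intro!: bdd_aboveI)
  have ne: "A z \<noteq> {}" for z by (auto simp: A_def)
  have memb: "a \<le> v' z" if "a \<in> A z" for a z unfolding v'_def using that bdd by (intro cSup_upper)
  have v'le: "v' z \<le> (if z \<in> ?V then w z else 0)" for z unfolding v'_def using ne ub by (intro cSup_least)
  have mix: "v x powr t * v y powr (1 - t) \<le> v' (lin_comb {..<k} t x y)"
    if "0 < t" "t < 1" "x \<in> ?V" "y \<in> ?V" for t x y
    by (rule memb) (unfold A_def, use that in blast)
  have vv': "v x \<le> v' x" for x by (rule memb) (simp add: A_def)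
  have Phi: "continuous_on UNIV (\<lambda>(t, x, y). lin_comb {..<k} t x y)" by (rule lin_comb_continuous)
  have sc': "sigma_compact {z. s < v' z}" if s: "0 \<le> s" for s
  proof -
    define Q where "Q = {(a, b, c, e). a \<in> \<rat> \<and> b \<in> \<rat> \<and> c \<in> \<rat> \<and> e \<in> \<rat> \<and> 0 < a \<and> 0 < b \<and> 0 < c \<and> e < 1 \<and> (\<forall>\<tau>\<in>{c..e}. s < a powr \<tau> * b powr (1 - \<tau>))}"
    have cQ: "countable Q"
      by (rule countable_subset[of _ "\<rat> \<times> \<rat> \<times> \<rat> \<times> \<rat>"]) (auto simp: Q_def intro!: countable_SIGMA countable_rat)
    define img where "img = (\<lambda>(a, b, c, e). (\<lambda>(t, x, y). lin_comb {..<k} t x y) ` ({c..e} \<times> {x. a < v x} \<times> {x. b < v x}))"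
    have "{z. s < v' z} = {z. s < v z} \<union> (\<Union>i\<in>Q. img i)"
    proof (intro set_eqI iffI)
      fix z assume "z \<in> {z. s < v' z}"
      then obtain a where a: "a \<in> A z" "s < a" unfolding v'_def using less_cSup_iff[OF ne bdd] by auto
      then consider "a = v z" | x y t where "a = v x powr t * v y powr (1 - t)" "x \<in> ?V" "y \<in> ?V" "0 < t" "t < 1" "lin_comb {..<k} t x y = z"
        by (auto simp: A_def)
      then show "z \<in> {z. s < v z} \<union> (\<Union>i\<in>Q. img i)"
      proof cases
        case (2 x y t)
        then have "s < v x powr t * v y powr (1 - t)" using a by simp
        then obtain p q c e where pq: "p \<in> \<rat>" "q \<in> \<rat>" "c \<in> \<rat>" "e \<in> \<rat>" "0 < p" "p < v x" "0 < q" "q < v y"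
          and ce: "0 < c" "c \<le> t" "t \<le> e" "e < 1" "\<forall>\<tau>\<in>{c..e}. s < p powr \<tau> * q powr (1 - \<tau>)"
          by (rule rational_geometric_mean[OF s 2(4,5) nn nn])
        have "(p, q, c, e) \<in> Q" unfolding Q_def using pq ce by simp
        moreover have "z \<in> img (p, q, c, e)"
          unfolding img_def prod.case by (rule image_eqI[of _ _ "(t, x, y)"]) (use 2(6) pq ce in simp_all)
        ultimately have "(p, q, c, e) \<in> Q \<and> z \<in> img (p, q, c, e)" ..
        then show ?thesis by blast
      qed (use a in auto)
    next
      fix z assume "z \<in> {z. s < v z} \<union> (\<Union>i\<in>Q. img i)"
      then consider "s < v z" | p q c e where "(p, q, c, e) \<in> Q" "z \<in> img (p, q, c, e)" by auto
      then show "z \<in> {z. s < v' z}"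
      proof cases
        case 1 then show ?thesis using vv'[of z] by simp
      next
        case (2 p q c e)
        then obtain t x y where z: "z = lin_comb {..<k} t x y" "t \<in> {c..e}" "p < v x" "q < v y" by (auto simp: img_def)
        have Q: "0 < p" "0 < q" "0 < c" "e < 1" "s < p powr t * q powr (1 - t)" using 2(1) z(2) by (auto simp: Q_def)
        have V: "x \<in> ?V" "y \<in> ?V" using z Q out by force+
        have t: "0 < t" "t < 1" using z Q by auto
        have "s < p powr t * q powr (1 - t)" by (rule Q)
        also have "\<dots> \<le> v x powr t * v y powr (1 - t)" using z Q t by (intro mult_mono powr_mono2) auto
        also have "\<dots> \<le> v' z" unfolding z(1) by (rule mix[OF t V])
        finally show ?thesis by simp
      qed
    qed
    moreover have "sigma_compact (\<Union>i\<in>Q. img i)"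
    proof (rule sigma_compact_UN[OF cQ])
      fix i assume "i \<in> Q"
      then obtain p q c e where i: "i = (p, q, c, e)" "0 < p" "0 < q" by (auto simp: Q_def)
      show "sigma_compact (img i)" unfolding i img_def prod.case
        using i by (intro sigma_compact_image Phi sc) auto
    qed
    ultimately show ?thesis using sc[OF s] by (simp add: sigma_compact_Un)
  qed
  have "sigma_compact_minorant k w v'"
    unfolding sigma_compact_minorant_def
  proof (intro conjI allI ballI impI)
    show "0 \<le> v' x" for x using vv'[of x] nn[of x] by linarith
    show "v' x = 0" if "x \<notin> ?V" for x using v'le[of x] vv'[of x] nn[of x] that by simp
    show "v' x \<le> w x" if "x \<in> ?V" for x using v'le[of x] that by simp
  qed (rule sc')
  then show ?thesis using vv' mix by blast
qed

text \<open>One step bounds the means of v by v' instead of v, so it is iterated. In the increasing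
  limit the inequality between consecutive terms becomes log-concavity, and superlevel sets are
  again countable unions.\<close>

lemma concavify:
  assumes w: "log_concave_on {..<k} w" and v: "sigma_compact_minorant k w v"
  obtains v' where "sigma_compact_minorant k w v'" "\<And>x. v x \<le> v' x" "log_concave_on {..<k} v'"
proof -
  let ?V = "PiE {..<k} (\<lambda>_. UNIV) :: (nat \<Rightarrow> real) set"
  have "\<exists>f. \<forall>n. (sigma_compact_minorant k w (f n) \<and> (n = 0 \<longrightarrow> f n = v)) \<and> (\<forall>x. f n x \<le> f (Suc n) x) \<and>
    (\<forall>t x y. 0 < t \<longrightarrow> t < 1 \<longrightarrow> x \<in> ?V \<longrightarrow> y \<in> ?V \<longrightarrow> f n x powr t * f n y powr (1 - t) \<le> f (Suc n) (lin_comb {..<k} t x y))"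
  proof (rule dependent_nat_choice)
    show "\<exists>g. sigma_compact_minorant k w g \<and> (0 = (0::nat) \<longrightarrow> g = v)" using v by blast
    fix g and n :: nat assume "sigma_compact_minorant k w g \<and> (n = 0 \<longrightarrow> g = v)"
    then show "\<exists>g'. (sigma_compact_minorant k w g' \<and> (Suc n = 0 \<longrightarrow> g' = v)) \<and> (\<forall>x. g x \<le> g' x) \<and>
       (\<forall>t x y. 0 < t \<longrightarrow> t < 1 \<longrightarrow> x \<in> ?V \<longrightarrow> y \<in> ?V \<longrightarrow> g x powr t * g y powr (1 - t) \<le> g' (lin_comb {..<k} t x y))"
      using concavify_step[OF w, of g] by simp
  qed
  then obtain f where F: "\<forall>n. (sigma_compact_minorant k w (f n) \<and> (n = 0 \<longrightarrow> f n = v)) \<and> (\<forall>x. f n x \<le> f (Suc n) x) \<and>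
    (\<forall>t x y. 0 < t \<longrightarrow> t < 1 \<longrightarrow> x \<in> ?V \<longrightarrow> y \<in> ?V \<longrightarrow> f n x powr t * f n y powr (1 - t) \<le> f (Suc n) (lin_comb {..<k} t x y))"
    by (rule exE)
  have f0: "f 0 = v" using F[THEN spec, of 0, THEN conjunct1, THEN conjunct2] by simp
  have fg: "sigma_compact_minorant k w (f n)" for n by (rule F[THEN spec, THEN conjunct1, THEN conjunct1])
  have fmono: "f n x \<le> f (Suc n) x" for n x by (rule F[THEN spec, THEN conjunct2, THEN conjunct1, THEN spec])
  have fmix: "f n x powr t * f n y powr (1 - t) \<le> f (Suc n) (lin_comb {..<k} t x y)"
    if "0 < t" "t < 1" "x \<in> ?V" "y \<in> ?V" for n t x y
    using F[THEN spec, of n, THEN conjunct2, THEN conjunct2, THEN spec, THEN spec, THEN spec, of t x y] that by simp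
  have inc: "incseq (\<lambda>n. f n x)" for x using fmono by (intro incseq_SucI)
  have fnn: "0 \<le> f n x" for n x using fg[of n] by (simp add: sigma_compact_minorant_def)
  have fle: "f n x \<le> (if x \<in> ?V then w x else 0)" for n x using fg[of n] by (auto simp: sigma_compact_minorant_def)
  have bdd: "bdd_above (range (\<lambda>n. f n x))" for x using fle by (auto intro!: bdd_aboveI)
  define v' where "v' = (\<lambda>x. SUP n. f n x)"
  have up: "f n x \<le> v' x" for n x unfolding v'_def using bdd by (rule cSUP_upper2[OF _ _ order_refl]) auto
  have lim: "(\<lambda>n. f n x) \<longlonglongrightarrow> v' x" for x unfolding v'_def using bdd inc by (rule LIMSEQ_incseq_SUP)
  have v'le: "v' x \<le> (if x \<in> ?V then w x else 0)" for x unfolding v'_def using fle by (intro cSUP_least) auto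
  show ?thesis
  proof (rule that[of v'])
    show "v x \<le> v' x" for x using up[of 0 x] f0 by simp
    show "sigma_compact_minorant k w v'"
      unfolding sigma_compact_minorant_def
    proof (intro conjI allI ballI impI)
      show nn': "0 \<le> v' x" for x using up[of 0 x] fnn[of 0 x] by linarith
      show "v' x = 0" if "x \<notin> ?V" for x using v'le[of x] nn'[of x] that by simp
      show "v' x \<le> w x" if "x \<in> ?V" for x using v'le[of x] that by simp
      fix s :: real assume s: "0 \<le> s"
      have "{x. s < v' x} = (\<Union>n. {x. s < f n x})"
        unfolding v'_def using less_cSUP_iff[OF _ bdd] by auto
      also have "sigma_compact \<dots>"
        using fg s by (intro sigma_compact_UN) (auto simp: sigma_compact_minorant_def)
      finally show "sigma_compact {x. s < v' x}" .
    qed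
    show "log_concave_on {..<k} v'"
      unfolding log_concave_on_def
    proof (intro allI impI)
      fix t :: real and x y assume t: "0 < t" "t < 1" and xy: "x \<in> ?V" "y \<in> ?V"
      have "(\<lambda>n. f n x powr t * f n y powr (1 - t)) \<longlonglongrightarrow> v' x powr t * v' y powr (1 - t)"
        using t fnn by (intro tendsto_mult tendsto_powr' lim tendsto_const) auto
      moreover have "f n x powr t * f n y powr (1 - t) \<le> v' (lin_comb {..<k} t x y)" for n
        using fmix[OF t xy] up[of "Suc n" "lin_comb {..<k} t x y"] by (rule order_trans)
      ultimately show "v' x powr t * v' y powr (1 - t) \<le> v' (lin_comb {..<k} t x y)"
        by (intro LIMSEQ_le_const2) auto
    qed
  qed
qed


section \<open>Densities that may fail to be measurable\<close>

text \<open>\<open>density\<close> is built with \<open>measure_of\<close>, which yields the zero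
  measure when the given set function is not a measure. A nonzero total mass excludes this, so the
  formula is available for arbitrary f.\<close>

lemma emeasure_density_nonzero:
  assumes "emeasure (density M f) (space M) \<noteq> 0" and A: "A \<in> sets M"
  shows "emeasure (density M f) A = (\<integral>\<^sup>+ x. f x * indicator A x \<partial>M)"
  using assms sets.sigma_sets_eq[of M] unfolding density_def
  by (simp add: emeasure_measure_of_conv split: if_splits)

text \<open>For a non-measurable density \<open>nn_integral\<close> is a lower integral; it is attained by a Borel minorant.\<close>

lemma borel_minorant:
  assumes one: "(\<integral>\<^sup>+ x. f x \<partial>M) = 1" and meas: "emeasure (density M f) (space M) = 1"
  obtains g where "g \<in> borel_measurable M" "\<And>x. g x \<le> f x" "density M f = density M g"
proof -
  define G where "G = {g. simple_function M g \<and> g \<le> f}"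
  have "(\<lambda>_. 0) \<in> G" by (simp add: G_def le_fun_def)
  then have "G \<noteq> {}" by auto
  then have "integral\<^sup>S M ` G \<noteq> {}" by simp
  from ennreal_Sup_countable_SUP[OF this] obtain h :: "nat \<Rightarrow> ennreal"
    where h: "range h \<subseteq> integral\<^sup>S M ` G" "(SUP g\<in>G. integral\<^sup>S M g) = (SUP n. h n)" by auto
  have "\<forall>n. \<exists>g. g \<in> G \<and> h n = integral\<^sup>S M g"
  proof
    fix n
    have "h n \<in> integral\<^sup>S M ` G" using h(1) by (simp add: image_subset_iff)
    then show "\<exists>g. g \<in> G \<and> h n = integral\<^sup>S M g" by blast
  qed
  then obtain g where g: "\<And>n. g n \<in> G" "\<And>n. h n = integral\<^sup>S M (g n)" by metis
  define f0 where "f0 = (\<lambda>x. SUP n. g n x)"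
  have gm: "g n \<in> borel_measurable M" for n using g(1)[of n] by (auto simp: G_def intro: borel_measurable_simple_function)
  have f0m[measurable]: "f0 \<in> borel_measurable M" unfolding f0_def using gm by measurable
  have f0le: "f0 x \<le> f x" for x unfolding f0_def using g(1) by (auto simp: G_def le_fun_def intro: SUP_least)
  have "1 = (SUP n. h n)" using one h(2) by (simp add: nn_integral_def G_def)
  also have "\<dots> \<le> (\<integral>\<^sup>+ x. f0 x \<partial>M)"
  proof (rule SUP_least)
    fix n
    have "h n = (\<integral>\<^sup>+ x. g n x \<partial>M)" using g[of n] by (simp add: G_def nn_integral_eq_simple_integral)
    also have "\<dots> \<le> (\<integral>\<^sup>+ x. f0 x \<partial>M)" unfolding f0_def by (intro nn_integral_mono SUP_upper) simp
    finally show "h n \<le> (\<integral>\<^sup>+ x. f0 x \<partial>M)" .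
  qed
  finally have ge1: "1 \<le> (\<integral>\<^sup>+ x. f0 x \<partial>M)" .
  have le: "emeasure (density M f0) A \<le> emeasure (density M f) A" if "A \<in> sets M" for A
    using that meas f0le by (simp add: emeasure_density emeasure_density_nonzero nn_integral_mono mult_right_mono)
  have tot: "emeasure (density M f0) (space M) = 1"
  proof (rule antisym)
    show "emeasure (density M f0) (space M) \<le> 1" using le[of "space M"] meas by simp
    have "(\<integral>\<^sup>+ x. f0 x \<partial>M) = emeasure (density M f0) (space M)"
      by (subst emeasure_density) (auto intro!: nn_integral_cong)
    then show "1 \<le> emeasure (density M f0) (space M)" using ge1 by simp
  qed
  \<comment> \<open>Both have total mass 1, and one dominates the other on A as well as on its
    complement, so they agree on A.\<close>
  have "density M f = density M f0"
  proof (rule measure_eqI)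
    fix A assume "A \<in> sets (density M f)"
    then have A: "A \<in> sets M" by simp
    have c: "emeasure N A + emeasure N (space M - A) = 1" if "sets N = sets M" "space N = space M" "emeasure N (space M) = 1" for N
    proof -
      have "A \<union> (space M - A) = space M" using sets.sets_into_space[OF A] by auto
      then show ?thesis using that A by (subst plus_emeasure) (auto simp: that(1))
    qed
    have c1: "emeasure (density M f) A + emeasure (density M f) (space M - A) = 1" using meas by (intro c) auto
    have c0: "emeasure (density M f0) A + emeasure (density M f0) (space M - A) = 1" using tot by (intro c) auto
    have "emeasure (density M f) (space M - A) \<le> emeasure (density M f) (space M)"
      by (intro emeasure_mono) auto
    then have fin: "emeasure (density M f) (space M - A) < \<infinity>" using meas by (simp add: le_less_trans)
    have "emeasure (density M f) A + emeasure (density M f) (space M - A)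
        \<le> emeasure (density M f0) A + emeasure (density M f) (space M - A)"
      unfolding c1 c0[symmetric] using le[of "space M - A"] A by (intro add_left_mono) auto
    then have "emeasure (density M f) A \<le> emeasure (density M f0) A"
      using fin by (auto simp: add.commute[of "emeasure _ A"] ennreal_add_left_cancel_le)
    then show "emeasure (density M f) A = emeasure (density M f0) A" using le[OF A] by simp
  qed simp
  with f0m f0le show ?thesis by (rule that)
qed

text \<open>A Borel minorant f of full mass need not be log-concave. Inside each {f > q}, q rational
  and positive, choose a sigma-compact subset of full measure; these sets are encoded in a function
  v that equals f almost everywhere. Its log-concave hull lies between v and w, and since f and w
  define the same measure, so does the hull.\<close>

theorem borel_log_concave_version:
  assumes nn: "\<And>x. 0 \<le> w x" and lc: "log_concave_on {..<k} w"
    and prob: "prob_space (density (lebRn k) (\<lambda>x. ennreal (w x)))"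
  obtains w' where "w' \<in> borel_measurable (lebRn k)" "\<And>x. 0 \<le> w' x" "log_concave_on {..<k} w'"
    "density (lebRn k) (\<lambda>x. ennreal (w x)) = density (lebRn k) (\<lambda>x. ennreal (w' x))"
proof -
  let ?V = "PiE {..<k} (\<lambda>_. UNIV) :: (nat \<Rightarrow> real) set"
  let ?N = "lebRn k"
  have sp: "space ?N = ?V" by (simp add: lebRn_def space_PiM)
  have tot: "emeasure (density ?N (\<lambda>x. ennreal (w x))) (space ?N) = 1"
    using prob_space.emeasure_space_1[OF prob] by simp
  have "(\<integral>\<^sup>+ x. ennreal (w x) \<partial>?N) = emeasure (density ?N (\<lambda>x. ennreal (w x))) (space ?N)"
    using tot by (subst emeasure_density_nonzero) (auto intro!: nn_integral_cong)
  then have one: "(\<integral>\<^sup>+ x. ennreal (w x) \<partial>?N) = 1" using tot by simp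
  obtain f where f[measurable]: "f \<in> borel_measurable ?N" and fw: "\<And>x. f x \<le> ennreal (w x)"
    and df: "density ?N (\<lambda>x. ennreal (w x)) = density ?N f"
    using borel_minorant[OF one tot] by blast
  have f1: "(\<integral>\<^sup>+ x. f x \<partial>?N) = 1"
  proof -
    have "(\<integral>\<^sup>+ x. f x \<partial>?N) = emeasure (density ?N f) (space ?N)"
      by (subst emeasure_density) (auto intro!: nn_integral_cong)
    then show ?thesis using tot df by simp
  qed
  define A where "A = (\<lambda>q. {x \<in> space ?N. ennreal q < f x})"
  have Am: "A q \<in> sets ?N" for q unfolding A_def by measurable
  \<comment> \<open>Markov's inequality; inner regularity is used for sets of finite
    measure.\<close>
  have Afin: "emeasure ?N (A q) < \<infinity>" if "0 < q" for q
  proof -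
    have "ennreal q * emeasure ?N (A q) = (\<integral>\<^sup>+ x. ennreal q * indicator (A q) x \<partial>?N)"
      using Am by (simp add: nn_integral_cmult_indicator)
    also have "\<dots> \<le> (\<integral>\<^sup>+ x. f x \<partial>?N)" by (intro nn_integral_mono) (auto simp: A_def indicator_def)
    finally have le1: "ennreal q * emeasure ?N (A q) \<le> 1" using f1 by simp
    show ?thesis
    proof (rule ccontr)
      assume "\<not> ?thesis"
      then have "emeasure ?N (A q) = \<top>" by (simp add: not_less top_unique)
      with le1 that show False by (simp add: ennreal_mult_top top_unique)
    qed
  qed
  have "\<forall>q. \<exists>S. 0 < q \<longrightarrow> sigma_compact S \<and> S \<subseteq> A q \<and> S \<in> sets ?N \<and> A q - S \<in> null_sets ?N"
  proof
    fix q :: real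
    show "\<exists>S. 0 < q \<longrightarrow> sigma_compact S \<and> S \<subseteq> A q \<and> S \<in> sets ?N \<and> A q - S \<in> null_sets ?N"
    proof (cases "0 < q")
      case True
      obtain S where "sigma_compact S" "S \<subseteq> A q" "S \<in> sets ?N" "A q - S \<in> null_sets ?N"
        by (rule inner_sigma_compact[OF Am Afin[OF True]])
      then show ?thesis by (intro exI[of _ S] impI conjI)
    qed simp
  qed
  then obtain U where U: "\<And>q. 0 < q \<Longrightarrow> sigma_compact (U q)" "\<And>q. 0 < q \<Longrightarrow> U q \<subseteq> A q"
    "\<And>q. 0 < q \<Longrightarrow> A q - U q \<in> null_sets ?N" by metis
  define Q where "Q = {q :: real. q \<in> \<rat> \<and> 0 < q}"
  have cQ: "countable Q" unfolding Q_def by (rule countable_subset[OF _ countable_rat]) auto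
  \<comment> \<open>Inserting 0 keeps the supremum over a nonempty set and makes v
    nonnegative.\<close>
  define T where "T = (\<lambda>x. insert 0 {q \<in> Q. x \<in> U q})"
  define v where "v = (\<lambda>x. Sup (T x))"
  have Tw: "q \<le> (if x \<in> ?V then w x else 0)" if "q \<in> T x" for q x
  proof (cases "q = 0")
    case False
    then have q: "0 < q" "x \<in> U q" using that by (auto simp: T_def Q_def)
    then have "x \<in> A q" using U(2) by blast
    then have "ennreal q < ennreal (w x)" "x \<in> ?V" using fw[of x] sp by (auto simp: A_def intro: less_le_trans)
    then show ?thesis using q nn by (auto simp: ennreal_less_iff)
  qed (use nn in auto)
  have bdd: "bdd_above (T x)" and ne: "T x \<noteq> {}" for x using Tw by (auto intro!: bdd_aboveI simp: T_def)
  have memb: "q \<le> v x" if "q \<in> T x" for q x unfolding v_def using that bdd by (rule cSup_upper)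
  have "sigma_compact_minorant k w v"
    unfolding sigma_compact_minorant_def
  proof (intro conjI allI ballI impI)
    show v0: "0 \<le> v x" for x by (rule memb) (simp add: T_def)
    have vle: "v x \<le> (if x \<in> ?V then w x else 0)" for x unfolding v_def using ne Tw by (rule cSup_least)
    show "v x = 0" if "x \<notin> ?V" for x using vle[of x] v0[of x] that by simp
    show "v x \<le> w x" if "x \<in> ?V" for x using vle[of x] that by simp
    fix s :: real assume s: "0 \<le> s"
    have "{x. s < v x} = (\<Union>q\<in>{q\<in>Q. s < q}. U q)"
      unfolding v_def using less_cSup_iff[OF ne bdd] s by (auto simp: T_def)
    also have "sigma_compact \<dots>"
      using U(1) by (intro sigma_compact_UN countable_subset[OF _ cQ]) (auto simp: Q_def)
    finally show "sigma_compact {x. s < v x}" .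
  qed
  from concavify[OF lc this] obtain v' where v': "sigma_compact_minorant k w v'" "\<And>x. v x \<le> v' x" "log_concave_on {..<k} v'" by blast
  have nn': "0 \<le> v' x" for x using v'(1) by (simp add: sigma_compact_minorant_def)
  have vm[measurable]: "v' \<in> borel_measurable ?N"
  proof (subst borel_measurable_iff_greater, intro allI)
    fix s :: real
    show "{x \<in> space ?N. s < v' x} \<in> sets ?N"
    proof (cases "0 \<le> s")
      case True
      then have "{x. s < v' x} \<in> sets borel" using v'(1) by (auto simp: sigma_compact_minorant_def intro: sigma_compact_borel)
      from measurable_sets[OF lebRn_id_measurable this] show ?thesis by (simp add: vimage_def Int_def conj_commute)
    next
      case False
      then have "s < v' x" for x using nn'[of x] by linarith
      then have "{x \<in> space ?N. s < v' x} = space ?N" by simp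
      then show ?thesis by simp
    qed
  qed
  have "AE x in ?N. x \<notin> (\<Union>q\<in>Q. A q - U q)"
    using U(3) cQ by (intro AE_not_in null_sets_UN') (auto simp: Q_def)
  \<comment> \<open>Off the countably many null sets \<open>A q - U q\<close>, every positive
    rational below f(x) is at most v(x).\<close>
  then have fv: "AE x in ?N. f x \<le> ennreal (v' x)"
    using AE_space
  proof eventually_elim
    case (elim x)
    show ?case
    proof (rule ccontr)
      assume "\<not> ?thesis"
      then have lt: "ennreal (v' x) < f x" by simp
      have "f x \<noteq> \<top>" using fw[of x] by (auto simp: top_unique)
      then obtain y where y: "f x = ennreal y" "0 \<le> y" by (cases "f x") auto
      then have "v' x < y" using lt nn'[of x] by (simp add: ennreal_less_iff)
      then obtain q where q: "q \<in> \<rat>" "v' x < q" "q < y" using Rats_dense_in_real by blast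
      have q0: "0 < q" using q nn'[of x] by linarith
      then have "x \<in> A q" using y q elim(2) by (simp add: A_def ennreal_less_iff)
      then have "x \<in> U q" using elim(1) q q0 by (auto simp: Q_def)
      then have "q \<le> v x" using q q0 by (intro memb) (auto simp: T_def Q_def)
      then show False using v'(2)[of x] q by linarith
    qed
  qed
  have vw: "ennreal (v' x) \<le> ennreal (w x)" if "x \<in> space ?N" for x
    using v'(1) that sp nn by (auto simp: sigma_compact_minorant_def intro!: ennreal_leI)
  have "density ?N f = density ?N (\<lambda>x. ennreal (v' x))"
  proof (rule measure_eqI)
    fix B assume "B \<in> sets (density ?N f)"
    then have B: "B \<in> sets ?N" by simp
    show "emeasure (density ?N f) B = emeasure (density ?N (\<lambda>x. ennreal (v' x))) B"
    proof (rule antisym)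
      show "emeasure (density ?N f) B \<le> emeasure (density ?N (\<lambda>x. ennreal (v' x))) B"
        using fv B by (simp add: emeasure_density) (intro nn_integral_mono_AE, auto elim!: eventually_mono intro: mult_right_mono)
      \<comment> \<open>The function w may be non-measurable, so its side is evaluated as a lower
        integral by \<open>emeasure_density_nonzero\<close>.\<close>
      have "emeasure (density ?N (\<lambda>x. ennreal (v' x))) B \<le> emeasure (density ?N (\<lambda>x. ennreal (w x))) B"
        using B tot vw by (simp add: emeasure_density emeasure_density_nonzero) (intro nn_integral_mono mult_right_mono, auto)
      then show "emeasure (density ?N (\<lambda>x. ennreal (v' x))) B \<le> emeasure (density ?N f) B" using df by simp
    qed
  qed simp
  then show ?thesis using that[OF vm nn' v'(3)] df by simp
qed

section \<open>Averaging over levels and truncation\<close>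

lemma kernel_continuous: "0 < \<tau> \<Longrightarrow> continuous_on UNIV (\<lambda>s. kernel d \<tau> (f s))" if "continuous_on UNIV f" for f :: "real \<Rightarrow> real"
  unfolding kernel_def by (intro continuous_intros that) (auto simp: max_def)

text \<open>The maximum of u and \<tau> is at least their mean, and a power of (u + \<tau>) / 2 has
  an elementary antiderivative. Since 1/d \<le> 1/2, the factor 2 / (1 - 1/d) is at most 4.\<close>

lemma kernel_integral_half:
  assumes d: "2 \<le> d" and tau: "0 < \<tau>" "\<tau> \<le> l"
  shows "integral {0..l} (kernel d \<tau>) \<le> 4 * l powr (1 - 1 / d)"
proof -
  define p where "p = 1 / real d"
  have p: "0 < p" "p \<le> 1/2" using d by (auto simp: p_def field_simps)
  define F where "F = (\<lambda>u. 2 * ((u + \<tau>) / 2) powr (1 - p) / (1 - p))"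
  have "integral {0..l} (kernel d \<tau>) \<le> F l - F 0"
  proof (rule integral_le_increment)
    show "kernel d \<tau> integrable_on {0..l}"
      using kernel_continuous[OF continuous_on_id tau(1), of d] by (intro integrable_continuous_interval) (auto intro: continuous_on_subset)
    fix x assume x: "x \<in> {0..l}"
    show "(F has_real_derivative ((x + \<tau>) / 2) powr (- p)) (at x)"
    proof -
      have "(F has_real_derivative 2 * ((1 - p) * ((x + \<tau>) / 2) powr (1 - p - 1) * (1/2)) / (1 - p)) (at x)"
        unfolding F_def using x tau p by (auto intro!: derivative_eq_intros)
      then show ?thesis using p by simp
    qed
    show "kernel d \<tau> x \<le> ((x + \<tau>) / 2) powr (- p)"
      unfolding kernel_def p_def using x tau by (simp, intro powr_mono2') auto
  qed (use tau in simp)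
  also have "\<dots> \<le> F l" using p by (simp add: F_def)
  also have "\<dots> \<le> 2 * l powr (1 - p) / (1/2)"
    unfolding F_def using p tau by (intro frac_le mult_left_mono powr_mono2) auto
  finally show ?thesis by (simp add: p_def)
qed

text \<open>With l = \<beta> - \<alpha>, levels within l of s contribute at most two half integrals,
  8 l^(1-1/d) for \<tau> \<le> l; at the others the weight is at most l^(-1/d), which adds 1. For
  \<tau> > l the weight is that small everywhere. Uniformity in s allows averaging over the values
  of f.\<close>

lemma kernel_integral:
  assumes d: "2 \<le> d" and tau: "0 < \<tau>" and ab: "\<alpha> < \<beta>"
  shows "(\<integral>m. indicator {\<alpha>..<\<beta>} m * kernel d \<tau> (s - m) \<partial>lborel) \<le> 9 * (\<beta> - \<alpha>) powr (1 - 1 / d)"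
proof -
  define l where "l = \<beta> - \<alpha>"
  have l: "0 < l" using ab by (simp add: l_def)
  have lp: "l * l powr (- 1 / d) = l powr (1 - 1 / d)" using l powr_add[of l 1 "- 1 / d"] by simp
  have km[measurable]: "kernel d \<tau> \<in> borel_measurable borel" unfolding kernel_def by measurable
  define g where "g = (\<lambda>u. indicator {-l..l} u * kernel d \<tau> u)"
  have kb: "0 \<le> kernel d \<tau> u" "kernel d \<tau> u \<le> \<tau> powr (- 1 / d)" for u by (rule kernel_bounds[OF tau])+
  have gint: "integrable lborel g"
    unfolding g_def by (rule integrable_bounded_support[where R = l and B = "\<tau> powr (- 1 / d)"])
      (use kb in \<open>auto simp: indicator_def abs_le_iff\<close>)
  have int0: "integrable lborel (\<lambda>m. indicator {\<alpha>..<\<beta>} m * kernel d \<tau> (s - m))"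
    by (rule integrable_bounded_support[where R = "\<bar>\<alpha>\<bar> + \<bar>\<beta>\<bar>" and B = "\<tau> powr (- 1 / d)"])
      (use kb in \<open>auto simp: indicator_def\<close>)
  have trans: "(\<integral>m. g (s - m) \<partial>lborel) = (\<integral>u. g u \<partial>lborel)" "integrable lborel (\<lambda>m. g (s - m))"
    using lborel_integral_real_affine[of "-1" g s] lborel_integrable_real_affine[OF gint, of "-1" s] by simp_all
  have gtot: "(\<integral>u. g u \<partial>lborel) \<le> 8 * l powr (1 - 1 / d)" if tl: "\<tau> \<le> l"
  proof -
    have kc: "continuous_on UNIV (kernel d \<tau>)" using kernel_continuous[OF continuous_on_id tau, of d] by simp
    have ki: "kernel d \<tau> integrable_on {a..b}" for a b
      by (intro integrable_continuous_interval continuous_on_subset[OF kc]) auto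
    have "(\<integral>u. g u \<partial>lborel) = integral {-l..l} (kernel d \<tau>)"
      unfolding g_def by (rule interval_like_integral[OF _ _ _ kc]) auto
    also have "\<dots> = integral {-l..0} (kernel d \<tau>) + integral {0..l} (kernel d \<tau>)"
      using l by (intro Henstock_Kurzweil_Integration.integral_combine[symmetric] ki) auto
    also have "integral {-l..0} (kernel d \<tau>) = integral {0..l} (kernel d \<tau>)"
    proof -
      have "integral {- l..- 0} (\<lambda>x. kernel d \<tau> (- x)) = integral {0..l} (kernel d \<tau>)"
        by (rule Henstock_Kurzweil_Integration.integral_reflect_real)
      moreover have "kernel d \<tau> (- x) = kernel d \<tau> x" for x by (simp add: kernel_def)
      ultimately show ?thesis by simp
    qed
    also have "integral {0..l} (kernel d \<tau>) + integral {0..l} (kernel d \<tau>) \<le> 8 * l powr (1 - 1 / d)"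
      using kernel_integral_half[OF d tau tl] by simp
    finally show ?thesis .
  qed
  have kfar: "kernel d \<tau> u \<le> l powr (- 1 / d)" if "l \<le> \<bar>u\<bar> \<or> l \<le> \<tau>" for u
    unfolding kernel_def using that l tau by (intro powr_mono2') auto
  show ?thesis
  proof (cases "\<tau> \<le> l")
    case True
    have "(\<integral>m. indicator {\<alpha>..<\<beta>} m * kernel d \<tau> (s - m) \<partial>lborel)
        \<le> (\<integral>m. l powr (- 1 / d) * indicator {\<alpha>..<\<beta>} m + g (s - m) \<partial>lborel)"
    proof (rule integral_mono[OF int0])
      show "integrable lborel (\<lambda>m. l powr (- 1 / d) * indicator {\<alpha>..<\<beta>} m + g (s - m))"
        using ab by (intro Bochner_Integration.integrable_add trans integrable_mult_right integrable_real_indicator) auto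
      show "indicator {\<alpha>..<\<beta>} m * kernel d \<tau> (s - m) \<le> l powr (- 1 / d) * indicator {\<alpha>..<\<beta>} m + g (s - m)" for m
        using kb[of "s - m"] kfar[of "s - m"] unfolding g_def
        by (cases "\<bar>s - m\<bar> \<le> l") (auto simp: indicator_def abs_le_iff)
    qed
    also have "\<dots> = l powr (- 1 / d) * l + (\<integral>u. g u \<partial>lborel)"
    proof -
      have "integrable lborel (\<lambda>m. l powr (- 1 / d) * indicat_real {\<alpha>..<\<beta>} m)"
        using ab by (intro integrable_mult_right integrable_real_indicator) auto
      then show ?thesis using trans ab by (simp add: l_def)
    qed
    also have "\<dots> \<le> 9 * l powr (1 - 1 / d)" using gtot[OF True] lp by (simp add: mult.commute)
    finally show ?thesis by (simp add: l_def)
  next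
    case False
    have "(\<integral>m. indicator {\<alpha>..<\<beta>} m * kernel d \<tau> (s - m) \<partial>lborel) \<le> (\<integral>m. l powr (- 1 / d) * indicator {\<alpha>..<\<beta>} m \<partial>lborel)"
    proof (rule integral_mono[OF int0])
      show "integrable lborel (\<lambda>m. l powr (- 1 / d) * indicat_real {\<alpha>..<\<beta>} m)"
        using ab by (intro integrable_mult_right integrable_real_indicator) auto
      show "indicator {\<alpha>..<\<beta>} m * kernel d \<tau> (s - m) \<le> l powr (- 1 / d) * indicator {\<alpha>..<\<beta>} m" for m
        using kfar[of "s - m"] False by (auto simp: indicator_def)
    qed
    also have "\<dots> = l powr (1 - 1 / d)" using ab lp by (simp add: l_def mult.commute)
    also have "\<dots> \<le> 9 * l powr (1 - 1 / d)" by simp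
    finally show ?thesis by (simp add: l_def)
  qed
qed

text \<open>Averaging over the level \<open>m\<close> avoids the logarithm that a fixed level would produce: \<open>\<bar>s\<bar>\<close> raised to \<open>-1/d\<close>
  is locally integrable because \<open>d \<ge> 2\<close>.\<close>

lemma good_level:
  assumes "prob_space M0" and [measurable]: "X \<in> borel_measurable M0" and d: "2 \<le> d" and tau: "0 < \<tau>" and ab: "\<alpha> < \<beta>"
  obtains m where "\<alpha> \<le> m" "m < \<beta>" "(\<integral>x. kernel d \<tau> (X x - m) \<partial>M0) \<le> 10 * (\<beta> - \<alpha>) powr (- 1 / d)"
proof -
  interpret prob_space M0 by fact
  interpret pair_sigma_finite M0 lborel ..
  have km[measurable]: "kernel d \<tau> \<in> borel_measurable borel" unfolding kernel_def by measurable
  have kb: "0 \<le> kernel d \<tau> u" "kernel d \<tau> u \<le> \<tau> powr (- 1 / d)" for u by (rule kernel_bounds[OF tau])+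
  define l where "l = \<beta> - \<alpha>"
  have l: "0 < l" using ab by (simp add: l_def)
  \<comment> \<open>The interval is half-open: m < \<beta> is what later bounds the mass of {F \<le>
    m} by 3/4.\<close>
  define f where "f = (\<lambda>x m. indicator {\<alpha>..<\<beta>} m * kernel d \<tau> (X x - m))"
  have int: "integrable (M0 \<Otimes>\<^sub>M lborel) (case_prod f)"
  proof (rule Bochner_Integration.integrable_bound)
    show "integrable (M0 \<Otimes>\<^sub>M lborel) (\<lambda>x. \<tau> powr (- 1 / d) * indicator (space M0 \<times> {\<alpha>..<\<beta>}) x :: real)"
      using ab by (intro integrable_mult_right integrable_real_indicator)
        (auto simp: lborel.emeasure_pair_measure_Times emeasure_space_1)
    show "case_prod f \<in> borel_measurable (M0 \<Otimes>\<^sub>M lborel)" unfolding f_def by measurable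
    show "AE p in M0 \<Otimes>\<^sub>M lborel. norm (case p of (x, m) \<Rightarrow> f x m) \<le> norm (\<tau> powr (- 1 / d) * indicat_real (space M0 \<times> {\<alpha>..<\<beta>}) p)"
      using kb by (intro AE_I2) (auto simp: f_def space_pair_measure indicator_def)
  qed
  have fub: "(\<integral>m. (\<integral>x. f x m \<partial>M0) \<partial>lborel) = (\<integral>x. (\<integral>m. f x m \<partial>lborel) \<partial>M0)" by (rule Fubini_integral[OF int])
  have "(\<integral>x. (\<integral>m. f x m \<partial>lborel) \<partial>M0) \<le> (\<integral>x. 9 * l powr (1 - 1 / d) \<partial>M0)"
    using integrable_fst[OF int] kernel_integral[OF d tau ab] by (intro integral_mono) (auto simp: f_def l_def)
  also have "\<dots> = 9 * l powr (1 - 1 / d)" by (simp add: prob_space)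
  finally have le: "(\<integral>m. (\<integral>x. f x m \<partial>M0) \<partial>lborel) \<le> 9 * l powr (1 - 1 / d)" using fub by simp
  \<comment> \<open>If every level violated the bound, the integral over the levels would be at
    least 10 l^(1-1/d) instead of at most 9 l^(1-1/d).\<close>
  have "\<exists>m. \<alpha> \<le> m \<and> m < \<beta> \<and> (\<integral>x. kernel d \<tau> (X x - m) \<partial>M0) \<le> 10 * l powr (- 1 / d)"
  proof (rule ccontr)
    assume "\<not> ?thesis"
    then have gt: "10 * l powr (- 1 / d) \<le> (\<integral>x. kernel d \<tau> (X x - m) \<partial>M0)" if "\<alpha> \<le> m" "m < \<beta>" for m
      using that by (metis less_le not_le)
    have "10 * l powr (1 - 1 / d) = (\<integral>m. 10 * l powr (- 1 / d) * indicator {\<alpha>..<\<beta>} m \<partial>lborel)"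
      using ab l powr_add[of l 1 "- 1 / d"] by (simp add: l_def)
    also have "\<dots> \<le> (\<integral>m. (\<integral>x. f x m \<partial>M0) \<partial>lborel)"
    proof (rule integral_mono)
      show "integrable lborel (\<lambda>m. 10 * l powr (- 1 / d) * indicat_real {\<alpha>..<\<beta>} m)"
        using ab by (intro integrable_mult_right integrable_real_indicator) auto
      show "integrable lborel (\<lambda>m. \<integral>x. f x m \<partial>M0)" using integrable_snd[OF int] .
      show "10 * l powr (- 1 / d) * indicat_real {\<alpha>..<\<beta>} m \<le> (\<integral>x. f x m \<partial>M0)" for m
        using gt[of m] by (auto simp: f_def indicator_def)
    qed
    also note le
    finally show False using l by simp
  qed
  then show ?thesis using that by (auto simp: l_def)
qed

section \<open>Truncation\<close>

text \<open>One parameter cuts both the support and the height. Restriction to a cube and the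
  minimum with a constant both preserve log-concavity.\<close>

definition truncate :: "nat \<Rightarrow> ((nat \<Rightarrow> real) \<Rightarrow> real) \<Rightarrow> nat \<Rightarrow> (nat \<Rightarrow> real) \<Rightarrow> real" where
  "truncate k w n x = (if \<forall>j<k. \<bar>x j\<bar> \<le> real n then min (w x) (real n) else 0)"

lemma truncate_box_function:
  assumes [measurable]: "w \<in> borel_measurable (lebRn k)" and nn: "\<And>x. 0 \<le> w x"
  shows "box_function {..<k} (real n) (real n) (truncate k w n)"
  unfolding box_function_def
proof (intro conjI allI ballI impI)
  have "{x \<in> space (lebRn k). \<forall>j\<in>{..<k}. \<bar>x j\<bar> \<le> real n} \<in> sets (lebRn k)"
  proof (rule sets.sets_Collect_finite_All)
    fix j assume "j \<in> {..<k}"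
    then have [measurable]: "(\<lambda>x. x j) \<in> borel_measurable (lebRn k)" by (intro component_measurable) simp
    show "{x \<in> space (lebRn k). \<bar>x j\<bar> \<le> real n} \<in> sets (lebRn k)" by measurable
  qed simp
  then have S: "{x \<in> space (lebRn k). \<forall>j<k. \<bar>x j\<bar> \<le> real n} \<in> sets (lebRn k)" by (simp only: Ball_def lessThan_iff)
  have "(\<lambda>x. min (w x) (real n)) \<in> borel_measurable (lebRn k)" by measurable
  then have "(\<lambda>x. if \<forall>j<k. \<bar>x j\<bar> \<le> real n then min (w x) (real n) else 0) \<in> borel_measurable (lebRn k)"
    by (rule measurable_If[OF _ borel_measurable_const S])
  then show "truncate k w n \<in> borel_measurable (PiM {..<k} (\<lambda>_. lborel))"
    by (simp add: truncate_def[abs_def] lebRn_def)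
qed (auto simp: truncate_def nn min_def not_le)

lemma truncate_le: "0 \<le> w x \<Longrightarrow> truncate k w n x \<le> w x"
  by (simp add: truncate_def)

lemma truncate_log_concave:
  assumes nn: "\<And>x. 0 \<le> w x" and lc: "log_concave_on {..<k} w"
  shows "log_concave_on {..<k} (truncate k w n)"
  unfolding log_concave_on_def
proof (intro allI impI)
  fix t :: real and x y :: "nat \<Rightarrow> real"
  assume t: "0 < t" "t < 1" and xy: "x \<in> PiE {..<k} (\<lambda>_. UNIV)" "y \<in> PiE {..<k} (\<lambda>_. UNIV)"
  define z where "z = lin_comb {..<k} t x y"
  have nz: "0 \<le> truncate k w n z" using nn by (simp add: truncate_def)
  show "truncate k w n x powr t * truncate k w n y powr (1 - t) \<le> truncate k w n z"
  proof (cases "(\<forall>j<k. \<bar>x j\<bar> \<le> real n) \<and> (\<forall>j<k. \<bar>y j\<bar> \<le> real n)")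
    case True
    have "\<bar>z j\<bar> \<le> real n" if "j < k" for j
    proof -
      have "\<bar>z j\<bar> \<le> t * \<bar>x j\<bar> + (1 - t) * \<bar>y j\<bar>"
        using that t abs_triangle_ineq[of "t * x j" "(1 - t) * y j"] by (simp add: z_def lin_comb_def abs_mult)
      also have "\<dots> \<le> t * real n + (1 - t) * real n" using True that t by (intro add_mono mult_left_mono) auto
      finally show ?thesis by (simp add: algebra_simps)
    qed
    then have tz: "truncate k w n z = min (w z) (real n)" by (simp add: truncate_def)
    have "min (w x) (real n) powr t * min (w y) (real n) powr (1 - t) \<le> w x powr t * w y powr (1 - t)"
      using t nn by (intro mult_mono powr_mono2) auto
    also have "\<dots> \<le> w z" unfolding z_def using lc t xy unfolding log_concave_on_def by blast
    finally have 1: "min (w x) (real n) powr t * min (w y) (real n) powr (1 - t) \<le> w z" .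
    have "min (w x) (real n) powr t * min (w y) (real n) powr (1 - t) \<le> real n powr t * real n powr (1 - t)"
      using t nn by (intro mult_mono powr_mono2) auto
    also have "\<dots> = real n" by (simp flip: powr_add)
    finally show ?thesis using 1 True unfolding tz by (simp add: truncate_def)
  next
    case False
    then have "truncate k w n x = 0 \<or> truncate k w n y = 0" by (auto simp: truncate_def)
    then show ?thesis using nz by auto
  qed
qed

lemma truncate_eventually: "eventually (\<lambda>n. truncate k w n x = w x) sequentially"
proof -
  obtain N where N: "max (w x) (\<Sum>j<k. \<bar>x j\<bar>) \<le> real N" using real_arch_simple by blast
  show ?thesis
  proof (rule eventually_sequentiallyI[of N])
    fix n assume n: "N \<le> n"
    have "\<bar>x j\<bar> \<le> real n" if "j < k" for j
    proof -
      have "\<bar>x j\<bar> \<le> (\<Sum>j<k. \<bar>x j\<bar>)" using that by (intro member_le_sum) auto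
      then show ?thesis using N n by simp
    qed
    moreover have "w x \<le> real n" using N n by simp
    ultimately show "truncate k w n x = w x" by (simp add: truncate_def)
  qed
qed

lemma truncate_integral_tendsto:
  assumes [measurable]: "w \<in> borel_measurable (lebRn k)" and nn: "\<And>x. 0 \<le> w x"
    and g[measurable]: "g \<in> borel_measurable (lebRn k)" and int: "integrable (lebRn k) (\<lambda>x. g x * w x)"
  shows "(\<lambda>n. \<integral>x. g x * truncate k w n x \<partial>lebRn k) \<longlonglongrightarrow> (\<integral>x. g x * w x \<partial>lebRn k)"
proof (rule integral_dominated_convergence[where w = "\<lambda>x. \<bar>g x * w x\<bar>"])
  have tm: "truncate k w n \<in> borel_measurable (lebRn k)" for n
    using truncate_box_function[OF assms(1) nn, of n] by (simp only: box_function_def lebRn_def)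
  then show "(\<lambda>x. g x * truncate k w n x) \<in> borel_measurable (lebRn k)" for n by measurable
  show "AE x in lebRn k. (\<lambda>n. g x * truncate k w n x) \<longlonglongrightarrow> g x * w x"
    using truncate_eventually[of k w] by (intro AE_I2 tendsto_eventually) (auto elim: eventually_mono)
  show "AE x in lebRn k. norm (g x * truncate k w n x) \<le> \<bar>g x * w x\<bar>" for n
    using truncate_le[of w _ k n] nn by (intro AE_I2) (auto simp: abs_mult truncate_def intro!: mult_left_mono)
qed (use int in auto)

section \<open>The estimate for log-concave densities\<close>

context
  fixes k d :: nat and w F :: "(nat \<Rightarrow> real) \<Rightarrow> real" and E :: real
  assumes k: "0 < k" and wm[measurable]: "w \<in> borel_measurable (lebRn k)" and nn: "\<And>x. 0 \<le> w x"
    and lc: "log_concave_on {..<k} w" and wint: "integrable (lebRn k) w" and mass1: "(\<integral>x. w x \<partial>lebRn k) = 1"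
    and F: "poly_on_lines k d F" "box_lipschitz k F" and Fm[measurable]: "F \<in> borel_measurable (lebRn k)"
    and E: "oscillation_constant d E" and d: "2 \<le> d"
begin

lemma bounded_integrable:
  assumes "g \<in> borel_measurable (lebRn k)" "\<And>x. \<bar>g x\<bar> \<le> C"
  shows "integrable (lebRn k) (\<lambda>x. g x * w x)"
proof (rule Bochner_Integration.integrable_bound)
  show "integrable (lebRn k) (\<lambda>x. C * w x)" using wint by simp
  show "AE x in lebRn k. norm (g x * w x) \<le> norm (C * w x)"
  proof (intro AE_I2)
    fix x
    have "\<bar>g x\<bar> * w x \<le> \<bar>C\<bar> * w x" using assms(2)[of x] nn[of x] by (intro mult_right_mono) auto
    then show "norm (g x * w x) \<le> norm (C * w x)" using nn[of x] by (simp add: abs_mult)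
  qed
qed (use assms in measurable)

lemma truncate_box: "box_function {..<k} (real n) (real n) (truncate k w n)"
  by (rule truncate_box_function[OF wm nn])

lemma truncate_mass_tendsto: "(\<lambda>n. \<integral>x. truncate k w n x \<partial>lebRn k) \<longlonglongrightarrow> 1"
  using truncate_integral_tendsto[OF wm nn, of "\<lambda>_. 1"] wint mass1 by simp

lemma truncate_mass_le: "(\<integral>x. truncate k w n x \<partial>lebRn k) \<le> 1"
proof -
  have "integrable (lebRn k) (truncate k w n)"
    unfolding lebRn_def by (rule box_function_integrable[OF _ truncate_box]) simp
  then have "(\<integral>x. truncate k w n x \<partial>lebRn k) \<le> (\<integral>x. w x \<partial>lebRn k)"
    using wint by (rule integral_mono) (rule truncate_le, rule nn)
  then show ?thesis using mass1 by simp
qed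

lemma truncate_mass_of_tendsto:
  assumes Q: "{x \<in> space (lebRn k). Q x} \<in> sets (lebRn k)"
  shows "(\<lambda>n. mass_of k (truncate k w n) Q) \<longlonglongrightarrow> mass_of k w Q"
  unfolding mass_of_def
  by (rule truncate_integral_tendsto[OF wm nn indicator_measurable_pred[OF Q]],
      rule bounded_integrable[OF indicator_measurable_pred[OF Q], of 1]) (simp add: indicator_def)

text \<open>Truncation loses mass, so the proportions 1/4 and 3/4 are relaxed to 1/5 and 4/5 for
  large n; c = 1/5 produces 1 + 32 / c^2 = 801. Both sides converge by dominated convergence,
  because D and the capped weight are bounded.\<close>

lemma full_oscillation:
  assumes t: "test_fun \<phi> D M" and M: "0 < M" and lip: "\<And>x y. \<bar>D x - D y\<bar> \<le> K * \<bar>x - y\<bar>"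
    and tau: "0 < \<tau>" "\<tau> \<le> 1 / M"
    and q: "1 / 4 \<le> mass_of k w (\<lambda>x. F x \<le> m)" "mass_of k w (\<lambda>x. F x \<le> m) \<le> 3 / 4"
  shows "(\<integral>x. D (F x) * w x \<partial>lebRn k)
    \<le> 4 * (1 + E * 801) * M powr (1 - 1 / d) * (\<integral>x. kernel d \<tau> (F x - m) * w x \<partial>lebRn k)"
proof -
  have Dc: "continuous_on UNIV D" and DM: "\<And>x. \<bar>D x\<bar> \<le> M" using t unfolding test_fun_def by blast+
  have [measurable]: "D \<in> borel_measurable borel" using Dc by (rule borel_measurable_continuous_onI)
  have [measurable]: "kernel d \<tau> \<in> borel_measurable borel" unfolding kernel_def by measurable
  define C where "C = 4 * (1 + E * 801) * M powr (1 - 1 / d)"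
  have Q: "{x \<in> space (lebRn k). F x \<le> m} \<in> sets (lebRn k)" by measurable
  have "(\<lambda>n. \<integral>x. D (F x) * truncate k w n x \<partial>lebRn k) \<longlonglongrightarrow> (\<integral>x. D (F x) * w x \<partial>lebRn k)"
    by (rule truncate_integral_tendsto[OF wm nn _ bounded_integrable[OF _ DM]]) measurable
  moreover have "\<bar>kernel d \<tau> s\<bar> \<le> \<tau> powr (- 1 / d)" for s using kernel_bounds[OF tau(1), of d s] by simp
  then have "(\<lambda>n. \<integral>x. kernel d \<tau> (F x - m) * truncate k w n x \<partial>lebRn k) \<longlonglongrightarrow> (\<integral>x. kernel d \<tau> (F x - m) * w x \<partial>lebRn k)"
    by (intro truncate_integral_tendsto[OF wm nn _ bounded_integrable]) measurable
  then have "(\<lambda>n. C * (\<integral>x. kernel d \<tau> (F x - m) * truncate k w n x \<partial>lebRn k)) \<longlonglongrightarrow> C * (\<integral>x. kernel d \<tau> (F x - m) * w x \<partial>lebRn k)"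
    by (intro tendsto_intros)
  moreover have "eventually (\<lambda>n. (\<integral>x. D (F x) * truncate k w n x \<partial>lebRn k) \<le> C * (\<integral>x. kernel d \<tau> (F x - m) * truncate k w n x \<partial>lebRn k)) sequentially"
  proof -
    have e1: "eventually (\<lambda>n. 0 < (\<integral>x. truncate k w n x \<partial>lebRn k)) sequentially"
      using truncate_mass_tendsto by (rule order_tendstoD) simp
    have e2: "eventually (\<lambda>n. 1/5 < mass_of k (truncate k w n) (\<lambda>x. F x \<le> m)) sequentially"
      using truncate_mass_of_tendsto[OF Q] q by (intro order_tendstoD) auto
    have "(\<lambda>n. mass_of k (truncate k w n) (\<lambda>x. F x \<le> m) - 4/5 * (\<integral>x. truncate k w n x \<partial>lebRn k)) \<longlonglongrightarrow> mass_of k w (\<lambda>x. F x \<le> m) - 4/5 * 1"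
      by (intro tendsto_intros truncate_mass_of_tendsto[OF Q] truncate_mass_tendsto)
    then have e3: "eventually (\<lambda>n. mass_of k (truncate k w n) (\<lambda>x. F x \<le> m) - 4/5 * (\<integral>x. truncate k w n x \<partial>lebRn k) < 0) sequentially"
      by (rule order_tendstoD) (use q in simp)
    show ?thesis using e1 e2 e3
    proof eventually_elim
      case (elim n)
      have "(\<integral>x. D (F x) * truncate k w n x \<partial>lebRn k)
        \<le> 4 * (1 + E * (1 + 32 / (1/5)\<^sup>2)) * M powr (1 - 1 / d) * (\<integral>x. kernel d \<tau> (F x - m) * truncate k w n x \<partial>lebRn k)"
        using elim truncate_mass_le[of n] d
        by (intro compact_oscillation[OF k _ truncate_box truncate_log_concave[OF nn lc] F Fm E _ t M lip _ _ tau elim(1)]) auto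
      then show ?case by (simp add: C_def power2_eq_square)
    qed
  qed
  ultimately have "(\<integral>x. D (F x) * w x \<partial>lebRn k) \<le> C * (\<integral>x. kernel d \<tau> (F x - m) * w x \<partial>lebRn k)"
    by (intro tendsto_le[OF sequentially_bot]) auto
  then show ?thesis by (simp add: C_def)
qed

text \<open>Square integrability of F is not known beforehand, so the truncated bounds are carried
  to the limit by Fatou's lemma, which yields integrability together with the bound. The proportion
  1/2 is relaxed to c = 1/4.\<close>

lemma full_second_moment:
  assumes r: "0 \<le> r" and q: "1 / 2 \<le> mass_of k w (\<lambda>x. \<bar>F x - m\<bar> \<le> r)"
  shows "integrable (lebRn k) (\<lambda>x. (F x - m)\<^sup>2 * w x)"
    "(\<integral>x. (F x - m)\<^sup>2 * w x \<partial>lebRn k) \<le> 2 * moment_constant d E (1/4) * r\<^sup>2"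
proof -
  define C where "C = 2 * moment_constant d E (1/4) * r\<^sup>2"
  have C0: "0 \<le> C" using moment_constant_pos[of d E "1/4"] by (simp add: C_def)
  have Q: "{x \<in> space (lebRn k). \<bar>F x - m\<bar> \<le> r} \<in> sets (lebRn k)" by measurable
  have tm[measurable]: "truncate k w n \<in> borel_measurable (lebRn k)" for n
    using truncate_box[of n] by (simp only: box_function_def lebRn_def)
  have tnn: "0 \<le> truncate k w n x" for n x using nn by (simp add: truncate_def)
  have gc: "continuous_on UNIV (\<lambda>s::real. (s - m)\<^sup>2)" by (intro continuous_intros)
  have tint: "integrable (lebRn k) (\<lambda>x. (F x - m)\<^sup>2 * truncate k w n x)" for n
    unfolding lebRn_def by (rule bounded_fun_integrable[OF _ bounded_fun_compose[OF F(2) Fm gc] truncate_box]) simp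
  have ev: "eventually (\<lambda>n. (\<integral>\<^sup>+ x. ennreal ((F x - m)\<^sup>2 * truncate k w n x) \<partial>lebRn k) \<le> ennreal C) sequentially"
  proof -
    have e1: "eventually (\<lambda>n. 0 < (\<integral>x. truncate k w n x \<partial>lebRn k)) sequentially"
      using truncate_mass_tendsto by (rule order_tendstoD) simp
    have e2: "eventually (\<lambda>n. 1/4 < mass_of k (truncate k w n) (\<lambda>x. \<bar>F x - m\<bar> \<le> r)) sequentially"
      using truncate_mass_of_tendsto[OF Q] q by (intro order_tendstoD) auto
    show ?thesis using e1 e2
    proof eventually_elim
      case (elim n)
      have "(\<integral>x. (F x - m)\<^sup>2 * truncate k w n x \<partial>lebRn k) \<le> C * (\<integral>x. truncate k w n x \<partial>lebRn k)"
        unfolding C_def using elim truncate_mass_le[of n] d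
        by (intro compact_second_moment[OF k _ truncate_box truncate_log_concave[OF nn lc] F Fm E _ _ _ r elim(1)]) auto
      also have "\<dots> \<le> C" using mult_left_mono[OF truncate_mass_le[of n] C0] by simp
      finally have "(\<integral>x. (F x - m)\<^sup>2 * truncate k w n x \<partial>lebRn k) \<le> C" .
      moreover have "(\<integral>\<^sup>+ x. ennreal ((F x - m)\<^sup>2 * truncate k w n x) \<partial>lebRn k) = ennreal (\<integral>x. (F x - m)\<^sup>2 * truncate k w n x \<partial>lebRn k)"
        by (rule nn_integral_eq_integral[OF tint]) (use tnn in simp)
      ultimately show ?case by (simp add: ennreal_leI)
    qed
  qed
  have "(\<integral>\<^sup>+ x. ennreal ((F x - m)\<^sup>2 * w x) \<partial>lebRn k) = (\<integral>\<^sup>+ x. liminf (\<lambda>n. ennreal ((F x - m)\<^sup>2 * truncate k w n x)) \<partial>lebRn k)"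
  proof (intro nn_integral_cong)
    fix x
    have "eventually (\<lambda>n. ennreal ((F x - m)\<^sup>2 * truncate k w n x) = ennreal ((F x - m)\<^sup>2 * w x)) sequentially"
      using truncate_eventually[of k w x] by eventually_elim simp
    then have "(\<lambda>n. ennreal ((F x - m)\<^sup>2 * truncate k w n x)) \<longlonglongrightarrow> ennreal ((F x - m)\<^sup>2 * w x)" by (rule tendsto_eventually)
    then show "ennreal ((F x - m)\<^sup>2 * w x) = liminf (\<lambda>n. ennreal ((F x - m)\<^sup>2 * truncate k w n x))"
      by (rule lim_imp_Liminf[OF sequentially_bot, symmetric])
  qed
  also have "\<dots> \<le> liminf (\<lambda>n. \<integral>\<^sup>+ x. ennreal ((F x - m)\<^sup>2 * truncate k w n x) \<partial>lebRn k)"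
    by (rule nn_integral_liminf) measurable
  also have "\<dots> \<le> limsup (\<lambda>n. \<integral>\<^sup>+ x. ennreal ((F x - m)\<^sup>2 * truncate k w n x) \<partial>lebRn k)"
    by (rule Liminf_le_Limsup[OF sequentially_bot])
  also have "\<dots> \<le> ennreal C" using ev by (rule Limsup_bounded)
  finally have le: "(\<integral>\<^sup>+ x. ennreal ((F x - m)\<^sup>2 * w x) \<partial>lebRn k) \<le> ennreal C" .
  show int: "integrable (lebRn k) (\<lambda>x. (F x - m)\<^sup>2 * w x)"
  proof (rule integrableI_nonneg)
    show "(\<integral>\<^sup>+ x. ennreal ((F x - m)\<^sup>2 * w x) \<partial>lebRn k) < \<infinity>" using le by (rule le_less_trans) simp
  qed (use nn in auto)
  have "ennreal (\<integral>x. (F x - m)\<^sup>2 * w x \<partial>lebRn k) \<le> ennreal C"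
    using le nn_integral_eq_integral[OF int] nn by simp
  then show "(\<integral>x. (F x - m)\<^sup>2 * w x \<partial>lebRn k) \<le> 2 * moment_constant d E (1/4) * r\<^sup>2"
    using C0 by (simp add: C_def)
qed

lemma density_integral:
  assumes "g \<in> borel_measurable (lebRn k)"
  shows "(\<integral>x. g x \<partial>density (lebRn k) (\<lambda>x. ennreal (w x))) = (\<integral>x. g x * w x \<partial>lebRn k)"
  using assms nn by (subst integral_density) (auto simp: mult.commute)

text \<open>With l the distance of the quartiles \<alpha> and \<beta>, F lies within l of \<alpha>
  with probability at least 1/2, so the standard deviation is at most a multiple of l. For l > 0, at
  a good level m in [\<alpha>, \<beta>), the integral is at most a multiple of M^(1-1/d) l^(-1/d),
  and l cancels. The factor 40 is the 10 of \<open>good_level\<close> times the 4 of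
  \<open>full_oscillation\<close>.\<close>

theorem density_estimate:
  assumes t: "test_fun \<phi> D M" and M: "0 < M" and lip: "\<And>x y. \<bar>D x - D y\<bar> \<le> K * \<bar>x - y\<bar>"
  defines "V \<equiv> (\<integral>x. (F x - (\<integral>y. F y * w y \<partial>lebRn k))\<^sup>2 * w x \<partial>lebRn k)"
  shows "sqrt V powr (1 / d) * (\<integral>x. D (F x) * w x \<partial>lebRn k)
    \<le> sqrt (2 * moment_constant d E (1/4)) powr (1 / d) * (40 * (1 + E * 801)) * M powr (1 - 1 / d)"
proof -
  define \<mu> where "\<mu> = density (lebRn k) (\<lambda>x. ennreal (w x))"
  have pr: "prob_space \<mu>" unfolding \<mu>_def by (rule density_prob_space(1)[OF wm nn wint mass1])
  interpret prob_space \<mu> by (rule pr)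
  have sp: "space \<mu> = space (lebRn k)" "sets \<mu> = sets (lebRn k)" by (auto simp: \<mu>_def)
  have Fmu[measurable]: "F \<in> borel_measurable \<mu>" by (simp add: \<mu>_def)
  have ms: "measure \<mu> {x \<in> space \<mu>. Q x} = mass_of k w Q" if "{x \<in> space (lebRn k). Q x} \<in> sets (lebRn k)" for Q
    using density_prob_space(2)[OF wm nn wint mass1 that] by (simp add: \<mu>_def)
  obtain \<alpha> where a: "1/4 \<le> measure \<mu> {x\<in>space \<mu>. F x \<le> \<alpha>}" "measure \<mu> {x\<in>space \<mu>. F x < \<alpha>} \<le> 1/4"
     "\<And>s. s < \<alpha> \<Longrightarrow> measure \<mu> {x\<in>space \<mu>. F x \<le> s} < 1/4"
    by (rule quantile_exists[OF pr Fmu, of "1/4"]) auto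
  obtain \<beta> where b: "3/4 \<le> measure \<mu> {x\<in>space \<mu>. F x \<le> \<beta>}" "\<And>s. s < \<beta> \<Longrightarrow> measure \<mu> {x\<in>space \<mu>. F x \<le> s} < 3/4"
    by (rule quantile_exists[OF pr Fmu, of "3/4"]) auto
  have ab: "\<alpha> \<le> \<beta>" using a(3)[of \<beta>] b(1) by (cases "\<beta> < \<alpha>") auto
  define l where "l = \<beta> - \<alpha>"
  have l0: "0 \<le> l" using ab by (simp add: l_def)
  define C2 where "C2 = 2 * moment_constant d E (1/4)"
  have C2: "0 < C2" using moment_constant_pos[of d E "1/4"] by (simp add: C2_def)
  define C1 where "C1 = 4 * (1 + E * 801)"
  have C1: "0 < C1" using E by (simp add: C1_def oscillation_constant_def)
  have half: "1/2 \<le> mass_of k w (\<lambda>x. \<bar>F x - \<alpha>\<bar> \<le> l)"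
  proof -
    have "measure \<mu> {x\<in>space \<mu>. F x \<le> \<beta>} \<le> measure \<mu> ({x\<in>space \<mu>. F x < \<alpha>} \<union> {x\<in>space \<mu>. \<bar>F x - \<alpha>\<bar> \<le> l})"
      by (intro finite_measure_mono) (auto simp: l_def abs_le_iff)
    also have "\<dots> \<le> measure \<mu> {x\<in>space \<mu>. F x < \<alpha>} + measure \<mu> {x\<in>space \<mu>. \<bar>F x - \<alpha>\<bar> \<le> l}"
      by (intro measure_Un_le) measurable
    finally have "1/2 \<le> measure \<mu> {x\<in>space \<mu>. \<bar>F x - \<alpha>\<bar> \<le> l}" using a(2) b(1) by simp
    moreover have "measure \<mu> {x\<in>space \<mu>. \<bar>F x - \<alpha>\<bar> \<le> l} = mass_of k w (\<lambda>x. \<bar>F x - \<alpha>\<bar> \<le> l)" by (rule ms) measurable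
    ultimately show ?thesis by simp
  qed
  note sm = full_second_moment[OF l0 half]
  \<comment> \<open>The second moment about \<alpha> exceeds the variance by the squared distance
    from \<alpha> to the mean.\<close>
  have V: "V \<le> C2 * l\<^sup>2" "0 \<le> V"
  proof -
    have Fint: "integrable (lebRn k) (\<lambda>x. (F x - \<alpha>) * w x)"
    proof (rule Bochner_Integration.integrable_bound)
      show "integrable (lebRn k) (\<lambda>x. (F x - \<alpha>)\<^sup>2 * w x + w x)" using sm(1) wint by (rule Bochner_Integration.integrable_add)
      show "AE x in lebRn k. norm ((F x - \<alpha>) * w x) \<le> norm ((F x - \<alpha>)\<^sup>2 * w x + w x)"
      proof (intro AE_I2)
        fix x
        have "\<bar>F x - \<alpha>\<bar> \<le> (F x - \<alpha>)\<^sup>2 + 1"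
          using zero_le_power2[of "\<bar>F x - \<alpha>\<bar> - 1"] by (simp add: power2_eq_square algebra_simps abs_if split: if_splits)
        then have "\<bar>F x - \<alpha>\<bar> * w x \<le> ((F x - \<alpha>)\<^sup>2 + 1) * w x" using nn[of x] by (rule mult_right_mono)
        then show "norm ((F x - \<alpha>) * w x) \<le> norm ((F x - \<alpha>)\<^sup>2 * w x + w x)"
          using nn[of x] by (simp add: abs_mult distrib_right)
      qed
    qed measurable
    define e where "e = (\<integral>x. (F x - \<alpha>) * w x \<partial>lebRn k)"
    have "(\<integral>y. F y * w y \<partial>lebRn k) = (\<integral>y. (F y - \<alpha>) * w y + \<alpha> * w y \<partial>lebRn k)"
      by (intro Bochner_Integration.integral_cong) (auto simp: algebra_simps)
    also have "\<dots> = e + \<alpha>" using Fint wint mass1 by (simp add: e_def)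
    finally have mean: "(\<integral>y. F y * w y \<partial>lebRn k) = e + \<alpha>" .
    have "V = (\<integral>x. (F x - \<alpha>)\<^sup>2 * w x - 2 * e * ((F x - \<alpha>) * w x) + e\<^sup>2 * w x \<partial>lebRn k)"
      unfolding V_def mean by (intro Bochner_Integration.integral_cong) (auto simp: power2_eq_square algebra_simps)
    also have "\<dots> = (\<integral>x. (F x - \<alpha>)\<^sup>2 * w x \<partial>lebRn k) - 2 * e * e + e\<^sup>2"
      using sm(1) Fint wint mass1 by (simp add: e_def)
    also have "\<dots> \<le> (\<integral>x. (F x - \<alpha>)\<^sup>2 * w x \<partial>lebRn k)" by (simp add: power2_eq_square)
    finally show "V \<le> C2 * l\<^sup>2" using sm(2) by (simp add: C2_def)
    show "0 \<le> V" unfolding V_def using nn by (intro Bochner_Integration.integral_nonneg) simp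
  qed
  define I where "I = (\<integral>x. D (F x) * w x \<partial>lebRn k)"
  have "sqrt V powr (1 / d) * I \<le> sqrt C2 powr (1 / d) * (10 * C1) * M powr (1 - 1 / d)"
  \<comment> \<open>For l = 0 the variance vanishes. A nonpositive I is set aside because the bounds
    for the deviation and for I are multiplied below.\<close>
  proof (cases "I \<le> 0 \<or> l = 0")
    case True
    have "sqrt V powr (1 / d) * I \<le> 0"
    proof (cases "I \<le> 0")
      case True
      then show ?thesis by (intro mult_nonneg_nonpos) auto
    next
      case False
      then have "V = 0" using V \<open>I \<le> 0 \<or> l = 0\<close> by simp
      then show ?thesis by simp
    qed
    also have "0 \<le> sqrt C2 powr (1 / d) * (10 * C1) * M powr (1 - 1 / d)" using C1 by simp
    finally show ?thesis .
  next
    case False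
    then have I: "0 < I" and l: "0 < l" using l0 by auto
    define \<tau> where "\<tau> = 1 / M"
    have tau: "0 < \<tau>" "\<tau> \<le> 1 / M" using M by (auto simp: \<tau>_def)
    obtain m where m: "\<alpha> \<le> m" "m < \<beta>" "(\<integral>x. kernel d \<tau> (F x - m) \<partial>\<mu>) \<le> 10 * (\<beta> - \<alpha>) powr (- 1 / d)"
      using good_level[OF pr Fmu d tau(1), of \<alpha> \<beta>] l by (auto simp: l_def)
    have [measurable]: "kernel d \<tau> \<in> borel_measurable borel" unfolding kernel_def by measurable
    have km: "(\<integral>x. kernel d \<tau> (F x - m) * w x \<partial>lebRn k) \<le> 10 * l powr (- 1 / d)"
    proof -
      have "(\<lambda>x. kernel d \<tau> (F x - m)) \<in> borel_measurable (lebRn k)" by measurable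
      from density_integral[OF this] m(3) show ?thesis by (simp add: \<mu>_def l_def)
    qed
    have qm: "measure \<mu> {x\<in>space \<mu>. F x \<le> m} = mass_of k w (\<lambda>x. F x \<le> m)" by (rule ms) measurable
    have "measure \<mu> {x\<in>space \<mu>. F x \<le> \<alpha>} \<le> measure \<mu> {x\<in>space \<mu>. F x \<le> m}"
      using m by (intro finite_measure_mono) auto
    then have q: "1/4 \<le> mass_of k w (\<lambda>x. F x \<le> m)" "mass_of k w (\<lambda>x. F x \<le> m) \<le> 3/4"
      using a(1) b(2)[OF m(2)] qm by auto
    have "I \<le> C1 * M powr (1 - 1 / d) * (\<integral>x. kernel d \<tau> (F x - m) * w x \<partial>lebRn k)"
      unfolding I_def C1_def by (rule full_oscillation[OF t M lip tau q])
    also have "\<dots> \<le> C1 * M powr (1 - 1 / d) * (10 * l powr (- 1 / d))" using km C1 by (intro mult_left_mono) auto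
    finally have Ib: "I \<le> C1 * M powr (1 - 1 / d) * (10 * l powr (- 1 / d))" .
    have "sqrt V \<le> sqrt C2 * l" using V l real_sqrt_le_mono[OF V(1)] by (simp add: real_sqrt_mult)
    then have "sqrt V powr (1 / d) \<le> (sqrt C2 * l) powr (1 / d)" using V by (intro powr_mono2) auto
    also have "\<dots> = sqrt C2 powr (1 / d) * l powr (1 / d)" using C2 l by (simp add: powr_mult)
    finally have "sqrt V powr (1 / d) * I \<le> sqrt C2 powr (1 / d) * l powr (1 / d) * (C1 * M powr (1 - 1 / d) * (10 * l powr (- 1 / d)))"
      using Ib I by (intro mult_mono) auto
    also have "\<dots> = sqrt C2 powr (1 / d) * (10 * C1) * M powr (1 - 1 / d) * (l powr (1 / d) * l powr (- 1 / d))" by simp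
    also have "l powr (1 / d) * l powr (- 1 / d) = 1" using l by (simp flip: powr_add)
    finally show ?thesis by simp
  qed
  then show ?thesis by (simp add: I_def C2_def C1_def)
qed

end

section \<open>Polynomials on affine images\<close>

lemma box_lipschitz_const: "box_lipschitz k (\<lambda>_. c)"
  unfolding box_lipschitz_def by (intro allI exI[of _ 0]) simp

lemma box_lipschitz_component:
  assumes "j < k"
  shows "box_lipschitz k (\<lambda>x. x j)"
  unfolding box_lipschitz_def
proof (intro allI exI[of _ 1] conjI ballI impI)
  fix x y :: "nat \<Rightarrow> real"
  have "\<bar>x j - y j\<bar> \<le> (\<Sum>j<k. \<bar>x j - y j\<bar>)" using assms by (intro member_le_sum[of j "{..<k}" "\<lambda>j. \<bar>x j - y j\<bar>"]) auto
  then show "\<bar>x j - y j\<bar> \<le> 1 * (\<Sum>j<k. \<bar>x j - y j\<bar>)" by simp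
qed simp

lemma box_lipschitz_add:
  assumes "box_lipschitz k f" "box_lipschitz k g"
  shows "box_lipschitz k (\<lambda>x. f x + g x)"
  unfolding box_lipschitz_def
proof
  fix R
  obtain K where K: "0 \<le> K" "\<And>x y. x \<in> PiE {..<k} (\<lambda>_. UNIV) \<Longrightarrow> y \<in> PiE {..<k} (\<lambda>_. UNIV) \<Longrightarrow>
     (\<forall>j<k. \<bar>x j\<bar> \<le> R \<and> \<bar>y j\<bar> \<le> R) \<Longrightarrow> \<bar>f x - f y\<bar> \<le> K * (\<Sum>j<k. \<bar>x j - y j\<bar>)"
    using assms(1)[unfolded box_lipschitz_def, rule_format, of R] by auto
  obtain L where L: "0 \<le> L" "\<And>x y. x \<in> PiE {..<k} (\<lambda>_. UNIV) \<Longrightarrow> y \<in> PiE {..<k} (\<lambda>_. UNIV) \<Longrightarrow>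
     (\<forall>j<k. \<bar>x j\<bar> \<le> R \<and> \<bar>y j\<bar> \<le> R) \<Longrightarrow> \<bar>g x - g y\<bar> \<le> L * (\<Sum>j<k. \<bar>x j - y j\<bar>)"
    using assms(2)[unfolded box_lipschitz_def, rule_format, of R] by auto
  show "\<exists>K\<ge>0. \<forall>x\<in>PiE {..<k} (\<lambda>_. UNIV). \<forall>y\<in>PiE {..<k} (\<lambda>_. UNIV).
     (\<forall>j<k. \<bar>x j\<bar> \<le> R \<and> \<bar>y j\<bar> \<le> R) \<longrightarrow> \<bar>f x + g x - (f y + g y)\<bar> \<le> K * (\<Sum>j<k. \<bar>x j - y j\<bar>)"
  proof (intro exI[of _ "K + L"] conjI ballI impI)
    fix x y :: "nat \<Rightarrow> real"
    assume h: "x \<in> PiE {..<k} (\<lambda>_. UNIV)" "y \<in> PiE {..<k} (\<lambda>_. UNIV)" "\<forall>j<k. \<bar>x j\<bar> \<le> R \<and> \<bar>y j\<bar> \<le> R"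
    show "\<bar>f x + g x - (f y + g y)\<bar> \<le> (K + L) * (\<Sum>j<k. \<bar>x j - y j\<bar>)"
      using K(2)[OF h] L(2)[OF h] by (simp add: distrib_right abs_le_iff)
  qed (use K L in simp)
qed

text \<open>The product rule needs bounds of the factors, which \<open>box_lipschitz_bounded\<close>
  provides on each cube.\<close>

lemma box_lipschitz_mult:
  assumes "box_lipschitz k f" "box_lipschitz k g"
  shows "box_lipschitz k (\<lambda>x. f x * g x)"
  unfolding box_lipschitz_def
proof
  fix R
  obtain K where K: "0 \<le> K" "\<And>x y. x \<in> PiE {..<k} (\<lambda>_. UNIV) \<Longrightarrow> y \<in> PiE {..<k} (\<lambda>_. UNIV) \<Longrightarrow>
     (\<forall>j<k. \<bar>x j\<bar> \<le> R \<and> \<bar>y j\<bar> \<le> R) \<Longrightarrow> \<bar>f x - f y\<bar> \<le> K * (\<Sum>j<k. \<bar>x j - y j\<bar>)"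
    using assms(1)[unfolded box_lipschitz_def, rule_format, of R] by auto
  obtain L where L: "0 \<le> L" "\<And>x y. x \<in> PiE {..<k} (\<lambda>_. UNIV) \<Longrightarrow> y \<in> PiE {..<k} (\<lambda>_. UNIV) \<Longrightarrow>
     (\<forall>j<k. \<bar>x j\<bar> \<le> R \<and> \<bar>y j\<bar> \<le> R) \<Longrightarrow> \<bar>g x - g y\<bar> \<le> L * (\<Sum>j<k. \<bar>x j - y j\<bar>)"
    using assms(2)[unfolded box_lipschitz_def, rule_format, of R] by auto
  obtain A where A: "\<And>x. x \<in> PiE {..<k} (\<lambda>_. UNIV) \<Longrightarrow> (\<And>j. j < k \<Longrightarrow> \<bar>x j\<bar> \<le> R) \<Longrightarrow> \<bar>f x\<bar> \<le> A"
    using box_lipschitz_bounded[OF assms(1), of R] by blast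
  obtain B where B: "\<And>x. x \<in> PiE {..<k} (\<lambda>_. UNIV) \<Longrightarrow> (\<And>j. j < k \<Longrightarrow> \<bar>x j\<bar> \<le> R) \<Longrightarrow> \<bar>g x\<bar> \<le> B"
    using box_lipschitz_bounded[OF assms(2), of R] by blast
  show "\<exists>K\<ge>0. \<forall>x\<in>PiE {..<k} (\<lambda>_. UNIV). \<forall>y\<in>PiE {..<k} (\<lambda>_. UNIV).
     (\<forall>j<k. \<bar>x j\<bar> \<le> R \<and> \<bar>y j\<bar> \<le> R) \<longrightarrow> \<bar>f x * g x - f y * g y\<bar> \<le> K * (\<Sum>j<k. \<bar>x j - y j\<bar>)"
  proof (intro exI[of _ "\<bar>A\<bar> * L + \<bar>B\<bar> * K"] conjI ballI impI)
    fix x y :: "nat \<Rightarrow> real"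
    assume h: "x \<in> PiE {..<k} (\<lambda>_. UNIV)" "y \<in> PiE {..<k} (\<lambda>_. UNIV)" "\<forall>j<k. \<bar>x j\<bar> \<le> R \<and> \<bar>y j\<bar> \<le> R"
    have fA: "\<bar>f x\<bar> \<le> \<bar>A\<bar>" using A[OF h(1)] h(3) by force
    have gB: "\<bar>g y\<bar> \<le> \<bar>B\<bar>" using B[OF h(2)] h(3) by force
    have "f x * g x - f y * g y = f x * (g x - g y) + g y * (f x - f y)" by (simp add: algebra_simps)
    also have "\<bar>\<dots>\<bar> \<le> \<bar>f x\<bar> * \<bar>g x - g y\<bar> + \<bar>g y\<bar> * \<bar>f x - f y\<bar>"
      by (metis abs_mult abs_triangle_ineq)
    also have "\<dots> \<le> \<bar>A\<bar> * (L * (\<Sum>j<k. \<bar>x j - y j\<bar>)) + \<bar>B\<bar> * (K * (\<Sum>j<k. \<bar>x j - y j\<bar>))"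
      by (intro add_mono mult_mono fA gB K(2)[OF h] L(2)[OF h]) auto
    finally show "\<bar>f x * g x - f y * g y\<bar> \<le> (\<bar>A\<bar> * L + \<bar>B\<bar> * K) * (\<Sum>j<k. \<bar>x j - y j\<bar>)"
      by (simp add: algebra_simps)
  qed (use K L in simp)
qed

lemma box_lipschitz_power: "box_lipschitz k f \<Longrightarrow> box_lipschitz k (\<lambda>x. f x ^ n)"
  by (induction n) (auto intro: box_lipschitz_const box_lipschitz_mult)

lemma box_lipschitz_sum: "finite S \<Longrightarrow> (\<And>i. i \<in> S \<Longrightarrow> box_lipschitz k (f i)) \<Longrightarrow> box_lipschitz k (\<lambda>x. \<Sum>i\<in>S. f i x)"
  by (induction S rule: finite_induct) (auto intro: box_lipschitz_const box_lipschitz_add)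

lemma box_lipschitz_prod: "finite S \<Longrightarrow> (\<And>i. i \<in> S \<Longrightarrow> box_lipschitz k (f i)) \<Longrightarrow> box_lipschitz k (\<lambda>x. \<Prod>i\<in>S. f i x)"
  by (induction S rule: finite_induct) (auto intro: box_lipschitz_const box_lipschitz_mult)

lemma poly_measurable:
  assumes "poly_deg_le n d f"
  shows "f \<in> borel_measurable (lebRn n)"
proof -
  obtain A c where A: "\<forall>x. f x = (\<Sum>\<alpha>\<in>A. c \<alpha> * (\<Prod>i<n. x i ^ \<alpha> i))"
    using assms by (auto simp: poly_deg_le_def)
  have "f = (\<lambda>x. \<Sum>\<alpha>\<in>A. c \<alpha> * (\<Prod>i<n. x i ^ \<alpha> i))" using A by auto
  also have "\<dots> \<in> borel_measurable (lebRn n)"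
    by (intro borel_measurable_sum borel_measurable_times borel_measurable_const borel_measurable_prod borel_measurable_power component_measurable) simp
  finally show ?thesis .
qed

lemma affmap_measurable: "affmap n k a b \<in> measurable (lebRn k) (lebRn n)"
proof -
  have "(\<lambda>y. restrict (\<lambda>j. a j + (\<Sum>i<k. y i * b i j)) {..<n}) \<in> measurable (lebRn k) (PiM {..<n} (\<lambda>_. lborel))"
  proof (rule measurable_restrict)
    fix j
    have "(\<lambda>y. a j + (\<Sum>i<k. y i * b i j)) \<in> borel_measurable (lebRn k)"
      by (intro borel_measurable_add borel_measurable_const borel_measurable_sum borel_measurable_times component_measurable) simp
    then show "(\<lambda>y. a j + (\<Sum>i<k. y i * b i j)) \<in> measurable (lebRn k) lborel" by simp
  qed
  then show ?thesis by (simp add: affmap_def[abs_def] lebRn_def)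
qed

lemma poly_affine_lipschitz:
  assumes "poly_deg_le n d f"
  shows "box_lipschitz k (\<lambda>y. f (affmap n k a b y))"
proof -
  obtain A c where fin: "finite A" and A: "\<forall>x. f x = (\<Sum>\<alpha>\<in>A. c \<alpha> * (\<Prod>i<n. x i ^ \<alpha> i))"
    using assms by (auto simp: poly_deg_le_def)
  have eq: "(\<lambda>y. f (affmap n k a b y)) = (\<lambda>y. \<Sum>\<alpha>\<in>A. c \<alpha> * (\<Prod>i<n. (a i + (\<Sum>j<k. y j * b j i)) ^ \<alpha> i))"
    using A by (simp add: affmap_def)
  show ?thesis unfolding eq
    using fin by (intro box_lipschitz_sum box_lipschitz_mult box_lipschitz_prod box_lipschitz_power box_lipschitz_add
        box_lipschitz_const box_lipschitz_component) auto
qed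

text \<open>Along a line each coordinate of the affine image is a polynomial of degree at most 1, so
  substitution does not raise the total degree of a monomial.\<close>

lemma poly_affine_lines:
  assumes "poly_deg_le n d f"
  shows "poly_on_lines k d (\<lambda>y. f (affmap n k a b y))"
  unfolding poly_on_lines_def
proof (intro allI)
  fix u v :: "nat \<Rightarrow> real"
  obtain A c where fin: "finite A" and deg: "\<And>\<alpha>. \<alpha> \<in> A \<Longrightarrow> (\<Sum>i<n. \<alpha> i) \<le> d"
    and A: "\<forall>x. f x = (\<Sum>\<alpha>\<in>A. c \<alpha> * (\<Prod>i<n. x i ^ \<alpha> i))"
    using assms by (auto simp: poly_deg_le_def)
  define p where "p = (\<lambda>i. [:a i + (\<Sum>j<k. u j * b j i), \<Sum>j<k. v j * b j i:])"
  define P where "P = (\<Sum>\<alpha>\<in>A. smult (c \<alpha>) (\<Prod>i<n. p i ^ \<alpha> i))"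
  show "\<exists>P. degree P \<le> d \<and> (\<forall>t. f (affmap n k a b (restrict (\<lambda>j. u j + v j * t) {..<k})) = poly P t)"
  proof (intro exI[of _ P] conjI allI)
    show "degree P \<le> d" unfolding P_def
    proof (rule degree_sum_le[OF fin])
      fix \<alpha> assume al: "\<alpha> \<in> A"
      have "degree (smult (c \<alpha>) (\<Prod>i<n. p i ^ \<alpha> i)) \<le> degree (\<Prod>i<n. p i ^ \<alpha> i)" by (rule degree_smult_le)
      also have "\<dots> \<le> (\<Sum>i<n. degree (p i ^ \<alpha> i))" using degree_prod_sum_le[of "{..<n}" "\<lambda>i. p i ^ \<alpha> i"] by (simp add: o_def)
      also have "\<dots> \<le> (\<Sum>i<n. \<alpha> i)"
      proof (rule sum_mono)
        fix i
        have "degree (p i ^ \<alpha> i) \<le> degree (p i) * \<alpha> i" by (rule degree_power_le)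
        also have "\<dots> \<le> 1 * \<alpha> i" by (intro mult_right_mono) (auto simp: p_def)
        finally show "degree (p i ^ \<alpha> i) \<le> \<alpha> i" by simp
      qed
      also have "\<dots> \<le> d" by (rule deg[OF al])
      finally show "degree (smult (c \<alpha>) (\<Prod>i<n. p i ^ \<alpha> i)) \<le> d" .
    qed
    fix t
    have "poly (p i) t = a i + (\<Sum>j<k. (u j + v j * t) * b j i)" for i
      by (simp add: p_def algebra_simps sum.distrib sum_distrib_left)
    then show "f (affmap n k a b (restrict (\<lambda>j. u j + v j * t) {..<k})) = poly P t"
      using A by (simp add: affmap_def P_def poly_sum poly_prod poly_power)
  qed
qed

section \<open>From log-concave measures to log-concave densities\<close>

lemma affmap_lin_comb: "affmap n k a b (lin_comb {..<k} t x y) = comb n t (affmap n k a b x) (affmap n k a b y)"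
  by (auto simp: affmap_def comb_def lin_comb_def fun_eq_iff algebra_simps sum.distrib sum_subtractf sum_distrib_left)

text \<open>The potential is pulled back along the affine parametrisation, which commutes with
  convex combinations. Where it is infinite the density is 0 and the inequality is trivial.\<close>

lemma convex_potential_log_concave:
  fixes V :: "(nat \<Rightarrow> real) \<Rightarrow> ereal" and a b and n k :: nat
  defines "L \<equiv> affmap n k a b ` Rn k"
  defines "w \<equiv> (\<lambda>y. if V (affmap n k a b y) = \<infinity> then 0 else exp (- real_of_ereal (V (affmap n k a b y))))"
  assumes V: "\<forall>x\<in>L. V x \<noteq> -\<infinity>"
    and conv: "\<forall>x\<in>L. \<forall>y\<in>L. \<forall>t\<in>{0..1}. V (comb n t x y) \<le> ereal t * V x + ereal (1 - t) * V y"
  shows "log_concave_on {..<k} w"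
  unfolding log_concave_on_def
proof (intro allI impI)
  fix t :: real and x y :: "nat \<Rightarrow> real"
  assume t: "0 < t" "t < 1" and xy: "x \<in> PiE {..<k} (\<lambda>_. UNIV)" "y \<in> PiE {..<k} (\<lambda>_. UNIV)"
  define z where "z = lin_comb {..<k} t x y"
  have inL: "affmap n k a b x \<in> L" "affmap n k a b y \<in> L" "affmap n k a b z \<in> L"
    using xy lin_comb_range[of "{..<k}" t x y] by (auto simp: L_def Rn_def z_def)
  have nz: "0 \<le> w z" by (simp add: w_def)
  show "w x powr t * w y powr (1 - t) \<le> w z"
  proof (cases "V (affmap n k a b x) = \<infinity> \<or> V (affmap n k a b y) = \<infinity>")
    case True
    then have "w x = 0 \<or> w y = 0" by (auto simp: w_def)
    then show ?thesis using nz by auto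
  next
    case False
    then obtain r s where r: "V (affmap n k a b x) = ereal r" and s: "V (affmap n k a b y) = ereal s"
      using V inL by (meson ereal_cases)
    have "V (affmap n k a b z) \<le> ereal t * V (affmap n k a b x) + ereal (1 - t) * V (affmap n k a b y)"
      unfolding z_def affmap_lin_comb using conv inL t by auto
    then have le: "V (affmap n k a b z) \<le> ereal (t * r + (1 - t) * s)" by (simp add: r s)
    then obtain q where q: "V (affmap n k a b z) = ereal q" using V inL(3) by (cases "V (affmap n k a b z)") auto
    have "w x powr t * w y powr (1 - t) = exp (- (t * r + (1 - t) * s))"
      by (simp add: w_def r s powr_def algebra_simps flip: exp_add)
    also have "\<dots> \<le> exp (- q)" using le q by simp
    also have "\<dots> = w z" by (simp add: w_def q)
    finally show ?thesis .
  qed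
qed

text \<open>The exponential of the given potential may be non-measurable, so that
  \<open>density\<close> refers to a lower integral; a Borel log-concave version replaces it without
  changing the measure.\<close>

lemma log_concave_density_exists:
  assumes "log_concave n \<mu>"
  shows "\<exists>k a b w. w \<in> borel_measurable (lebRn k) \<and> (\<forall>x. 0 \<le> w x) \<and> log_concave_on {..<k} w \<and>
    integrable (lebRn k) w \<and> (\<integral>x. w x \<partial>lebRn k) = 1 \<and>
    \<mu> = distr (density (lebRn k) (\<lambda>x. ennreal (w x))) (lebRn n) (affmap n k a b)"
proof -
  obtain k a b and V :: "(nat \<Rightarrow> real) \<Rightarrow> ereal" where pr: "prob_space \<mu>"
    and V: "\<forall>x\<in>affmap n k a b ` Rn k. V x \<noteq> -\<infinity>"
    and conv: "\<forall>x\<in>affmap n k a b ` Rn k. \<forall>y\<in>affmap n k a b ` Rn k. \<forall>t\<in>{0..1}.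
          V (comb n t x y) \<le> ereal t * V x + ereal (1 - t) * V y"
    and mu: "\<mu> = distr (density (lebRn k) (\<lambda>y. if V (affmap n k a b y) = \<infinity> then 0
                      else ennreal (exp (- real_of_ereal (V (affmap n k a b y)))))) (lebRn n) (affmap n k a b)"
    using assms unfolding log_concave_def Let_def by blast
  define w0 where "w0 = (\<lambda>y. if V (affmap n k a b y) = \<infinity> then 0 else exp (- real_of_ereal (V (affmap n k a b y))))"
  have "(\<lambda>y. if V (affmap n k a b y) = \<infinity> then 0 else ennreal (exp (- real_of_ereal (V (affmap n k a b y))))) = (\<lambda>y. ennreal (w0 y))"
    by (auto simp: w0_def fun_eq_iff)
  with mu have mu0: "\<mu> = distr (density (lebRn k) (\<lambda>y. ennreal (w0 y))) (lebRn n) (affmap n k a b)" by simp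
  have lc0: "log_concave_on {..<k} w0" unfolding w0_def by (rule convex_potential_log_concave[OF V conv])
  have am: "affmap n k a b \<in> measurable (density (lebRn k) f) (lebRn n)" for f using affmap_measurable by simp
  have pr0: "prob_space (density (lebRn k) (\<lambda>y. ennreal (w0 y)))"
    using pr unfolding mu0 by (rule prob_space_distrD[OF am])
  obtain w where w: "w \<in> borel_measurable (lebRn k)" "\<And>x. 0 \<le> w x" "log_concave_on {..<k} w"
    and eq: "density (lebRn k) (\<lambda>y. ennreal (w0 y)) = density (lebRn k) (\<lambda>y. ennreal (w y))"
    by (rule borel_log_concave_version[OF _ lc0 pr0]) (auto simp: w0_def)
  note w(1)[measurable]
  have "1 = emeasure (density (lebRn k) (\<lambda>y. ennreal (w y))) (space (lebRn k))"
    using prob_space.emeasure_space_1[OF pr0[unfolded eq]] by simp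
  also have "\<dots> = (\<integral>\<^sup>+ x. ennreal (w x) \<partial>lebRn k)"
    by (subst emeasure_density) (auto intro!: nn_integral_cong simp: indicator_def)
  finally have one: "(\<integral>\<^sup>+ x. ennreal (w x) \<partial>lebRn k) = 1" by simp
  have int: "integrable (lebRn k) w" by (rule integrableI_nonneg) (use w one in auto)
  moreover have "(\<integral>x. w x \<partial>lebRn k) = 1"
    using one by (subst integral_eq_nn_integral) (use w in auto)
  ultimately show ?thesis using w mu0 eq by (intro exI[of _ k] exI[of _ a] exI[of _ b] exI[of _ w]) simp
qed

text \<open>The Lipschitz constant comes from the bounded second derivative by the mean value
  theorem. It is left existential because it drops out of the final bound.\<close>

lemma Cb_inf_test_fun:
  assumes "Cb_inf \<phi>" "\<forall>t. \<bar>\<phi> t\<bar> \<le> 1"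
  obtains K where "test_fun \<phi> (deriv \<phi>) (sup_norm (deriv \<phi>))" "\<And>x y. \<bar>deriv \<phi> x - deriv \<phi> y\<bar> \<le> K * \<bar>x - y\<bar>"
proof -
  obtain G :: "nat \<Rightarrow> real \<Rightarrow> real" where G0: "G 0 = \<phi>" and G: "\<And>k x. (G k has_real_derivative G (Suc k) x) (at x)"
    and bd: "\<And>k. bounded (range (G k))" using assms(1) unfolding Cb_inf_def by blast
  have dphi: "deriv \<phi> = G 1" using G[of 0] G0 by (auto intro!: DERIV_imp_deriv)
  obtain K1 where K1: "\<And>x. \<bar>G 1 x\<bar> \<le> K1" using bd[of 1] unfolding bounded_iff by auto
  obtain K2 where K2: "\<And>x. \<bar>G 2 x\<bar> \<le> K2" using bd[of 2] unfolding bounded_iff by auto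
  have G2: "(G 1 has_real_derivative G 2 x) (at x)" for x using G[of 1 x] by (simp add: numeral_2_eq_2)
  have "test_fun \<phi> (deriv \<phi>) (sup_norm (deriv \<phi>))"
    unfolding test_fun_def
  proof (intro conjI allI)
    show "(\<phi> has_real_derivative deriv \<phi> x) (at x)" for x using G[of 0 x] G0 dphi by simp
    show "continuous_on UNIV (deriv \<phi>)" unfolding dphi
      using G2 by (intro continuous_at_imp_continuous_on) (auto intro: DERIV_isCont)
    show "\<bar>deriv \<phi> x\<bar> \<le> sup_norm (deriv \<phi>)" for x
      unfolding sup_norm_def dphi by (rule cSUP_upper) (use K1 in \<open>auto intro!: bdd_aboveI[of _ K1]\<close>)
  qed (use assms in auto)
  moreover have lt: "\<bar>G 1 y - G 1 x\<bar> \<le> K2 * (y - x)" if xy: "x < y" for x y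
  proof -
    obtain z where "G 1 y - G 1 x = (y - x) * G 2 z" using MVT2[OF xy, of "G 1" "G 2"] G2 by blast
    then show ?thesis using K2[of z] xy by (simp add: abs_mult mult.commute)
  qed
  have "\<bar>deriv \<phi> x - deriv \<phi> y\<bar> \<le> K2 * \<bar>x - y\<bar>" for x y
    unfolding dphi using lt[of x y] lt[of y x] by (cases x y rule: linorder_cases) auto
  ultimately show ?thesis by (rule that)
qed

theorem theorem4p1:
  fixes d :: nat
  assumes "d \<ge> 2"
  shows "\<exists>C::real. \<forall>(n::nat) (\<mu>::(nat \<Rightarrow> real) measure) (f::(nat \<Rightarrow> real) \<Rightarrow> real) (\<phi>::real \<Rightarrow> real).
           log_concave n \<mu> \<and> poly_deg_le n d f \<and> Cb_inf \<phi> \<and> (\<forall>t. \<bar>\<phi> t\<bar> \<le> 1) \<longrightarrow>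
           sqrt (var \<mu> f) powr (1 / real d) * (\<integral>x. deriv \<phi> (f x) \<partial>\<mu>)
             \<le> C * sup_norm (deriv \<phi>) powr (1 - 1 / real d)"
proof -
  obtain E where E: "oscillation_constant d E" using oscillation_constant_exists by blast
  have E0: "0 < E" using E by (simp add: oscillation_constant_def)
  \<comment> \<open>E is chosen for d alone, hence so is C; both are fixed before n, \<mu>, f and
    \<phi>.\<close>
  define C where "C = sqrt (2 * moment_constant d E (1/4)) powr (1 / d) * (40 * (1 + E * 801))"
  have C0: "0 \<le> C" using E0 by (simp add: C_def)
  show ?thesis
  proof (intro exI[of _ C] allI impI, elim conjE)
    fix n \<mu> f \<phi>
    assume lc: "log_concave n \<mu>" and f: "poly_deg_le n d f" and phi: "Cb_inf \<phi>" "\<forall>t. \<bar>\<phi> t\<bar> \<le> 1"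
    define M where "M = sup_norm (deriv \<phi>)"
    obtain K where t0: "test_fun \<phi> (deriv \<phi>) (sup_norm (deriv \<phi>))"
      and lip: "\<And>x y. \<bar>deriv \<phi> x - deriv \<phi> y\<bar> \<le> K * \<bar>x - y\<bar>"
      using Cb_inf_test_fun[OF phi] by blast
    have t: "test_fun \<phi> (deriv \<phi>) M" using t0 by (simp add: M_def)
    have DM: "\<bar>deriv \<phi> x\<bar> \<le> M" for x using t unfolding test_fun_def by blast
    have "0 \<le> M" using DM[of 0] by linarith
    obtain k a b w where wm[measurable]: "w \<in> borel_measurable (lebRn k)" and nn: "\<And>x. 0 \<le> w x"
      and lcw: "log_concave_on {..<k} w" and wint: "integrable (lebRn k) w" and w1: "(\<integral>x. w x \<partial>lebRn k) = 1"
      and mu: "\<mu> = distr (density (lebRn k) (\<lambda>x. ennreal (w x))) (lebRn n) (affmap n k a b)"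
      using log_concave_density_exists[OF lc] by (elim exE conjE) (rule that, simp_all)
    define F where "F = (\<lambda>y. f (affmap n k a b y))"
    have fm[measurable]: "f \<in> borel_measurable (lebRn n)" by (rule poly_measurable[OF f])
    have Fm[measurable]: "F \<in> borel_measurable (lebRn k)"
      unfolding F_def by (rule measurable_compose[OF affmap_measurable fm])
    have Dm[measurable]: "deriv \<phi> \<in> borel_measurable borel"
      using t by (intro borel_measurable_continuous_onI) (simp add: test_fun_def)
    have am: "affmap n k a b \<in> measurable (density (lebRn k) (\<lambda>x. ennreal (w x))) (lebRn n)"
      using affmap_measurable by simp
    have int: "(\<integral>x. g (f x) \<partial>\<mu>) = (\<integral>y. g (F y) * w y \<partial>lebRn k)" if [measurable]: "g \<in> borel_measurable borel" for g :: "real \<Rightarrow> real"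
    proof -
      have "(\<integral>x. g (f x) \<partial>\<mu>) = (\<integral>y. g (F y) \<partial>density (lebRn k) (\<lambda>x. ennreal (w x)))"
        unfolding mu F_def by (rule integral_distr[OF am]) measurable
      also have "\<dots> = (\<integral>y. g (F y) * w y \<partial>lebRn k)"
        using nn by (subst integral_density) (auto simp: mult.commute)
      finally show ?thesis .
    qed
    have mean: "(\<integral>y. f y \<partial>\<mu>) = (\<integral>y. F y * w y \<partial>lebRn k)" using int[of "\<lambda>x. x"] by simp
    have V: "var \<mu> f = (\<integral>x. (F x - (\<integral>y. F y * w y \<partial>lebRn k))\<^sup>2 * w x \<partial>lebRn k)"
      unfolding var_def mean by (rule int) measurable
    have I: "(\<integral>x. deriv \<phi> (f x) \<partial>\<mu>) = (\<integral>x. deriv \<phi> (F x) * w x \<partial>lebRn k)" by (rule int) measurable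
    have "sqrt (var \<mu> f) powr (1 / real d) * (\<integral>x. deriv \<phi> (f x) \<partial>\<mu>) \<le> C * M powr (1 - 1 / real d)"
    \<comment> \<open>For k = 0 the measure is a point mass and the variance vanishes; for M = 0 the
      derivative vanishes. Both are set aside because a needle needs a coordinate and the cut-off is
      1/M.\<close>
    proof (cases "k = 0 \<or> M = 0")
      case True
      have zero: "sqrt (var \<mu> f) powr (1 / real d) * (\<integral>x. deriv \<phi> (f x) \<partial>\<mu>) = 0"
      proof (cases "M = 0")
        case True
        then have "deriv \<phi> x = 0" for x using DM[of x] by simp
        then show ?thesis by simp
      next
        case False
        then have k: "k = 0" using True by simp
        \<comment> \<open>The product space over no coordinates consists of this single
          function.\<close>
        define c where "c = F (\<lambda>_. undefined)"
        have Fc: "F x = c" if "x \<in> space (lebRn k)" for x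
          using that by (simp add: k lebRn_def space_PiM c_def)
        have "(\<integral>y. F y * w y \<partial>lebRn k) = (\<integral>y. c * w y \<partial>lebRn k)" by (intro Bochner_Integration.integral_cong) (auto simp: Fc)
        also have "\<dots> = c" using w1 by simp
        finally have "var \<mu> f = (\<integral>x. (F x - c)\<^sup>2 * w x \<partial>lebRn k)" unfolding V by simp
        also have "\<dots> = (\<integral>x. 0 \<partial>lebRn k)" by (intro Bochner_Integration.integral_cong) (auto simp: Fc)
        finally show ?thesis by simp
      qed
      show ?thesis unfolding zero using C0 by simp
    next
      case False
      then have "0 < k" "0 < M" using \<open>0 \<le> M\<close> by auto
      then show ?thesis unfolding V I C_def F_def
        using density_estimate[OF _ wm nn lcw wint w1 poly_affine_lines[OF f] poly_affine_lipschitz[OF f] Fm[unfolded F_def] E assms t _ lip]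
        by (simp add: mult.assoc)
    qed
    then show "sqrt (var \<mu> f) powr (1 / real d) * (\<integral>x. deriv \<phi> (f x) \<partial>\<mu>) \<le> C * sup_norm (deriv \<phi>) powr (1 - 1 / real d)"
      by (simp add: M_def)
  qed
qed

end
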